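(* Let $A$ be a constant with $\frac12\cdot\frac1{4\pi}<A<\frac1{4\pi}$, and for every integer $n\ge 1$ let $U_n(y)=y+\frac{A}{n}\sin(4n\pi y)$, $y\in[0,1]$. Then, under the 2D Euler dynamics, the shears $U_n$ are linearly unstable. More precisely, there is a constant $c_0>0$ independent of $n$ such that for every $n\ge1$ there exists an unstable eigenmode curve $(\alpha,c(\alpha))$, with $\operatorname{Im}c(\alpha)>0$, of the Rayleigh equation associated with $U_n$, stemming from a neutral mode $(\alpha_n,\tfrac12)$ where $\alpha_n\ge c_0 n$. The corresponding unstable eigenfunctions belong to $C^\infty(0,1)$.
   Context: For a shear profile $U(y)$ on $[0,1]$, the Rayleigh equation (the linearization of the 2D Euler equation in the channel $0<y<1$ at the steady shear flow $(U(y),0)$, for perturbations with stream function $\psi=\phi(y)e^{i\alpha(x-ct)}$) is $$U''\phi-(U-c)\left[\partial_y^2-\alpha^2\right]\phi=0,\qquad \phi(0)=\phi(1)=0 .$$ A pair $(\alpha,c)$ with $\alpha>0$ and $c\in\mathbb{C}$ is an eigenmode of the Rayleigh equation if this boundary value problem has a nontrivial solution $\phi$, called an eigenfunction. The eigenmode is called unstable if $\operatorname{Im}c>0$ and neutral if $\operatorname{Im}c=0$. The shear is linearly unstable if an unstable eigenmode exists. An unstable eigenmode curve stemming from a neutral mode $(\alpha_n,\frac12)$ means: a continuous function $c(\alpha)$ defined on an interval of wave numbers having $\alpha_n$ as an end point, such that $(\alpha,c(\alpha))$ is an unstable eigenmode for each $\alpha$ in that interval and $c(\alpha)\to\frac12$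 as $\alpha\to\alpha_n$. *)

theory Defs
  imports "HOL-Analysis.Analysis"
begin

text \<open>Derivatives on the channel \<open>[0,1]\<close> are taken within \<open>{0..1}\<close>, so they are one-sided at
  the walls and values of a function outside the channel are irrelevant.\<close>

definition chan_deriv :: "(real \<Rightarrow> 'a::real_normed_vector) \<Rightarrow> real \<Rightarrow> 'a" where
  "chan_deriv f y = vector_derivative f (at y within {0..1})"

definition C2_chan :: "(real \<Rightarrow> 'a::real_normed_vector) \<Rightarrow> bool" where
  "C2_chan f \<longleftrightarrow> f differentiable_on {0..1} \<and> chan_deriv f differentiable_on {0..1} \<and>
     continuous_on {0..1} (chan_deriv (chan_deriv f))"

definition smooth_open_chan :: "(real \<Rightarrow> 'a::real_normed_vector) \<Rightarrow> bool" where
  "smooth_open_chan f \<longleftrightarrow>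
     (\<forall>k. \<forall>y\<in>{0<..<1}. (((\<lambda>g x. vector_derivative g (at x)) ^^ k) f) differentiable (at y))"

text \<open>Solutions are classical (\<open>C\<^sup>2\<close> up to the walls), also for neutral modes. The equation is
  kept undivided: where \<open>U = c\<close> it only says \<open>U'' \<phi> = 0\<close>.\<close>

definition rayleigh_eigenfunction ::
    "(real \<Rightarrow> real) \<Rightarrow> real \<Rightarrow> complex \<Rightarrow> (real \<Rightarrow> complex) \<Rightarrow> bool" where
  "rayleigh_eigenfunction U \<alpha> c \<phi> \<longleftrightarrow>
     C2_chan \<phi> \<and>
     (\<forall>y\<in>{0..1}. of_real (chan_deriv (chan_deriv U) y) * \<phi> y
        - (of_real (U y) - c) * (chan_deriv (chan_deriv \<phi>) y - (of_real \<alpha>)\<^sup>2 * \<phi> y) = 0) \<and>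
     \<phi> 0 = 0 \<and> \<phi> 1 = 0 \<and> (\<exists>y\<in>{0..1}. \<phi> y \<noteq> 0)"

definition rayleigh_eigenmode :: "(real \<Rightarrow> real) \<Rightarrow> real \<Rightarrow> complex \<Rightarrow> bool" where
  "rayleigh_eigenmode U \<alpha> c \<longleftrightarrow> \<alpha> > 0 \<and> (\<exists>\<phi>. rayleigh_eigenfunction U \<alpha> c \<phi>)"

definition unstable_eigenmode :: "(real \<Rightarrow> real) \<Rightarrow> real \<Rightarrow> complex \<Rightarrow> bool" where
  "unstable_eigenmode U \<alpha> c \<longleftrightarrow> rayleigh_eigenmode U \<alpha> c \<and> Im c > 0"

definition neutral_eigenmode :: "(real \<Rightarrow> real) \<Rightarrow> real \<Rightarrow> complex \<Rightarrow> bool" where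
  "neutral_eigenmode U \<alpha> c \<longleftrightarrow> rayleigh_eigenmode U \<alpha> c \<and> Im c = 0"

definition linearly_unstable :: "(real \<Rightarrow> real) \<Rightarrow> bool" where
  "linearly_unstable U \<longleftrightarrow> (\<exists>\<alpha> c. unstable_eigenmode U \<alpha> c)"

text \<open>\<open>I\<close> is a nondegenerate interval with end point \<open>\<alpha>\<^sub>0\<close>. That \<open>\<alpha>\<^sub>0 \<notin> I\<close> is a consequence:
  otherwise continuity would give \<open>c \<alpha>\<^sub>0 = c\<^sub>0\<close>, which is not unstable.\<close>

definition unstable_curve_from ::
    "(real \<Rightarrow> real) \<Rightarrow> real \<Rightarrow> complex \<Rightarrow> real set \<Rightarrow> (real \<Rightarrow> complex) \<Rightarrow> bool" where
  "unstable_curve_from U \<alpha>\<^sub>0 c\<^sub>0 I c \<longleftrightarrow>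
     neutral_eigenmode U \<alpha>\<^sub>0 c\<^sub>0 \<and>
     is_interval I \<and> interior I \<noteq> {} \<and> \<alpha>\<^sub>0 \<in> frontier I \<and>
     continuous_on I c \<and>
     (\<forall>\<alpha>\<in>I. unstable_eigenmode U \<alpha> (c \<alpha>)) \<and>
     (c \<longlongrightarrow> c\<^sub>0) (at \<alpha>\<^sub>0 within I)"

definition shear_profile :: "real \<Rightarrow> nat \<Rightarrow> real \<Rightarrow> real" where
  "shear_profile A n y = y + A / real n * sin (4 * real n * pi * y)"

end

theory Submission
  imports Defs "HOL-Complex_Analysis.Complex_Analysis"
begin

text \<open>Put \<open>c = 1/2 + \<i> s\<close> with real \<open>s\<close> and \<open>\<lambda> = \<alpha>\<^sup>2\<close>. Since \<open>U - 1/2\<close> is odd about the middle of the channel,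
  \<open>\<phi> \<mapsto> cnj (\<phi> (1 - y))\<close> preserves the Rayleigh equation, which makes the value \<open>D s \<lambda>\<close> at \<open>y = 1\<close> of the
  solution with \<open>\<phi> 0 = 0\<close>, \<open>\<phi>' 0 = 1\<close> real. Unstable modes are thus the zeros of a real function of two real
  variables. The potential \<open>U'' / (U - c)\<close> stays bounded and converges in \<open>L\<^sup>1\<close> as \<open>s \<rightarrow> 0\<close>, so \<open>D\<close> is
  continuous up to \<open>s = 0\<close>, where it changes sign at the ground state \<open>\<lambda>\<^sub>0\<close> of the neutral problem.

  Uniqueness comes from Wronskians. Two zeros with the same \<open>s\<close> would give \<open>\<integral> \<phi>\<^sub>1 \<phi>\<^sub>2 = 0\<close>, against \<open>\<integral> \<phi>\<^sub>0\<^sup>2 > 0\<close>.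
  Two zeros with the same \<open>\<lambda>\<close> would give \<open>\<integral> U'' \<phi>\<^sub>1 \<phi>\<^sub>2 / ((U - c\<^sub>1) (U - c\<^sub>2)) = 0\<close>, whose imaginary part is
  bounded away from \<open>0\<close> by the contribution of the critical layer, proportional to \<open>U''' \<phi>\<^sub>0\<^sup>2\<close> at \<open>y = 1/2\<close>. Hence
  the zeros near \<open>(0, \<lambda>\<^sub>0)\<close> form a curve on which \<open>s\<close> is a continuous function of \<open>\<lambda>\<close>. That
  \<open>\<lambda>\<^sub>0 \<ge> n\<^sup>2 / 100\<close> is seen with a test function supported on \<open>\<bar>y - 1/2\<bar> \<le> 1 / (4 n)\<close>, on which the problem
  scales exactly.\<close>

section \<open>Shooting for linear second-order equations\<close>

text \<open>At a maximum point \<open>t0\<close> of \<open>u t * exp (- (2 * L * t))\<close> with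
  positive maximum, the integral term is at most half of \<open>u t0\<close>. It can therefore be
  absorbed on the left, which costs the factor 2.\<close>

lemma gronwall_unit_interval:
  fixes u :: "real \<Rightarrow> real"
  assumes cont: "continuous_on {0..1} u" and L: "L > 0" and e: "e \<ge> 0"
    and bd: "\<And>y. y \<in> {0..1} \<Longrightarrow> u y \<le> e + L * integral {0..y} u"
    and y: "y \<in> {0..1}"
  shows "u y \<le> 2 * e * exp (2 * L)"
proof -
  define g where "g = (\<lambda>t. u t * exp (- (2 * L * t)))"
  have "continuous_on {0..1} g"
    unfolding g_def by (intro continuous_intros cont)
  then obtain t0 where t0: "t0 \<in> {0..1}" and max: "\<And>t. t \<in> {0..1} \<Longrightarrow> g t \<le> g t0"
    using continuous_attains_sup[of "{0..1::real}" g] by auto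
  define m where "m = g t0"
  have u_le: "u t \<le> m * exp (2 * L * t)" if "t \<in> {0..1}" for t
    using max[OF that] by (simp add: g_def m_def exp_minus divide_simps mult.commute)
  have m_eq: "u t0 = m * exp (2 * L * t0)"
    by (simp add: m_def g_def exp_minus)
  have "m \<le> 2 * e"
  proof (cases "m \<le> 0")
    case True
    then show ?thesis using e by linarith
  next
    case False
    have exp_int: "((\<lambda>t. m * exp (2 * L * t)) has_integral
        m * exp (2 * L * t0) / (2 * L) - m * exp (2 * L * 0) / (2 * L)) {0..t0}"
      using t0 L by (intro fundamental_theorem_of_calculus)
        (auto intro!: derivative_eq_intros
          simp flip: has_real_derivative_iff_has_vector_derivative)
    have "integral {0..t0} u \<le> m * exp (2 * L * t0) / (2 * L) - m * exp (2 * L * 0) / (2 * L)"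
    proof (rule has_integral_le[OF integrable_integral exp_int])
      show "u integrable_on {0..t0}"
        using t0 by (intro integrable_continuous_interval continuous_on_subset[OF cont]) auto
    qed (use t0 u_le in auto)
    then have "integral {0..t0} u \<le> m * exp (2 * L * t0) / (2 * L)"
      using False L by (simp add: field_simps)
    then have "L * integral {0..t0} u \<le> m * exp (2 * L * t0) / 2"
      using L by (simp add: field_simps)
    then have "m * exp (2 * L * t0) \<le> 2 * e"
      using bd[OF t0] m_eq by linarith
    moreover have "m * 1 \<le> m * exp (2 * L * t0)"
      using False L t0 by (intro mult_left_mono) auto
    ultimately show ?thesis by linarith
  qed
  then have "m * exp (2 * L * y) \<le> 2 * e * exp (2 * L * y)"
    by (rule mult_right_mono) simp
  also have "\<dots> \<le> 2 * e * exp (2 * L)"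
    using e L y by (intro mult_left_mono) (auto simp: mult_le_cancel_left1)
  finally show ?thesis
    using u_le[OF y] by linarith
qed

text \<open>The equation \<open>\<phi>'' = q \<phi>\<close> as a first-order system, over any Banach
  field so that the real neutral problem and the complex unstable one share one theory. With the
  slope at 0 normalised, the eigenvalue condition is just \<open>\<phi> 1 = 0\<close>.\<close>

definition shoots :: "(real \<Rightarrow> 'a::{real_normed_field,banach}) \<Rightarrow> (real \<Rightarrow> 'a) \<Rightarrow> (real \<Rightarrow> 'a) \<Rightarrow> bool"
  where "shoots q \<phi> \<psi> \<longleftrightarrow> \<phi> 0 = 0 \<and> \<psi> 0 = 1 \<and>
    (\<forall>y\<in>{0..1}. (\<phi> has_vector_derivative \<psi> y) (at y within {0..1}) \<and>
      (\<psi> has_vector_derivative q y * \<phi> y) (at y within {0..1}))"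

lemma shootsD:
  assumes "shoots q \<phi> \<psi>"
  shows "\<phi> 0 = 0" "\<psi> 0 = 1"
    "\<And>y. y \<in> {0..1} \<Longrightarrow> (\<phi> has_vector_derivative \<psi> y) (at y within {0..1})"
    "\<And>y. y \<in> {0..1} \<Longrightarrow> (\<psi> has_vector_derivative q y * \<phi> y) (at y within {0..1})"
    "continuous_on {0..1} \<phi>" "continuous_on {0..1} \<psi>"
  using assms
  by (auto simp: shoots_def intro!: continuous_on_vector_derivative)

lemma integral_eq_of_has_vector_derivative:
  fixes f :: "real \<Rightarrow> 'a::banach"
  assumes "\<And>y. y \<in> {0..1} \<Longrightarrow> (f has_vector_derivative f' y) (at y within {0..1})" "y \<in> {0..1}"
  shows "(f' has_integral (f y - f 0)) {0..y}"
  using assms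
  by (intro fundamental_theorem_of_calculus)
     (auto intro: has_vector_derivative_within_subset[where S = "{0..1}"])

lemma norm_le_of_has_vector_derivative:
  fixes f :: "real \<Rightarrow> 'a::banach"
  assumes f: "\<And>y. y \<in> {0..1} \<Longrightarrow> (f has_vector_derivative f' y) (at y within {0..1})"
    and g: "continuous_on {0..1} g" and le: "\<And>y. y \<in> {0..1} \<Longrightarrow> norm (f' y) \<le> g y"
    and y: "y \<in> {0..1}"
  shows "norm (f y) \<le> norm (f 0) + integral {0..y} g"
proof -
  have "(f' has_integral (f y - f 0)) {0..y}"
    by (rule integral_eq_of_has_vector_derivative[OF f y])
  moreover have "g integrable_on {0..y}"
    using y by (intro integrable_continuous_interval continuous_on_subset[OF g]) auto
  ultimately have "norm (f y - f 0) \<le> integral {0..y} g"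
    using integral_norm_bound_integral[of f' "{0..y}" g] le y
    by (auto simp: has_integral_iff)
  then show ?thesis
    using norm_triangle_sub[of "f y" "f 0"] by linarith
qed

text \<open>Gronwall applied to \<open>norm d + norm e\<close>. The forcing \<open>r\<close> enters
  only through its \<open>L^1\<close> norm, which matters because the Rayleigh potentials converge
  in \<open>L^1\<close> but not uniformly.\<close>

lemma system_bound:
  fixes d e :: "real \<Rightarrow> 'a::{real_normed_field,banach}"
  assumes d: "\<And>y. y \<in> {0..1} \<Longrightarrow> (d has_vector_derivative e y) (at y within {0..1})"
    and e: "\<And>y. y \<in> {0..1} \<Longrightarrow> (e has_vector_derivative q y * d y + r y) (at y within {0..1})"
    and q: "\<And>y. y \<in> {0..1} \<Longrightarrow> norm (q y) \<le> M"
    and r: "continuous_on {0..1} r"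
    and y: "y \<in> {0..1}"
  shows "norm (d y) + norm (e y)
    \<le> 2 * (norm (d 0) + norm (e 0) + integral {0..1} (\<lambda>t. norm (r t))) * exp (2 * (1 + M))"
proof (rule gronwall_unit_interval[OF _ _ _ _ y])
  have contd: "continuous_on {0..1} d" and conte: "continuous_on {0..1} e"
    by (rule continuous_on_vector_derivative, erule d) (rule continuous_on_vector_derivative, erule e)
  note cont = contd conte r
  have M: "M \<ge> 0"
    using q[of 0] order_trans[OF norm_ge_zero[of "q 0"]] by auto
  then show "0 < 1 + M" by simp
  show "continuous_on {0..1} (\<lambda>y. norm (d y) + norm (e y))"
    by (intro continuous_intros cont)
  have r_int: "(\<lambda>t. norm (r t)) integrable_on {0..1}"
    by (intro integrable_continuous_interval continuous_intros cont)
  then show "0 \<le> norm (d 0) + norm (e 0) + integral {0..1} (\<lambda>t. norm (r t))"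
    by (intro add_nonneg_nonneg integral_nonneg) auto
  fix y :: real assume y: "y \<in> {0..1}"
  have conty: "continuous_on {0..y} d" "continuous_on {0..y} e" "continuous_on {0..y} r"
    using y by (auto intro: continuous_on_subset[OF contd] continuous_on_subset[OF conte]
        continuous_on_subset[OF r])
  have "norm (d y) \<le> norm (d 0) + integral {0..y} (\<lambda>t. norm (e t))"
    by (rule norm_le_of_has_vector_derivative[OF d _ _ y]) (auto intro!: continuous_intros cont)
  moreover have "norm (e y) \<le> norm (e 0) + integral {0..y} (\<lambda>t. M * norm (d t) + norm (r t))"
  proof (rule norm_le_of_has_vector_derivative[OF e _ _ y])
    show "norm (q t * d t + r t) \<le> M * norm (d t) + norm (r t)" if "t \<in> {0..1}" for t
      using norm_triangle_ineq[of "q t * d t" "r t"] q[OF that]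
        mult_right_mono[OF q[OF that] norm_ge_zero[of "d t"]] by (simp add: norm_mult)
  qed (auto intro!: continuous_intros cont)
  moreover have "integral {0..y} (\<lambda>t. M * norm (d t) + norm (r t))
      = M * integral {0..y} (\<lambda>t. norm (d t)) + integral {0..y} (\<lambda>t. norm (r t))"
    by (subst integral_add)
       (auto intro!: integrable_continuous_interval continuous_intros conty)
  moreover have "integral {0..y} (\<lambda>t. norm (r t)) \<le> integral {0..1} (\<lambda>t. norm (r t))"
    using y by (intro integral_subset_le r_int)
      (auto intro!: integrable_continuous_interval continuous_intros conty)
  moreover have "integral {0..y} (\<lambda>t. norm (d t) + norm (e t))
      = integral {0..y} (\<lambda>t. norm (d t)) + integral {0..y} (\<lambda>t. norm (e t))"
    by (rule integral_add) (auto intro!: integrable_continuous_interval continuous_intros conty)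
  moreover have "M * integral {0..y} (\<lambda>t. norm (e t)) \<ge> 0" "integral {0..y} (\<lambda>t. norm (d t)) \<ge> 0"
    using M by (auto intro!: mult_nonneg_nonneg integral_nonneg integrable_continuous_interval
        continuous_intros conty)
  ultimately show "norm (d y) + norm (e y)
      \<le> norm (d 0) + norm (e 0) + integral {0..1} (\<lambda>t. norm (r t))
        + (1 + M) * integral {0..y} (\<lambda>t. norm (d t) + norm (e t))"
    by (simp add: algebra_simps)
qed

lemma shoots_bound:
  assumes "shoots q \<phi> \<psi>" "\<And>y. y \<in> {0..1} \<Longrightarrow> norm (q y) \<le> M" "y \<in> {0..1}"
  shows "norm (\<phi> y) + norm (\<psi> y) \<le> 2 * exp (2 * (1 + M))"
  using system_bound[of \<phi> \<psi> q "\<lambda>_. 0" M y] shootsD[OF assms(1)] assms(2,3) by simp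

text \<open>The difference of the two solutions solves the first system with forcing
  \<open>(q1 - q2) * \<phi>2\<close> and zero initial data.\<close>

lemma shoots_stable:
  assumes 1: "shoots q1 \<phi>1 \<psi>1" and 2: "shoots q2 \<phi>2 \<psi>2"
    and M1: "\<And>y. y \<in> {0..1} \<Longrightarrow> norm (q1 y) \<le> M" and M2: "\<And>y. y \<in> {0..1} \<Longrightarrow> norm (q2 y) \<le> M"
    and c1: "continuous_on {0..1} q1" and c2: "continuous_on {0..1} q2"
    and y: "y \<in> {0..1}"
  shows "norm (\<phi>1 y - \<phi>2 y) + norm (\<psi>1 y - \<psi>2 y)
    \<le> 4 * exp (4 * (1 + M)) * integral {0..1} (\<lambda>t. norm (q1 t - q2 t))"
proof -
  have "norm (\<phi>1 y - \<phi>2 y) + norm (\<psi>1 y - \<psi>2 y)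
    \<le> 2 * (norm (\<phi>1 0 - \<phi>2 0) + norm (\<psi>1 0 - \<psi>2 0)
        + integral {0..1} (\<lambda>t. norm ((q1 t - q2 t) * \<phi>2 t))) * exp (2 * (1 + M))"
  proof (rule system_bound[OF _ _ M1 _ y])
    show "((\<lambda>y. \<psi>1 y - \<psi>2 y) has_vector_derivative
         q1 y * (\<phi>1 y - \<phi>2 y) + (q1 y - q2 y) * \<phi>2 y) (at y within {0..1})" if "y \<in> {0..1}" for y
      using that by (auto intro!: derivative_eq_intros shootsD[OF 1] shootsD[OF 2] simp: algebra_simps)
  qed (auto intro!: derivative_eq_intros shootsD[OF 1] shootsD[OF 2] continuous_intros c1 c2)
  also have "norm (\<phi>1 0 - \<phi>2 0) + norm (\<psi>1 0 - \<psi>2 0) = 0"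
    using shootsD[OF 1] shootsD[OF 2] by simp
  also have "integral {0..1} (\<lambda>t. norm ((q1 t - q2 t) * \<phi>2 t))
      \<le> integral {0..1} (\<lambda>t. 2 * exp (2 * (1 + M)) * norm (q1 t - q2 t))"
  proof (intro integral_le)
    fix t :: real assume t: "t \<in> {0..1}"
    have "norm (\<phi>2 t) \<le> 2 * exp (2 * (1 + M))"
      using shoots_bound[OF 2 M2 t] norm_ge_zero[of "\<psi>2 t"] by linarith
    from mult_left_mono[OF this norm_ge_zero[of "q1 t - q2 t"]]
    show "norm ((q1 t - q2 t) * \<phi>2 t) \<le> 2 * exp (2 * (1 + M)) * norm (q1 t - q2 t)"
      by (simp add: norm_mult mult_ac)
  qed (intro integrable_continuous_interval continuous_intros c1 c2 shootsD[OF 2])+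
  also have "\<dots> = 2 * exp (2 * (1 + M)) * integral {0..1} (\<lambda>t. norm (q1 t - q2 t))"
    by simp
  finally have "norm (\<phi>1 y - \<phi>2 y) + norm (\<psi>1 y - \<psi>2 y)
      \<le> 4 * (exp (2 * (1 + M)) * exp (2 * (1 + M))) * integral {0..1} (\<lambda>t. norm (q1 t - q2 t))"
    by (simp add: mult_ac)
  also have "exp (2 * (1 + M)) * exp (2 * (1 + M)) = exp (4 * (1 + M))"
    by (simp add: mult_exp_exp)
  finally show ?thesis .
qed

lemma shoots_unique:
  assumes "shoots q \<phi>1 \<psi>1" "shoots q \<phi>2 \<psi>2" "continuous_on {0..1} q" "y \<in> {0..1}"
  shows "\<phi>1 y = \<phi>2 y" "\<psi>1 y = \<psi>2 y"
proof -
  obtain M where M: "\<And>y. y \<in> {0..1} \<Longrightarrow> norm (q y) \<le> M"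
    using compact_imp_bounded[OF compact_continuous_image[OF assms(3) compact_Icc]]
    unfolding bounded_iff by fastforce
  have "norm (\<phi>1 y - \<phi>2 y) + norm (\<psi>1 y - \<psi>2 y) \<le> 0"
    using shoots_stable[OF assms(1,2) M M assms(3,3,4)] by simp
  then have "norm (\<phi>1 y - \<phi>2 y) \<le> 0" "norm (\<psi>1 y - \<psi>2 y) \<le> 0"
    using norm_ge_zero[of "\<psi>1 y - \<psi>2 y"] norm_ge_zero[of "\<phi>1 y - \<phi>2 y"] by linarith+
  then show "\<phi>1 y = \<phi>2 y" "\<psi>1 y = \<psi>2 y" by simp_all
qed

text \<open>\<open>\<psi>1 \<phi>2 - \<phi>1 \<psi>2\<close> vanishes at 0, so only the wall at 1
  contributes. If both solutions vanish there as well, the integral is 0; both uniqueness arguments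
  rest on this.\<close>

lemma wronskian:
  assumes 1: "shoots q1 \<phi>1 \<psi>1" and 2: "shoots q2 \<phi>2 \<psi>2"
  shows "((\<lambda>y. (q1 y - q2 y) * (\<phi>1 y * \<phi>2 y)) has_integral (\<psi>1 1 * \<phi>2 1 - \<phi>1 1 * \<psi>2 1)) {0..1}"
proof -
  have "((\<lambda>y. \<psi>1 y * \<phi>2 y - \<phi>1 y * \<psi>2 y) has_vector_derivative
      (q1 y - q2 y) * (\<phi>1 y * \<phi>2 y)) (at y within {0..1})" if "y \<in> {0..1}" for y
    using that by (auto intro!: derivative_eq_intros shootsD[OF 1] shootsD[OF 2] simp: algebra_simps)
  from integral_eq_of_has_vector_derivative[OF this, of 1] show ?thesis
    using shootsD[OF 1] shootsD[OF 2] by simp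
qed

section \<open>Existence of shooting solutions by a Picard series\<close>

fun picard :: "(real \<Rightarrow> 'a::{real_normed_field,banach}) \<Rightarrow> nat \<Rightarrow> (real \<Rightarrow> 'a) \<times> (real \<Rightarrow> 'a)" where
  "picard q 0 = ((\<lambda>_. 0), (\<lambda>_. 1))"
| "picard q (Suc k) = ((\<lambda>y. integral {0..y} (snd (picard q k))),
     (\<lambda>y. integral {0..y} (\<lambda>t. q t * fst (picard q k) t)))"

lemma picard_continuous:
  assumes "continuous_on {0..1} q"
  shows "continuous_on {0..1} (fst (picard q k)) \<and> continuous_on {0..1} (snd (picard q k))"
proof (induction k)
  case (Suc k)
  have "continuous_on {0..1} (\<lambda>t. q t * fst (picard q k) t)"
    by (intro continuous_intros assms conjunct1[OF Suc])
  then show ?case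
    using Suc
    by (auto intro!: continuous_on_vector_derivative[OF integral_has_vector_derivative])
qed auto

text \<open>\<open>picard q k\<close> is the \<open>k\<close>-th increment, not the
  \<open>k\<close>-th partial sum, of the iteration. Against the weight
  \<open>exp (2 * (1 + M) * y)\<close> each integration gains a factor 1/2, so the increments are
  summable uniformly in \<open>y\<close>.\<close>

lemma picard_bound:
  assumes q: "continuous_on {0..1} q" and M: "\<And>y. y \<in> {0..1} \<Longrightarrow> norm (q y) \<le> M"
    and y: "y \<in> {0..1}"
  shows "norm (fst (picard q k) y) + norm (snd (picard q k) y)
    \<le> (1/2) ^ k * exp (2 * (1 + M) * y)"
  using y
proof (induction k arbitrary: y)
  case 0
  have "M \<ge> 0"
    using M[of 0] order_trans[OF norm_ge_zero[of "q 0"]] by auto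
  with 0 show ?case by simp
next
  case (Suc k)
  define a where "a = fst (picard q k)"
  define b where "b = snd (picard q k)"
  have M0: "M \<ge> 0"
    using M[of 0] order_trans[OF norm_ge_zero[of "q 0"]] by auto
  have sub: "{0..y} \<subseteq> {0..1}" using Suc.prems by auto
  have cont: "continuous_on {0..y} a" "continuous_on {0..y} b" "continuous_on {0..y} q"
    using picard_continuous[OF q, of k] q sub
    by (auto simp: a_def b_def intro: continuous_on_subset)
  have "norm (integral {0..y} b) + norm (integral {0..y} (\<lambda>t. q t * a t))
    \<le> integral {0..y} (\<lambda>t. norm (b t)) + integral {0..y} (\<lambda>t. norm (q t * a t))"
    by (intro add_mono integral_norm_bound_integral integrable_continuous_interval
        continuous_intros cont) auto
  also have "\<dots> = integral {0..y} (\<lambda>t. norm (b t) + norm (q t * a t))"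
    by (intro integral_add[symmetric] integrable_continuous_interval continuous_intros cont)
  also have "\<dots> \<le> integral {0..y} (\<lambda>t. (1 + M) * ((1/2) ^ k * exp (2 * (1 + M) * t)))"
  proof (intro integral_le integrable_continuous_interval continuous_intros cont)
    fix t assume t: "t \<in> {0..y}"
    have "norm (q t * a t) \<le> M * norm (a t)"
      using t sub by (auto simp: norm_mult intro!: mult_right_mono M)
    then have "norm (b t) + norm (q t * a t) \<le> (1 + M) * (norm (a t) + norm (b t))"
      using mult_nonneg_nonneg[OF M0 norm_ge_zero[of "b t"]] norm_ge_zero[of "a t"]
      unfolding distrib_left distrib_right by linarith
    also have "\<dots> \<le> (1 + M) * ((1/2) ^ k * exp (2 * (1 + M) * t))"
      using Suc.IH[of t] t sub M0 by (intro mult_left_mono) (auto simp: a_def b_def)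
    finally show "norm (b t) + norm (q t * a t) \<le> (1 + M) * ((1/2) ^ k * exp (2 * (1 + M) * t))" .
  qed
  also have "\<dots> = (1/2) ^ Suc k * exp (2 * (1 + M) * y) - (1/2) ^ Suc k * exp (2 * (1 + M) * 0)"
    using Suc.prems M0
    by (intro integral_unique fundamental_theorem_of_calculus)
       (auto intro!: derivative_eq_intros simp flip: has_real_derivative_iff_has_vector_derivative)
  also have "\<dots> \<le> (1/2) ^ Suc k * exp (2 * (1 + M) * y)"
    by simp
  finally show ?case
    by (simp add: a_def b_def)
qed

lemma integral_tendsto_of_uniform_limit:
  fixes f :: "nat \<Rightarrow> real \<Rightarrow> 'a::banach"
  assumes "uniform_limit {a..b} f g sequentially" "\<And>n. continuous_on {a..b} (f n)"
  shows "(\<lambda>n. integral {a..b} (f n)) \<longlonglongrightarrow> integral {a..b} g"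
proof -
  obtain I J where IJ: "\<And>n. (f n has_integral I n) {a..b}" "(g has_integral J) {a..b}" "I \<longlonglongrightarrow> J"
    using uniform_limit_integral[OF assms trivial_limit_sequentially] by blast
  have "(\<lambda>n. integral {a..b} (f n)) = I" "integral {a..b} g = J"
    using IJ by (auto intro!: integral_unique)
  with IJ(3) show ?thesis by simp
qed

lemma shoots_exists:
  fixes q :: "real \<Rightarrow> 'a::{real_normed_field,banach}"
  assumes q: "continuous_on {0..1} q"
  shows "\<exists>\<phi> \<psi>. shoots q \<phi> \<psi>"
proof -
  obtain M where M: "\<And>y. y \<in> {0..1} \<Longrightarrow> norm (q y) \<le> M"
    using compact_imp_bounded[OF compact_continuous_image[OF q compact_Icc]]
    unfolding bounded_iff by fastforce
  have M0: "M \<ge> 0"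
    using M[of 0] order_trans[OF norm_ge_zero[of "q 0"]] by auto
  define a where "a = (\<lambda>k. fst (picard q k))"
  define b where "b = (\<lambda>k. snd (picard q k))"
  have ca: "continuous_on {0..1} (a k)" and cb: "continuous_on {0..1} (b k)" for k
    using picard_continuous[OF q, of k] by (auto simp: a_def b_def)
  define C where "C = exp (2 * (1 + M))"
  have bound: "norm (a k y) + norm (b k y) \<le> C * (1/2) ^ k" if "y \<in> {0..1}" for k y
  proof -
    have "exp (2 * (1 + M) * y) \<le> C"
      using that M0 by (auto simp: C_def mult_le_cancel_left1)
    then have "(1/2) ^ k * exp (2 * (1 + M) * y) \<le> (1/2) ^ k * C"
      by (intro mult_left_mono) auto
    moreover have "norm (a k y) + norm (b k y) \<le> (1/2) ^ k * exp (2 * (1 + M) * y)"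
      unfolding a_def b_def by (rule picard_bound[OF q M that])
    ultimately have "norm (a k y) + norm (b k y) \<le> (1/2) ^ k * C"
      by (rule order_trans[rotated])
    then show ?thesis
      by (subst mult.commute)
  qed
  have na: "norm (a k y) \<le> C * (1/2) ^ k" and nb: "norm (b k y) \<le> C * (1/2) ^ k" if "y \<in> {0..1}" for k y
    using bound[OF that, of k] norm_ge_zero[of "a k y"] norm_ge_zero[of "b k y"] by linarith+
  have sumC: "summable (\<lambda>k. C * (1/2) ^ k)"
    by (intro summable_mult summable_geometric) auto
  define \<phi> where "\<phi> = (\<lambda>y. \<Sum>k. a k y)"
  define \<psi> where "\<psi> = (\<lambda>y. \<Sum>k. b k y)"
  have suma: "summable (\<lambda>k. a k y)" and sumb: "summable (\<lambda>k. b k y)" if "y \<in> {0..1}" for y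
    by (rule summable_comparison_test'[OF sumC]; use na nb that in blast)+
  have lima: "uniform_limit {0..1} (\<lambda>n y. \<Sum>i<n. a i y) \<phi> sequentially"
    and limb: "uniform_limit {0..1} (\<lambda>n y. \<Sum>i<n. b i y) \<psi> sequentially"
    unfolding \<phi>_def \<psi>_def by (rule Weierstrass_m_test[OF _ sumC]; use na nb in blast)+
  have phi: "\<phi> y = integral {0..y} \<psi>" and psi: "\<psi> y = 1 + integral {0..y} (\<lambda>t. q t * \<phi> t)"
    and cphi: "continuous_on {0..1} \<phi>" and cpsi: "continuous_on {0..1} \<psi>" if y: "y \<in> {0..1}" for y
  proof -
    have sub: "{0..y} \<subseteq> {0..1}" using y by auto
    have la: "uniform_limit {0..y} (\<lambda>n y. \<Sum>i<n. a i y) \<phi> sequentially"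
      and lb: "uniform_limit {0..y} (\<lambda>n y. \<Sum>i<n. b i y) \<psi> sequentially"
      using lima limb uniform_limit_on_subset sub by blast+
    have cay: "continuous_on {0..y} (a k)" and cby: "continuous_on {0..y} (b k)"
      and cqy: "continuous_on {0..y} q" for k
      using ca cb q sub continuous_on_subset by blast+
    have "bounded (q ` {0..y})" 
      by (intro compact_imp_bounded compact_continuous_image cqy compact_Icc)
    moreover have "bounded (\<phi> ` {0..y})"
    proof -
      have "continuous_on {0..y} \<phi>"
        by (rule uniform_limit_theorem[OF _ la]) (auto intro!: always_eventually continuous_intros cay)
      then show ?thesis
        by (intro compact_imp_bounded compact_continuous_image compact_Icc)
    qed
    ultimately have lqa: "uniform_limit {0..y} (\<lambda>n t. q t * (\<Sum>i<n. a i t)) (\<lambda>t. q t * \<phi> t) sequentially"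
      by (intro uniform_lim_mult uniform_limit_const la)
    show "continuous_on {0..1} \<phi>"
      by (rule uniform_limit_theorem[OF _ lima]) (auto intro!: always_eventually continuous_intros ca)
    show "continuous_on {0..1} \<psi>"
      by (rule uniform_limit_theorem[OF _ limb]) (auto intro!: always_eventually continuous_intros cb)
    have L1: "(\<lambda>n. integral {0..y} (\<lambda>t. \<Sum>i<n. b i t)) \<longlonglongrightarrow> integral {0..y} \<psi>"
      by (rule integral_tendsto_of_uniform_limit[OF lb]) (intro continuous_intros cby)
    \<comment> \<open>Integration shifts the index of the increments by one. The shifted sum of the
      \<open>a\<close> loses only \<open>a 0 = 0\<close>, while that of the \<open>b\<close> loses
      the initial slope \<open>b 0 = 1\<close>.\<close>
    have E1: "integral {0..y} (\<lambda>t. \<Sum>i<n. b i t) = (\<Sum>i<n. a (Suc i) y)" for n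
      by (subst integral_sum) (auto intro!: integrable_continuous_interval cby, simp add: a_def b_def)
    have L2: "(\<lambda>n. \<Sum>i<n. a (Suc i) y) \<longlonglongrightarrow> \<phi> y"
    proof -
      have "a 0 y = 0" by (simp add: a_def)
      then show ?thesis
        using summable_LIMSEQ[OF summable_Suc_iff[THEN iffD2, OF suma[OF y]]]
          suminf_split_head[OF suma[OF y]] by (simp only: \<phi>_def diff_zero)
    qed
    show "\<phi> y = integral {0..y} \<psi>"
      by (rule LIMSEQ_unique[OF L2 L1[unfolded E1]])
    have L3: "(\<lambda>n. integral {0..y} (\<lambda>t. q t * (\<Sum>i<n. a i t))) \<longlonglongrightarrow> integral {0..y} (\<lambda>t. q t * \<phi> t)"
      by (rule integral_tendsto_of_uniform_limit[OF lqa]) (intro continuous_intros cay cqy)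
    have E2: "integral {0..y} (\<lambda>t. q t * (\<Sum>i<n. a i t)) = (\<Sum>i<n. b (Suc i) y)" for n
      unfolding sum_distrib_left
      by (subst integral_sum) (auto intro!: integrable_continuous_interval cay cqy continuous_intros, simp add: a_def b_def)
    have L4: "(\<lambda>n. \<Sum>i<n. b (Suc i) y) \<longlonglongrightarrow> \<psi> y - 1"
    proof -
      have "b 0 y = 1" by (simp add: b_def)
      then show ?thesis
        using summable_LIMSEQ[OF summable_Suc_iff[THEN iffD2, OF sumb[OF y]]]
          suminf_split_head[OF sumb[OF y]] by (simp only: \<psi>_def)
    qed
    have "\<psi> y - 1 = integral {0..y} (\<lambda>t. q t * \<phi> t)"
      by (rule LIMSEQ_unique[OF L4 L3[unfolded E2]])
    then show "\<psi> y = 1 + integral {0..y} (\<lambda>t. q t * \<phi> t)"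
      by (simp add: algebra_simps)
  qed
  have c: "continuous_on {0..1} \<phi>" "continuous_on {0..1} \<psi>"
    using cphi[of 0] cpsi[of 0] by auto
  have "(\<phi> has_vector_derivative \<psi> y) (at y within {0..1})" if "y \<in> {0..1}" for y
    by (rule has_vector_derivative_transform[OF that _ integral_has_vector_derivative[OF c(2) that]])
       (use phi in auto)
  moreover have "(\<psi> has_vector_derivative q y * \<phi> y) (at y within {0..1})" if "y \<in> {0..1}" for y
  proof (rule has_vector_derivative_transform[OF that])
    have "continuous_on {0..1} (\<lambda>t. q t * \<phi> t)"
      by (intro continuous_intros q c)
    from integral_has_vector_derivative[OF this that]
    show "((\<lambda>y. 1 + integral {0..y} (\<lambda>t. q t * \<phi> t)) has_vector_derivative q y * \<phi> y) (at y within {0..1})"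
      by (auto intro!: derivative_eq_intros)
  qed (use psi in auto)
  ultimately have "shoots q \<phi> \<psi>"
    using phi[of 0] psi[of 0] by (auto simp: shoots_def)
  then show ?thesis by blast
qed

text \<open>\<open>u\<^sup>2 + v\<^sup>2\<close> cannot decay faster than
  \<open>exp (- (1 + M) y)\<close>, since its derivative \<open>2 (1 + q) u v\<close> is at most
  \<open>(1 + M) (u\<^sup>2 + v\<^sup>2)\<close> in absolute value. Consequently all zeros of
  \<open>u\<close> are simple.\<close>

lemma shoots_energy:
  fixes u v q :: "real \<Rightarrow> real"
  assumes uv: "shoots q u v" and y: "y \<in> {0..1}"
    and M: "\<And>y. y \<in> {0..1} \<Longrightarrow> \<bar>q y\<bar> \<le> M"
  shows "(u y)\<^sup>2 + (v y)\<^sup>2 > 0"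
proof -
  define E where "E = (\<lambda>t. ((u t)\<^sup>2 + (v t)\<^sup>2) * exp ((1 + M) * t))"
  define E' where "E' = (\<lambda>t. ((1 + M) * ((u t)\<^sup>2 + (v t)\<^sup>2) + (1 + q t) * (2 * (u t * v t))) * exp ((1 + M) * t))"
  have "(E has_vector_derivative E' t) (at t within {0..1})" if "t \<in> {0..1}" for t
    using shootsD(3,4)[OF uv that] unfolding E_def E'_def
    by (auto intro!: derivative_eq_intros simp: algebra_simps power2_eq_square
        simp flip: has_real_derivative_iff_has_vector_derivative)
  from integral_eq_of_has_vector_derivative[OF this y]
  have int: "(E' has_integral E y - E 0) {0..y}" .
  have "E' t \<ge> 0" if "t \<in> {0..1}" for t
  proof -
    have "2 * \<bar>u t * v t\<bar> \<le> (u t)\<^sup>2 + (v t)\<^sup>2"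
      using sum_squares_bound[of "\<bar>u t\<bar>" "\<bar>v t\<bar>"] by (simp add: abs_mult)
    moreover have "\<bar>1 + q t\<bar> \<le> 1 + M" using M[OF that] by linarith
    ultimately have "\<bar>1 + q t\<bar> * (2 * \<bar>u t * v t\<bar>) \<le> (1 + M) * ((u t)\<^sup>2 + (v t)\<^sup>2)"
      by (intro mult_mono) auto
    then have "\<bar>(1 + q t) * (2 * (u t * v t))\<bar> \<le> (1 + M) * ((u t)\<^sup>2 + (v t)\<^sup>2)"
      unfolding abs_mult by simp
    then show ?thesis
      unfolding E'_def by (intro mult_nonneg_nonneg) auto
  qed
  then have "E y - E 0 \<ge> 0"
    using int y by (intro has_integral_nonneg[OF int]) auto
  moreover have "E 0 = 1"
    using shootsD[OF uv] by (simp add: E_def)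
  ultimately have "E y > 0" by linarith
  then show ?thesis
    by (simp add: E_def zero_less_mult_iff)
qed

section \<open>Ground states\<close>

text \<open>Since \<open>u 0 = 0\<close>, positivity next to the wall cannot be kept under
  perturbation by looking at \<open>u\<close> alone; a lower bound on the slope does it.\<close>

lemma shoots_lower_near_0:
  fixes u v q :: "real \<Rightarrow> real"
  assumes uv: "shoots q u v" and r: "r \<le> 1" and c: "\<And>t. t \<in> {0..r} \<Longrightarrow> c \<le> v t" and y: "y \<in> {0..r}"
  shows "c * y \<le> u y"
proof -
  have y1: "y \<in> {0..1}" using y r by auto
  have int: "(v has_integral (u y - u 0)) {0..y}"
    by (rule integral_eq_of_has_vector_derivative[OF shootsD(3)[OF uv] y1])
  have intc: "((\<lambda>_. c) has_integral (y *\<^sub>R c)) {0..y}"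
    using has_integral_const_real[of c 0 y] y by simp
  have "y *\<^sub>R c \<le> u y - u 0"
    by (rule has_integral_le[OF intc int]) (use c y in auto)
  then show ?thesis
    using shootsD[OF uv] by (simp add: mult.commute)
qed

lemma shoots_slope_near_0:
  fixes u v q :: "real \<Rightarrow> real"
  assumes uv: "shoots q u v"
  obtains r where "0 < r" "r \<le> 1" "\<And>t. t \<in> {0..r} \<Longrightarrow> 1/2 \<le> v t"
proof -
  have "continuous (at 0 within {0..1}) v"
    using shootsD(6)[OF uv] by (simp add: continuous_on_eq_continuous_within)
  then obtain d where d: "d > 0" "\<And>t. t \<in> {0..1} \<Longrightarrow> dist t 0 < d \<Longrightarrow> dist (v t) (v 0) < 1/2"
    unfolding continuous_within_eps_delta by (metis half_gt_zero_iff zero_less_one)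
  show thesis
  proof (rule that[of "min 1 (d/2)"])
    fix t assume "t \<in> {0..min 1 (d/2)}"
    then have "dist (v t) (v 0) < 1/2" using d by (intro d(2)) auto
    then show "1/2 \<le> v t" using shootsD(2)[OF uv] unfolding dist_real_def by linarith
  qed (use d in auto)
qed

text \<open>\<open>(u v)' = v\<^sup>2 + q u\<^sup>2\<close> is nonnegative, so \<open>u v\<close> is
  nonnegative and \<open>u\<^sup>2\<close> is nondecreasing. As \<open>u\<close> starts out
  positive, it never returns to 0.\<close>

lemma shoots_pos_of_nonneg_potential:
  fixes u v q :: "real \<Rightarrow> real"
  assumes uv: "shoots q u v" and q: "\<And>y. y \<in> {0..1} \<Longrightarrow> q y \<ge> 0" and y: "y \<in> {0<..1}"
  shows "u y > 0"
proof -
  obtain r where r: "0 < r" "r \<le> 1" "\<And>t. t \<in> {0..r} \<Longrightarrow> 1/2 \<le> v t"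
    using shoots_slope_near_0[OF uv] by metis
  have uv_nonneg: "u t * v t \<ge> 0" if "t \<in> {0..1}" for t
  proof -
    have "((\<lambda>y. u y * v y) has_vector_derivative (v y)\<^sup>2 + q y * (u y)\<^sup>2) (at y within {0..1})"
      if "y \<in> {0..1}" for y
      using that by (auto intro!: derivative_eq_intros shootsD[OF uv] simp: power2_eq_square)
    from integral_eq_of_has_vector_derivative[OF this that]
    have "u t * v t - u 0 * v 0 \<ge> 0"
      by (rule has_integral_nonneg) (use q that in auto)
    then show ?thesis using shootsD[OF uv] by simp
  qed
  have mono: "(u s)\<^sup>2 \<le> (u t)\<^sup>2" if st: "0 \<le> s" "s \<le> t" "t \<le> 1" for s t
  proof -
    have "((\<lambda>y. (u y)\<^sup>2) has_vector_derivative 2 * (u y * v y)) (at y within {s..t})"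
      if "y \<in> {s..t}" for y
      by (rule has_vector_derivative_within_subset[of _ _ _ "{0..1}"])
         (use that st in \<open>auto intro!: derivative_eq_intros shootsD[OF uv] simp: power2_eq_square\<close>)
    from fundamental_theorem_of_calculus[OF st(2) this]
    have "(u t)\<^sup>2 - (u s)\<^sup>2 \<ge> 0"
      by (rule has_integral_nonneg) (use uv_nonneg st in auto)
    then show ?thesis by simp
  qed
  have near: "u t > 0" if "t \<in> {0<..r}" for t
    using shoots_lower_near_0[OF uv r(2), of "1/2" t] r that by auto
  have nz: "u t \<noteq> 0" if "t \<in> {0<..1}" for t
  proof -
    define s where "s = min r t"
    have "u s > 0" using near[of s] r that by (auto simp: s_def)
    then have "0 < (u s)\<^sup>2" by simp
    also have "\<dots> \<le> (u t)\<^sup>2" using mono[of s t] r that by (auto simp: s_def)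
    finally show ?thesis by auto
  qed
  show ?thesis
  proof (rule ccontr)
    assume "\<not> u y > 0"
    then have neg: "u y \<le> 0" by simp
    have ry: "r \<le> y" using near[of y] neg y by force
    have "continuous_on {r..y} u"
      using r y by (intro continuous_on_subset[OF shootsD(5)[OF uv]]) auto
    from IVT2'[of u y 0 r, OF neg _ ry this] near[of r] r
    obtain x where "r \<le> x" "x \<le> y" "u x = 0" by auto
    then show False using nz[of x] r y by auto
  qed
qed

text \<open>Continuity method. The parameters whose solution fails to be positive on
  \<open>{0<..1}\<close> form a set \<open>B\<close> that contains \<open>\<mu>\<close>, is bounded
  above by \<open>P\<close> and has open complement. At \<open>l = Sup B\<close> the solution is
  nonnegative and has a zero in \<open>{0<..1}\<close>; an interior zero would be a double one, so
  it is at 1.\<close>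

theorem ground_state_exists:
  fixes p :: "real \<Rightarrow> real"
  assumes p: "continuous_on {0..1} p"
    and bad: "\<And>u v. shoots (\<lambda>y. \<mu> + p y) u v \<Longrightarrow> \<exists>y\<in>{0<..1}. u y \<le> 0"
  shows "\<exists>l u v. \<mu> \<le> l \<and> shoots (\<lambda>y. l + p y) u v \<and> u 1 = 0 \<and> (\<forall>y\<in>{0<..<1}. u y > 0)"
proof -
  obtain P where P: "\<And>y. y \<in> {0..1} \<Longrightarrow> \<bar>p y\<bar> \<le> P"
    using compact_imp_bounded[OF compact_continuous_image[OF p compact_Icc]]
    unfolding bounded_iff by fastforce
  have cq: "continuous_on {0..1} (\<lambda>y. l + p y)" for l
    by (intro continuous_intros p)
  have "\<forall>l. \<exists>u v. shoots (\<lambda>y. l + p y) u v"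
    using shoots_exists[OF cq] by blast
  then obtain u v where uv: "\<And>l. shoots (\<lambda>y. l + p y) (u l) (v l)"
    by metis
  define B where "B = {l. \<exists>y\<in>{0<..1}. u l y \<le> 0}"
  have stable: "\<exists>K>0. \<forall>l' y. \<bar>l' - l\<bar> \<le> 1 \<longrightarrow> y \<in> {0..1} \<longrightarrow>
      \<bar>u l' y - u l y\<bar> + \<bar>v l' y - v l y\<bar> \<le> K * \<bar>l' - l\<bar>" for l
  proof (intro exI conjI allI impI)
    fix l' y :: real assume l': "\<bar>l' - l\<bar> \<le> 1" and y: "y \<in> {0..1}"
    have "norm (u l' y - u l y) + norm (v l' y - v l y) \<le>
        4 * exp (4 * (1 + (\<bar>l\<bar> + 1 + P))) * integral {0..1} (\<lambda>t. norm ((l' + p t) - (l + p t)))"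
    proof (rule shoots_stable[OF uv uv _ _ cq cq y])
      fix y :: real assume "y \<in> {0..1}"
      then show "norm (l' + p y) \<le> \<bar>l\<bar> + 1 + P" "norm (l + p y) \<le> \<bar>l\<bar> + 1 + P"
        using P[of y] l' by auto
    qed
    then show "\<bar>u l' y - u l y\<bar> + \<bar>v l' y - v l y\<bar> \<le> 4 * exp (4 * (1 + (\<bar>l\<bar> + 1 + P))) * \<bar>l' - l\<bar>"
      by simp
  qed auto
  have notB: "u l y > 0" if "l \<notin> B" "y \<in> {0<..1}" for l y
  proof (rule ccontr)
    assume "\<not> u l y > 0"
    then have "u l y \<le> 0" by simp
    then show False using that by (auto simp: B_def)
  qed
  have in_good: "l \<notin> B" if "\<And>y. y \<in> {0<..1} \<Longrightarrow> u l y > 0" for l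
  proof
    assume "l \<in> B"
    then obtain y where "y \<in> {0<..1}" "u l y \<le> 0" by (auto simp: B_def)
    then show False using that[of y] by simp
  qed
  have open_good: "\<exists>\<delta>>0. \<forall>l'. \<bar>l' - l\<bar> < \<delta> \<longrightarrow> l' \<notin> B" if good: "l \<notin> B" for l
  proof -
    obtain K where K: "K > 0" "\<And>l' y. \<bar>l' - l\<bar> \<le> 1 \<Longrightarrow> y \<in> {0..1} \<Longrightarrow>
      \<bar>u l' y - u l y\<bar> + \<bar>v l' y - v l y\<bar> \<le> K * \<bar>l' - l\<bar>"
      using stable[of l] by blast
    obtain r where r: "0 < r" "r \<le> 1" "\<And>t. t \<in> {0..r} \<Longrightarrow> 1/2 \<le> v l t"
      using shoots_slope_near_0[OF uv[of l]] by metis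
    have "continuous_on {r..1} (u l)"
      using r by (intro continuous_on_subset[OF shootsD(5)[OF uv]]) auto
    then obtain t0 where t0: "t0 \<in> {r..1}" "\<And>t. t \<in> {r..1} \<Longrightarrow> u l t0 \<le> u l t"
      using continuous_attains_inf[of "{r..1}" "u l"] r by auto
    have "t0 \<in> {0<..1}" using t0(1) r(1) by auto
    then have m: "u l t0 > 0"  by (rule notB[OF good])
    \<comment> \<open>The entry 1/4 keeps the slope above 1/4 on \<open>{0..r}\<close>, where it was
      at least 1/2; the entry \<open>u l t0\<close> is the minimum of \<open>u l\<close> on
      \<open>{r..1}\<close> and keeps the solution positive there.\<close>
    define \<delta> where "\<delta> = min 1 (min (1/4) (u l t0) / K)"
    have "l' \<notin> B" if l': "\<bar>l' - l\<bar> < \<delta>" for l'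
    proof -
      have "K * \<bar>l' - l\<bar> < min (1/4) (u l t0)"
        using l' K by (auto simp: \<delta>_def field_simps)
      then have diff: "\<bar>u l' y - u l y\<bar> < u l t0" "\<bar>v l' y - v l y\<bar> < 1/4" if "y \<in> {0..1}" for y
        using K(2)[of l' y] that l' abs_ge_zero[of "u l' y - u l y"] abs_ge_zero[of "v l' y - v l y"]
        unfolding \<delta>_def min_less_iff_conj by linarith+
      have "u l' y > 0" if y: "y \<in> {0<..1}" for y
      proof (cases "y \<le> r")
        case True
        have "1/4 * y \<le> u l' y"
        proof (rule shoots_lower_near_0[OF uv r(2)])
          show "1/4 \<le> v l' t" if "t \<in> {0..r}" for t
          proof -
            have "\<bar>v l' t - v l t\<bar> < 1/4" using that r by (intro diff(2)) auto
            then show ?thesis using r(3)[OF that] by linarith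
          qed
        qed (use y True in auto)
        then show ?thesis using y by auto
      next
        case False
        then show ?thesis using diff(1)[of y] t0(2)[of y] y by auto
      qed
      then show ?thesis by (rule in_good)
    qed
    moreover have "\<delta> > 0" using m K by (auto simp: \<delta>_def)
    ultimately show ?thesis by blast
  qed
  have bdd: "l \<le> P" if "l \<in> B" for l
  proof (rule ccontr)
    assume "\<not> l \<le> P"
    then have "l + p y \<ge> 0" if "y \<in> {0..1}" for y using P[OF that] by auto
    then have "u l y > 0" if "y \<in> {0<..1}" for y
      using shoots_pos_of_nonneg_potential[OF uv] that by blast
    then show False using that in_good by blast
  qed
  then have bdd_above: "bdd_above B" by (auto simp: bdd_above_def)
  have muB: "\<mu> \<in> B" using bad[OF uv] by (auto simp: B_def)
  define l where "l = Sup B"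
  have mul: "\<mu> \<le> l" unfolding l_def by (rule cSup_upper[OF muB bdd_above])
  have above: "l' \<notin> B" if "l' > l" for l'
    using cSup_upper[OF _ bdd_above, of l'] that by (auto simp: l_def)
  have lB: "l \<in> B"
  proof (rule ccontr)
    assume "l \<notin> B"
    then obtain \<delta> where \<delta>: "\<delta> > 0" "\<And>l'. \<bar>l' - l\<bar> < \<delta> \<Longrightarrow> l' \<notin> B" using open_good by blast
    obtain l' where "l' \<in> B" "l - \<delta> < l'"
      using less_cSup_iff[OF _ bdd_above, of "l - \<delta>"] muB \<delta> by (auto simp: l_def)
    moreover have "l' \<le> l" using cSup_upper[OF \<open>l' \<in> B\<close> bdd_above] by (simp add: l_def)
    ultimately show False using \<delta>(2)[of l'] by auto
  qed
  have nonneg: "u l y \<ge> 0" if y: "y \<in> {0..1}" for y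
  proof (cases "y = 0")
    case True
    then show ?thesis using shootsD(1)[OF uv, of l] by simp
  next
    case False
    show ?thesis
    proof (rule ccontr)
      assume neg: "\<not> u l y \<ge> 0"
      obtain K where K: "K > 0" "\<And>l' y. \<bar>l' - l\<bar> \<le> 1 \<Longrightarrow> y \<in> {0..1} \<Longrightarrow>
        \<bar>u l' y - u l y\<bar> + \<bar>v l' y - v l y\<bar> \<le> K * \<bar>l' - l\<bar>"
        using stable[of l] by blast
      \<comment> \<open>Above \<open>l\<close>, hence outside \<open>B\<close>, but so close that
        the stability bound cannot lift the negative value at \<open>y\<close> above 0.\<close>
      define l' where "l' = l + min 1 (- u l y / K)"
      have "l' > l" using neg K(1) by (auto simp: l'_def divide_neg_pos)
      moreover have "\<bar>u l' y - u l y\<bar> \<le> K * \<bar>l' - l\<bar>"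
        using K(2)[OF _ y, of l'] \<open>l' > l\<close> abs_ge_zero[of "v l' y - v l y"]
        unfolding l'_def by linarith
      moreover have "K * \<bar>l' - l\<bar> \<le> - u l y"
        using K(1) neg by (auto simp: l'_def min_def field_simps)
      ultimately have "u l' y \<le> 0" by auto
      then show False using above[OF \<open>l' > l\<close>] y False by (auto simp: B_def)
    qed
  qed
  have pos: "u l y > 0" if y: "y \<in> {0<..<1}" for y
  proof (rule ccontr)
    assume "\<not> u l y > 0"
    then have 0: "u l y = 0" using nonneg[of y] y by auto
    have "(u l has_real_derivative v l y) (at y within {0..1})"
      using shootsD(3)[OF uv, of y] y by (simp add: has_real_derivative_iff_has_vector_derivative)
    then have "(u l has_real_derivative v l y) (at y)"
      using y by (subst (asm) at_within_Icc_at) auto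
    moreover have "u l y \<le> u l z" if "\<bar>y - z\<bar> < min y (1 - y)" for z
    proof -
      have "z \<in> {0..1}" using that unfolding atLeastAtMost_iff min_less_iff_conj by linarith
      then show ?thesis using nonneg[of z] 0 by simp
    qed
    ultimately have "v l y = 0"
      using y by (intro DERIV_local_min[of "u l" "v l y" y "min y (1 - y)"]) simp_all
    moreover have "(u l y)\<^sup>2 + (v l y)\<^sup>2 > 0"
    proof (rule shoots_energy[OF uv])
      show "\<bar>l + p y\<bar> \<le> \<bar>l\<bar> + P" if "y \<in> {0..1}" for y
        using P[OF that] by linarith
    qed (use y in auto)
    ultimately show False using 0 by simp
  qed
  obtain y where y: "y \<in> {0<..1}" "u l y \<le> 0" using lB by (auto simp: B_def)
  have "\<not> y < 1"
  proof
    assume "y < 1"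
    then have "u l y > 0" using y(1) by (intro pos) auto
    then show False using y(2) by simp
  qed
  then have "y = 1" using y(1) by auto
  then have "u l 1 = 0" using y nonneg[of 1] by auto
  then show ?thesis using mul uv pos by blast
qed

section \<open>Rayleigh potentials of odd profiles\<close>

text \<open>\<open>W\<close> is \<open>U - c\<close> for the neutral phase speed and \<open>p\<close> the regularised quotient of \<open>U''\<close> by \<open>W\<close>.\<close>

locale odd_profile =
  fixes W p :: "real \<Rightarrow> real" and m B P :: real
  assumes W_cont: "continuous_on {0..1} W" and p_cont: "continuous_on {0..1} p"
    and W_odd: "\<And>y. y \<in> {0..1} \<Longrightarrow> W (1 - y) = - W y"
    and p_even: "\<And>y. y \<in> {0..1} \<Longrightarrow> p (1 - y) = p y"
    and m_pos: "m > 0"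
    and W_lower: "\<And>y. y \<in> {0..1} \<Longrightarrow> m * \<bar>y - 1/2\<bar> \<le> \<bar>W y\<bar>"
    and W_upper: "\<And>y. y \<in> {0..1} \<Longrightarrow> \<bar>W y\<bar> \<le> B * \<bar>y - 1/2\<bar>"
    and p_bound: "\<And>y. y \<in> {0..1} \<Longrightarrow> \<bar>p y\<bar> \<le> P"
    and p_mid: "p (1/2) < 0"
begin

text \<open>The factor \<open>U - c\<close> once the phase speed has been moved off the real axis by
  \<open>i s\<close>.\<close>

definition den :: "real \<Rightarrow> real \<Rightarrow> complex" where
  "den s y = of_real (W y) - \<i> * of_real s"

text \<open>At \<open>s = 0\<close> the quotient \<open>W y / den s y\<close> would be \<open>0 / 0 = 0\<close> at the critical layer.\<close>

definition pot :: "real \<Rightarrow> real \<Rightarrow> real \<Rightarrow> complex" where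
  "pot s l y = of_real l + of_real (p y) * (if s = 0 then 1 else of_real (W y) / den s y)"

lemma P_nonneg: "P \<ge> 0"
  using p_bound[of "1/2"] by auto

lemma norm_den_ge: "\<bar>W y\<bar> \<le> norm (den s y)" "\<bar>s\<bar> \<le> norm (den s y)"
  using abs_Re_le_cmod[of "den s y"] abs_Im_le_cmod[of "den s y"] by (auto simp: den_def)

lemma den_nz: "s \<noteq> 0 \<Longrightarrow> den s y \<noteq> 0"
  using norm_den_ge(2)[of s y] by auto

lemma norm_W_div_den: "norm (of_real (W y) / den s y) \<le> 1"
  using norm_den_ge(1)[of y s] by (auto simp: norm_divide divide_le_eq_1)

lemma pot_bound:
  assumes "y \<in> {0..1}"
  shows "norm (pot s l y) \<le> \<bar>l\<bar> + P"
proof -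
  have "norm (of_real (p y) * (if s = 0 then 1 else of_real (W y) / den s y)) \<le> P * 1"
    unfolding norm_mult using p_bound[OF assms] P_nonneg norm_W_div_den[of y s]
    by (intro mult_mono) auto
  then show ?thesis
    unfolding pot_def by (intro norm_triangle_le) simp
qed

lemma den_cont: "continuous_on {0..1} (den s)"
  unfolding den_def by (intro continuous_intros W_cont)

lemma pot_cont: "continuous_on {0..1} (pot s l)"
proof (cases "s = 0")
  case True
  then show ?thesis unfolding pot_def by (auto intro!: continuous_intros p_cont)
next
  case False
  then show ?thesis
    unfolding pot_def by (auto intro!: continuous_intros p_cont W_cont den_cont den_nz)
qed

text \<open>Reflection flips \<open>W\<close> and turns \<open>den\<close> into minus its conjugate,
  so the quotient \<open>W / den\<close> is conjugated while \<open>p\<close> is unchanged.\<close>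

lemma pot_sym:
  assumes "y \<in> {0..1}"
  shows "pot s l (1 - y) = cnj (pot s l y)"
proof -
  have "den s (1 - y) = - cnj (den s y)"
    using W_odd[OF assms] by (simp add: den_def)
  then show ?thesis
    using W_odd[OF assms] p_even[OF assms] by (simp add: pot_def)
qed

lemma pot_diff_l: "pot s l y - pot s l' y = of_real (l - l')"
  by (simp add: pot_def)

text \<open>A resolvent identity, from \<open>den s' y - den s y = i (s - s')\<close>. The explicit
  factor \<open>s - s'\<close> is later divided out of the Wronskian.\<close>

lemma pot_diff_s:
  assumes "s \<noteq> 0" "s' \<noteq> 0"
  shows "pot s l y - pot s' l y
    = \<i> * of_real (s - s') * (of_real (p y * W y) / (den s y * den s' y))"
proof -
  have "of_real (W y) / den s y - of_real (W y) / den s' y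
      = \<i> * of_real (s - s') * (of_real (W y) / (den s y * den s' y))"
    using den_nz[OF assms(1), of y] den_nz[OF assms(2), of y]
    by (simp add: divide_simps) (simp add: den_def algebra_simps)
  then have "of_real (p y) * (of_real (W y) / den s y - of_real (W y) / den s' y)
      = of_real (p y) * (\<i> * of_real (s - s') * (of_real (W y) / (den s y * den s' y)))"
    by simp
  then show ?thesis
    using assms by (simp add: pot_def algebra_simps)
qed

text \<open>Uniform in \<open>y\<close>, but the constant blows up as \<open>s'\<close> tends to 0;
  it serves continuity at positive \<open>s'\<close> only.\<close>

lemma norm_pot_diff_s:
  assumes "s \<noteq> 0" "s' > 0" "y \<in> {0..1}"
  shows "norm (pot s l y - pot s' l y) \<le> P * \<bar>s - s'\<bar> / s'"
proof -
  have "norm (of_real (p y * W y) / (den s y * den s' y))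
      = \<bar>p y\<bar> * (norm (of_real (W y) / den s y) * (1 / norm (den s' y)))"
    by (simp add: norm_mult norm_divide)
  also have "\<dots> \<le> P * (1 * (1 / s'))"
    using p_bound[OF assms(3)] norm_W_div_den[of y s] norm_den_ge(2)[of s' y] assms(2) P_nonneg
    by (intro mult_mono) (auto intro!: divide_left_mono mult_pos_pos simp: den_nz)
  finally have "\<bar>s - s'\<bar> * norm (of_real (p y * W y) / (den s y * den s' y)) \<le> \<bar>s - s'\<bar> * (P * (1 / s'))"
    by (intro mult_left_mono) simp_all
  moreover have "norm (\<i> * of_real (s - s') * z) = \<bar>s - s'\<bar> * norm z" for z
    by (simp add: norm_mult flip: of_real_diff)
  moreover have "pot s l y - pot s' l y
      = \<i> * of_real (s - s') * (of_real (p y * W y) / (den s y * den s' y))"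
    using assms by (intro pot_diff_s) auto
  ultimately have "norm (pot s l y - pot s' l y) \<le> \<bar>s - s'\<bar> * (P * (1 / s'))"
    by (simp only:)
  then show ?thesis by (simp add: mult.commute)
qed

text \<open>There is no uniform smallness: at \<open>y = 1/2\<close> the difference has norm
  \<open>\<bar>p (1/2)\<bar>\<close> for every \<open>s > 0\<close>. With
  \<open>t = s / norm (den s y)\<close> the norm equals \<open>\<bar>p y\<bar> * t\<close>, and
  \<open>2 * t \<le> sqrt s + t\<^sup>2 / sqrt s\<close> trades \<open>t\<close> for
  \<open>t\<^sup>2\<close>, which lies below an integrable Lorentzian.\<close>

lemma norm_pot_diff_0:
  assumes s: "s > 0" and y: "y \<in> {0..1}"
  shows "norm (pot s l y - pot 0 l y)
    \<le> P / 2 * (sqrt s + 1 / sqrt s * (s\<^sup>2 / (s\<^sup>2 + m\<^sup>2 * (y - 1/2)\<^sup>2)))"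
proof -
  define t where "t = s / norm (den s y)"
  have pos: "norm (den s y) > 0" using den_nz[of s y] s by simp
  have "(m * \<bar>y - 1/2\<bar>)\<^sup>2 \<le> (W y)\<^sup>2"
    using W_lower[OF y] m_pos by (subst power2_abs[of "W y", symmetric]) (intro power_mono, auto)
  moreover have n2: "(norm (den s y))\<^sup>2 = (W y)\<^sup>2 + s\<^sup>2"
    by (simp add: den_def cmod_def)
  ultimately have "s\<^sup>2 + m\<^sup>2 * (y - 1/2)\<^sup>2 \<le> (norm (den s y))\<^sup>2"
    by (simp add: power_mult_distrib)
  then have t2: "t\<^sup>2 \<le> s\<^sup>2 / (s\<^sup>2 + m\<^sup>2 * (y - 1/2)\<^sup>2)"
  proof -
    have "0 < s\<^sup>2 + m\<^sup>2 * (y - 1/2)\<^sup>2" using s by (intro add_pos_nonneg) auto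
    with \<open>_ \<le> (norm (den s y))\<^sup>2\<close> show ?thesis
      unfolding t_def power_divide by (intro divide_left_mono mult_pos_pos) (use pos in auto)
  qed
  have "2 * (sqrt s * t) \<le> (sqrt s)\<^sup>2 + t\<^sup>2"
    using sum_squares_bound[of "sqrt s" t] by simp
  then have "2 * t \<le> sqrt s + 1 / sqrt s * t\<^sup>2"
    using s by (simp add: field_simps power2_eq_square)
  also have "\<dots> \<le> sqrt s + 1 / sqrt s * (s\<^sup>2 / (s\<^sup>2 + m\<^sup>2 * (y - 1/2)\<^sup>2))"
    using t2 s by (intro add_left_mono mult_left_mono) auto
  finally have t_le: "t \<le> (sqrt s + 1 / sqrt s * (s\<^sup>2 / (s\<^sup>2 + m\<^sup>2 * (y - 1/2)\<^sup>2))) / 2"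
    by simp
  have "pot s l y - pot 0 l y = of_real (p y) * (\<i> * of_real s / den s y)"
    using s den_nz[of s y] by (simp add: pot_def field_simps) (simp add: den_def algebra_simps)
  then have "norm (pot s l y - pot 0 l y) = \<bar>p y\<bar> * t"
    using s by (simp add: norm_mult norm_divide t_def)
  also have "\<dots> \<le> P * ((sqrt s + 1 / sqrt s * (s\<^sup>2 / (s\<^sup>2 + m\<^sup>2 * (y - 1/2)\<^sup>2))) / 2)"
    using t_le p_bound[OF y] P_nonneg s pos by (intro mult_mono) (auto simp: t_def)
  finally show ?thesis by simp
qed

lemma has_integral_lorentzian:
  assumes s: "s > 0"
  shows "((\<lambda>y. s\<^sup>2 / (s\<^sup>2 + m\<^sup>2 * (y - 1/2)\<^sup>2)) has_integral
     (s / m * arctan (m * (1 - 1/2) / s) - s / m * arctan (m * (0 - 1/2) / s))) {0..1}"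
proof (rule fundamental_theorem_of_calculus)
  fix y :: real
  have nz: "s\<^sup>2 + m\<^sup>2 * (y - 1/2)\<^sup>2 \<noteq> 0"
    using s by (simp add: add_pos_nonneg less_imp_neq[symmetric])
  have "((\<lambda>y. s / m * arctan (m * (y - 1/2) / s)) has_real_derivative
      s / m * (m / s * inverse (1 + (m * (y - 1/2) / s)\<^sup>2))) (at y within {0..1})"
    using m_pos s by (auto intro!: derivative_eq_intros)
  also have "s / m * (m / s * inverse (1 + (m * (y - 1/2) / s)\<^sup>2)) = inverse (1 + (m * (y - 1/2) / s)\<^sup>2)"
    using m_pos s by simp
  also have "1 + (m * (y - 1/2) / s)\<^sup>2 = (s\<^sup>2 + m\<^sup>2 * (y - 1/2)\<^sup>2) / s\<^sup>2"
    using s by (simp add: power_divide power_mult_distrib add_divide_distrib)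
  finally show "((\<lambda>y. s / m * arctan (m * (y - 1/2) / s)) has_vector_derivative
      s\<^sup>2 / (s\<^sup>2 + m\<^sup>2 * (y - 1/2)\<^sup>2)) (at y within {0..1})"
    by (simp add: has_real_derivative_iff_has_vector_derivative)
qed simp

text \<open>The two arctangents differ by at most \<open>pi\<close> whatever \<open>s\<close> is, so
  the Lorentzian has mass at most \<open>s * pi / m\<close>; divided by \<open>sqrt s\<close> this
  is of order \<open>sqrt s\<close>.\<close>

lemma integral_pot_diff_0:
  assumes s: "s > 0"
  shows "integral {0..1} (\<lambda>y. norm (pot s l y - pot 0 l y)) \<le> P / 2 * (1 + pi / m) * sqrt s"
proof -
  let ?a = "s / m * arctan (m * (1 - 1/2) / s) - s / m * arctan (m * (0 - 1/2) / s)"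
  have "((\<lambda>y. P / 2 * (sqrt s + 1 / sqrt s * (s\<^sup>2 / (s\<^sup>2 + m\<^sup>2 * (y - 1/2)\<^sup>2)))) has_integral
      P / 2 * (sqrt s + 1 / sqrt s * ?a)) {0..1}"
    using has_integral_const_real[of "sqrt s" 0 1]
    by (intro has_integral_mult_right has_integral_add has_integral_lorentzian s) simp
  moreover have "((\<lambda>y. norm (pot s l y - pot 0 l y)) has_integral
      integral {0..1} (\<lambda>y. norm (pot s l y - pot 0 l y))) {0..1}"
    by (intro integrable_integral integrable_continuous_interval continuous_intros pot_cont)
  ultimately have "integral {0..1} (\<lambda>y. norm (pot s l y - pot 0 l y))
      \<le> P / 2 * (sqrt s + 1 / sqrt s * ?a)"
    using norm_pot_diff_0[OF s] has_integral_le by blast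
  also have "?a \<le> s / m * (pi / 2) - s / m * (- (pi / 2))"
    using s m_pos arctan_ubound arctan_lbound
    by (intro diff_mono mult_left_mono) (auto intro: less_imp_le)
  also have "\<dots> = s * pi / m" by (simp add: field_simps)
  finally have "integral {0..1} (\<lambda>y. norm (pot s l y - pot 0 l y))
      \<le> P / 2 * (sqrt s + 1 / sqrt s * (s * pi / m))"
    using s P_nonneg by (simp add: mult_left_mono divide_right_mono)
  also have "1 / sqrt s * (s * pi / m) = sqrt s * (pi / m)"
    using s m_pos by (simp add: field_simps)
  finally show ?thesis by (simp add: algebra_simps)
qed

text \<open>A choice is made because \<open>shoots\<close> constrains the functions on the channel
  only; there \<open>shoots_unique\<close> determines them.\<close>

definition sol :: "real \<Rightarrow> real \<Rightarrow> (real \<Rightarrow> complex) \<times> (real \<Rightarrow> complex)" where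
  "sol s l = (SOME z. shoots (pot s l) (fst z) (snd z))"

definition phi :: "real \<Rightarrow> real \<Rightarrow> real \<Rightarrow> complex" where "phi s l = fst (sol s l)"
definition psi :: "real \<Rightarrow> real \<Rightarrow> real \<Rightarrow> complex" where "psi s l = snd (sol s l)"

lemma shoots_phi: "shoots (pot s l) (phi s l) (psi s l)"
proof -
  have "\<exists>z. shoots (pot s l) (fst z) (snd z)"
    using shoots_exists[OF pot_cont, of s l] by auto
  from someI_ex[OF this] show ?thesis
    unfolding phi_def psi_def sol_def .
qed

text \<open>\<open>x \<mapsto> cnj (\<phi> (1 - x))\<close> solves the same equation, and its Wronskian with \<open>\<phi>\<close> takes the values
  \<open>cnj (\<phi> 1)\<close> and \<open>\<phi> 1\<close> at the two walls.\<close>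

lemma phi_1_real: "phi s l 1 = of_real (Re (phi s l 1))"
proof -
  define f where "f = (\<lambda>y. cnj (phi s l (1 - y)))"
  define g where "g = (\<lambda>y. - cnj (psi s l (1 - y)))"
  note D = shootsD[OF shoots_phi[of s l]]
  have refl: "((\<lambda>y. h (1 - y)) has_vector_derivative - h') (at y within {0..1})"
    if "(h has_vector_derivative h') (at (1 - y) within {0..1})" for h :: "real \<Rightarrow> complex" and h' y
  proof -
    have img: "(\<lambda>y. 1 - y) ` {0..1} = {0..1::real}"
      by (auto simp: image_iff intro: bexI[of _ "1 - x" for x])
    have "((\<lambda>y::real. 1 - y) has_vector_derivative -1) (at y within {0..1})"
      by (auto intro!: derivative_eq_intros)
    from vector_diff_chain_within[OF this, of h h'] that img
    show ?thesis by (simp add: o_def)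
  qed
  have f': "(f has_vector_derivative g y) (at y within {0..1})" if "y \<in> {0..1}" for y
    unfolding f_def g_def
    using has_vector_derivative_cnj[OF refl[OF D(3)[of "1 - y"]]] that by simp
  have g': "(g has_vector_derivative pot s l y * f y) (at y within {0..1})" if "y \<in> {0..1}" for y
  proof -
    have "((\<lambda>y. - cnj (psi s l (1 - y))) has_vector_derivative
        - cnj (- (pot s l (1 - y) * phi s l (1 - y)))) (at y within {0..1})"
      using that by (intro has_vector_derivative_minus has_vector_derivative_cnj refl D(4)) auto
    then show ?thesis
      unfolding f_def g_def using pot_sym[OF that, of s l] by simp
  qed
  have "((\<lambda>y. psi s l y * f y - phi s l y * g y) has_vector_derivative 0) (at y within {0..1})"
    if "y \<in> {0..1}" for y
    using that by (auto intro!: derivative_eq_intros f' g' D simp: algebra_simps)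
  from integral_eq_of_has_vector_derivative[OF this, of 1]
  have "psi s l 1 * f 1 - phi s l 1 * g 1 - (psi s l 0 * f 0 - phi s l 0 * g 0) = 0"
    using has_integral_unique[of "\<lambda>_. 0::complex"] has_integral_0 by fastforce
  then have "cnj (phi s l 1) = phi s l 1"
    using D(1,2) by (simp add: f_def g_def)
  then show ?thesis
    by (metis Reals_cnj_iff of_real_Re)
qed

text \<open>The dispersion (Evans) function of the problem. A zero with \<open>s > 0\<close> and
  \<open>l > 0\<close> yields an unstable mode of squared wave number \<open>l\<close>; taking the
  real part loses nothing by \<open>phi_1_real\<close>.\<close>

definition D :: "real \<Rightarrow> real \<Rightarrow> real" where "D s l = Re (phi s l 1)"

lemma phi_1: "phi s l 1 = of_real (D s l)"
  unfolding D_def by (rule phi_1_real)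

lemma norm_phi_diff:
  assumes "\<bar>l\<bar> \<le> L" "\<bar>l'\<bar> \<le> L" "y \<in> {0..1}"
  shows "norm (phi s l y - phi s' l' y) + norm (psi s l y - psi s' l' y)
    \<le> 4 * exp (4 * (1 + (L + P))) * integral {0..1} (\<lambda>t. norm (pot s l t - pot s' l' t))"
proof (rule shoots_stable[OF shoots_phi shoots_phi _ _ pot_cont pot_cont assms(3)])
  fix y :: real assume y: "y \<in> {0..1}"
  show "norm (pot s l y) \<le> L + P" "norm (pot s' l' y) \<le> L + P"
    using pot_bound[OF y, of s l] pot_bound[OF y, of s' l'] assms by linarith+
qed

lemma abs_D_diff:
  assumes "\<bar>l\<bar> \<le> L" "\<bar>l'\<bar> \<le> L"
  shows "\<bar>D s l - D s' l'\<bar>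
    \<le> 4 * exp (4 * (1 + (L + P))) * integral {0..1} (\<lambda>t. norm (pot s l t - pot s' l' t))"
  using norm_phi_diff[OF assms, of 1 s s', unfolded atLeastAtMost_iff, OF conjI[OF zero_le_one order_refl]] abs_Re_le_cmod[of "phi s l 1 - phi s' l' 1"]
    norm_ge_zero[of "psi s l 1 - psi s' l' 1"]
  unfolding D_def minus_complex.sel by linarith

lemma D_cont_l: "continuous_on A (D s)"
proof (rule continuous_at_imp_continuous_on, rule ballI)
  fix l
  have "\<bar>D s l' - D s l\<bar> \<le> 4 * exp (4 * (1 + ((\<bar>l\<bar> + 1) + P))) * \<bar>l' - l\<bar>" if "\<bar>l' - l\<bar> < 1" for l'
    using abs_D_diff[of l' "\<bar>l\<bar> + 1" l s s] that by (simp add: pot_diff_l flip: of_real_diff)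
  then have "\<forall>\<^sub>F l' in at l. norm (D s l' - D s l) \<le> 4 * exp (4 * (1 + ((\<bar>l\<bar> + 1) + P))) * \<bar>l' - l\<bar>"
    unfolding eventually_at by (intro exI[of _ 1]) (auto simp: dist_real_def)
  moreover have "((\<lambda>l'. 4 * exp (4 * (1 + ((\<bar>l\<bar> + 1) + P))) * \<bar>l' - l\<bar>) \<longlongrightarrow> 0) (at l)"
    by (auto intro!: tendsto_eq_intros)
  ultimately have "((\<lambda>l'. D s l' - D s l) \<longlongrightarrow> 0) (at l)"
    by (rule Lim_null_comparison)
  then show "isCont (D s) l"
    unfolding isCont_def by (simp add: LIM_zero_iff)
qed

lemma D_tendsto_s:
  assumes s: "s > 0"
  shows "((\<lambda>s'. D s' l) \<longlongrightarrow> D s l) (at s)"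
proof -
  define K where "K = 4 * exp (4 * (1 + (\<bar>l\<bar> + P)))"
  have "\<bar>D s' l - D s l\<bar> \<le> K * (P * \<bar>s' - s\<bar> / s)" if "s' \<noteq> 0" for s'
  proof -
    have "\<bar>D s' l - D s l\<bar> \<le> K * integral {0..1} (\<lambda>t. norm (pot s' l t - pot s l t))"
      unfolding K_def by (rule abs_D_diff) auto
    also have "integral {0..1} (\<lambda>t. norm (pot s' l t - pot s l t)) \<le> integral {0..1} (\<lambda>t::real. P * \<bar>s' - s\<bar> / s)"
      by (intro integral_le integrable_continuous_interval continuous_intros pot_cont
          norm_pot_diff_s that s)
    finally show ?thesis by (simp add: K_def)
  qed
  then have "\<forall>\<^sub>F s' in at s. norm (D s' l - D s l) \<le> K * (P * \<bar>s' - s\<bar> / s)"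
    unfolding eventually_at using s by (intro exI[of _ s]) (auto simp: dist_real_def)
  moreover have "((\<lambda>s'. K * (P * \<bar>s' - s\<bar> / s)) \<longlongrightarrow> 0) (at s)"
    using s by (auto intro!: tendsto_eq_intros)
  ultimately have "((\<lambda>s'. D s' l - D s l) \<longlongrightarrow> 0) (at s)"
    by (rule Lim_null_comparison)
  then show ?thesis by (simp add: LIM_zero_iff)
qed

text \<open>Continuity up to \<open>s = 0\<close>, jointly in \<open>s\<close> and \<open>l\<close>
  and uniform in \<open>y\<close>: the \<open>L^1\<close> distance of the potentials is at most
  \<open>\<bar>l - l0\<bar>\<close> plus a term of order \<open>sqrt s\<close>.\<close>

lemma near_limit:
  assumes e: "e > 0"
  shows "\<exists>d>0. \<forall>s l y. 0 \<le> s \<longrightarrow> s < d \<longrightarrow> \<bar>l - l0\<bar> < d \<longrightarrow> y \<in> {0..1} \<longrightarrow>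
    norm (phi s l y - phi 0 l0 y) + norm (psi s l y - psi 0 l0 y) \<le> e"
proof -
  define K where "K = 4 * exp (4 * (1 + ((\<bar>l0\<bar> + 1) + P)))"
  define C where "C = P / 2 * (1 + pi / m)"
  have K: "K > 0" and C: "C \<ge> 0"
    using P_nonneg m_pos by (auto simp: K_def C_def)
  have "((\<lambda>d. K * (d + C * sqrt d)) \<longlongrightarrow> K * (0 + C * sqrt 0)) (at_right 0)"
    by (intro tendsto_intros)
  then have "\<forall>\<^sub>F d in at_right 0. K * (d + C * sqrt d) < e"
    using e by (intro order_tendstoD(2)[of _ "K * (0 + C * sqrt 0)"]) auto
  moreover have "\<forall>\<^sub>F d in at_right 0. (0::real) < d \<and> d < 1"
    by (rule eventually_at_rightI[of 0 1]) auto
  ultimately have "\<forall>\<^sub>F d in at_right 0. K * (d + C * sqrt d) < e \<and> (0::real) < d \<and> d < 1"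
    by eventually_elim simp
  then obtain d where d: "K * (d + C * sqrt d) < e" "0 < d" "d < 1"
    using eventually_happens'[OF trivial_limit_at_right_real] by blast
  have "norm (phi s l y - phi 0 l0 y) + norm (psi s l y - psi 0 l0 y) \<le> e"
    if s: "0 \<le> s" "s < d" and l: "\<bar>l - l0\<bar> < d" and y: "y \<in> {0..1}" for s l y
  proof -
    have int0: "integral {0..1} (\<lambda>y. norm (pot s l y - pot 0 l y)) \<le> C * sqrt d"
    proof (cases "s = 0")
      case False
      then have "integral {0..1} (\<lambda>y. norm (pot s l y - pot 0 l y)) \<le> C * sqrt s"
        using integral_pot_diff_0[of s l] s by (simp add: C_def)
      also have "\<dots> \<le> C * sqrt d" using C s by (intro mult_left_mono) auto
      finally show ?thesis .
    qed (use C d in auto)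
    have "norm (pot s l t - pot 0 l0 t) \<le> norm (pot s l t - pot 0 l t) + \<bar>l - l0\<bar>" for t
    proof -
      have "pot s l t - pot 0 l0 t = (pot s l t - pot 0 l t) + of_real (l - l0)"
        using pot_diff_l[of 0 l t l0] by (simp add: algebra_simps)
      then show ?thesis
        by (metis norm_of_real norm_triangle_ineq)
    qed
    then have "integral {0..1} (\<lambda>t. norm (pot s l t - pot 0 l0 t))
        \<le> integral {0..1} (\<lambda>t. norm (pot s l t - pot 0 l t) + \<bar>l - l0\<bar>)"
      by (intro integral_le integrable_continuous_interval continuous_intros pot_cont)
    also have "\<dots> = integral {0..1} (\<lambda>t. norm (pot s l t - pot 0 l t)) + \<bar>l - l0\<bar>"
      by (subst integral_add) (auto intro!: integrable_continuous_interval continuous_intros pot_cont)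
    also have "\<dots> \<le> d + C * sqrt d" using int0 l by simp
    finally have "integral {0..1} (\<lambda>t. norm (pot s l t - pot 0 l0 t)) \<le> d + C * sqrt d" .
    from mult_left_mono[OF this less_imp_le[OF K]]
    have "K * integral {0..1} (\<lambda>t. norm (pot s l t - pot 0 l0 t)) < e" using d by linarith
    moreover have "norm (phi s l y - phi 0 l0 y) + norm (psi s l y - psi 0 l0 y)
        \<le> K * integral {0..1} (\<lambda>t. norm (pot s l t - pot 0 l0 t))"
      unfolding K_def by (rule norm_phi_diff) (use l d y in auto)
    ultimately show ?thesis by linarith
  qed
  then show ?thesis using d by blast
qed

end

lemma has_integral_odd_about_half:
  fixes f :: "real \<Rightarrow> real"
  assumes f: "continuous_on {0..1} f" and odd: "\<And>y. y \<in> {0..1} \<Longrightarrow> f (1 - y) = - f y"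
  shows "(f has_integral 0) {0..1}"
proof -
  define I where "I = integral {0..1} f"
  have int: "(f has_integral I) {0..1}"
    unfolding I_def by (intro integrable_integral integrable_continuous_interval f)
  have "((\<lambda>y. f (-1 *\<^sub>R y + 1)) has_integral (1 / \<bar>- 1\<bar> ^ DIM(real)) *\<^sub>R I)
      ((\<lambda>y. (1 / - 1) *\<^sub>R y + - ((1 / - 1) *\<^sub>R 1)) ` cbox 0 1)"
    by (rule has_integral_affinity) (use int in auto)
  moreover have "(\<lambda>y. (1 / - 1) *\<^sub>R y + - ((1 / - 1) *\<^sub>R 1)) ` cbox 0 1 = {0..1::real}"
    by (auto simp: image_iff intro: bexI[of _ "1 - x" for x])
  ultimately have "((\<lambda>y. f (1 - y)) has_integral I) {0..1}"
    by simp
  then have "((\<lambda>y. - f y) has_integral I) {0..1}"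
    by (rule has_integral_eq[rotated]) (use odd in auto)
  from has_integral_unique[OF has_integral_neg[OF int] this] have "- I = I" .
  then show ?thesis using int by simp
qed

section \<open>Bifurcation from the ground state\<close>

lemma norm_mult_diff_le:
  fixes a b a' b' :: complex
  assumes "norm (a - a') \<le> e" "norm (b - b') \<le> e" "norm a' \<le> C" "norm b' \<le> C" "e \<le> 1"
  shows "norm (a * b - a' * b') \<le> (2 * C + 1) * e"
proof -
  have e: "0 \<le> e" using assms(1) norm_ge_zero order_trans by blast
  have C: "0 \<le> C" using assms(3) norm_ge_zero order_trans by blast
  have "norm a \<le> C + 1"
    using norm_triangle_sub[of a a'] assms by linarith
  then have "norm (a * (b - b')) \<le> (C + 1) * e"
    unfolding norm_mult using assms e C by (intro mult_mono) auto
  moreover have "norm ((a - a') * b') \<le> e * C"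
    unfolding norm_mult using assms e C by (intro mult_mono) auto
  moreover have "a * b - a' * b' = a * (b - b') + (a - a') * b'"
    by (simp add: algebra_simps)
  ultimately have "norm (a * b - a' * b') \<le> (C + 1) * e + e * C"
    by (simp only: norm_triangle_mono)
  then show ?thesis by (simp add: algebra_simps)
qed

text \<open>The neutral mode from which the branch starts: \<open>u\<close> is its positive
  eigenfunction and \<open>l0\<close> the square of its wave number.\<close>

locale odd_profile_ground = odd_profile +
  fixes l0 :: real and u v :: "real \<Rightarrow> real"
  assumes ground: "shoots (\<lambda>y. l0 + p y) u v" and u_1: "u 1 = 0"
    and u_pos: "\<And>y. y \<in> {0<..<1} \<Longrightarrow> u y > 0"
begin

lemma phi_ground:
  assumes "y \<in> {0..1}"
  shows "phi 0 l0 y = of_real (u y)" "psi 0 l0 y = of_real (v y)"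
proof -
  have "shoots (pot 0 l0) (\<lambda>y. of_real (u y)) (\<lambda>y. of_real (v y))"
    using shootsD[OF ground]
    by (auto simp: shoots_def pot_def intro!: has_vector_derivative_of_real
        simp flip: of_real_add of_real_mult has_real_derivative_iff_has_vector_derivative)
  then show "phi 0 l0 y = of_real (u y)" "psi 0 l0 y = of_real (v y)"
    using shoots_unique[OF shoots_phi[of 0 l0] _ pot_cont assms] by auto
qed

lemma D_ground: "D 0 l0 = 0"
  using phi_ground(1)[of 1] u_1 by (simp add: D_def)

text \<open>Positivity of \<open>u\<close> inside the channel forbids a positive slope at the wall
  and simplicity of the zero forbids slope 0. This sign decides the direction in which
  \<open>D 0\<close> crosses 0.\<close>

lemma v_1: "v 1 < 0"
proof -
  have "(u 1)\<^sup>2 + (v 1)\<^sup>2 > 0"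
  proof (rule shoots_energy[OF ground])
    show "\<bar>l0 + p y\<bar> \<le> \<bar>l0\<bar> + P" if "y \<in> {0..1}" for y
      using p_bound[OF that] by linarith
  qed auto
  then have nz: "v 1 \<noteq> 0" using u_1 by auto
  have "v 1 \<le> 0"
  proof (rule ccontr)
    assume "\<not> v 1 \<le> 0"
    moreover have "(u has_real_derivative v 1) (at 1 within {0..1})"
      using shootsD(3)[OF ground, of 1] by (simp add: has_real_derivative_iff_has_vector_derivative)
    ultimately obtain d where d: "d > 0" "\<And>h. 0 < h \<Longrightarrow> 1 - h \<in> {0..1} \<Longrightarrow> h < d \<Longrightarrow> u (1 - h) < u 1"
      using has_real_derivative_pos_inc_left[of u "v 1" 1 "{0..1}"] by auto
    define h where "h = min (1/2) (d/2)"
    have "u (1 - h) < u 1" using d(1) by (intro d(2)) (auto simp: h_def)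
    moreover have "u (1 - h) > 0" using d(1) by (intro u_pos) (auto simp: h_def)
    ultimately show False using u_1 by simp
  qed
  with nz show ?thesis by simp
qed

lemma uv_bound: "\<exists>C>0. \<forall>y\<in>{0..1}. \<bar>u y\<bar> \<le> C \<and> \<bar>v y\<bar> \<le> C"
proof (intro exI conjI ballI)
  define C where "C = 2 * exp (2 * (1 + (\<bar>l0\<bar> + P)))"
  show "C > 0" by (simp add: C_def)
  fix y :: real assume y: "y \<in> {0..1}"
  have "norm (u y) + norm (v y) \<le> C" unfolding C_def
  proof (rule shoots_bound[OF ground _ y])
    show "norm (l0 + p y) \<le> \<bar>l0\<bar> + P" if "y \<in> {0..1}" for y
      using p_bound[OF that] by simp
  qed
  then show "\<bar>u y\<bar> \<le> C" "\<bar>v y\<bar> \<le> C" by auto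
qed

lemma near_ground:
  assumes "e > 0"
  shows "\<exists>d>0. \<forall>s l. 0 \<le> s \<longrightarrow> s < d \<longrightarrow> \<bar>l - l0\<bar> < d \<longrightarrow> (\<forall>y\<in>{0..1}.
    norm (phi s l y - of_real (u y)) \<le> e \<and> norm (psi s l y - of_real (v y)) \<le> e)"
proof -
  obtain d where d: "d > 0" "\<And>s l y. 0 \<le> s \<Longrightarrow> s < d \<Longrightarrow> \<bar>l - l0\<bar> < d \<Longrightarrow> y \<in> {0..1} \<Longrightarrow>
    norm (phi s l y - phi 0 l0 y) + norm (psi s l y - psi 0 l0 y) \<le> e"
    using near_limit[OF assms, of l0] by blast
  show ?thesis
  proof (intro exI[of _ d] conjI allI impI ballI)
    fix s l y :: real assume *: "0 \<le> s" "s < d" "\<bar>l - l0\<bar> < d" "y \<in> {0..1}"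
    show "norm (phi s l y - of_real (u y)) \<le> e"
      using d(2)[OF *] norm_ge_zero[of "psi s l y - psi 0 l0 y"]
      unfolding phi_ground[OF *(4)] by linarith
    show "norm (psi s l y - of_real (v y)) \<le> e"
      using d(2)[OF *] norm_ge_zero[of "phi s l y - phi 0 l0 y"]
      unfolding phi_ground[OF *(4)] by linarith
  qed (rule d)
qed

text \<open>The second estimate concerns the derivative of the product. It will make the imaginary
  part of the product Lipschitz with a small constant, as the singular kernel below
  requires.\<close>

lemma prod_near_ground:
  assumes e: "e > 0"
  shows "\<exists>d>0. \<forall>s l s' l'. 0 \<le> s \<longrightarrow> s < d \<longrightarrow> \<bar>l - l0\<bar> < d \<longrightarrow> 0 \<le> s' \<longrightarrow> s' < d \<longrightarrow> \<bar>l' - l0\<bar> < d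
    \<longrightarrow> (\<forall>y\<in>{0..1}. norm (phi s l y * phi s' l' y - of_real ((u y)\<^sup>2)) \<le> e \<and>
      norm (psi s l y * phi s' l' y + phi s l y * psi s' l' y - of_real (2 * (u y * v y))) \<le> e)"
proof -
  obtain C where C: "C > 0" "\<And>y. y \<in> {0..1} \<Longrightarrow> \<bar>u y\<bar> \<le> C" "\<And>y. y \<in> {0..1} \<Longrightarrow> \<bar>v y\<bar> \<le> C"
    using uv_bound by blast
  define e' where "e' = min 1 (e / (2 * (2 * C + 1)))"
  have e': "e' > 0" "e' \<le> 1" using e C by (auto simp: e'_def)
  have "e' \<le> e / (2 * (2 * C + 1))" by (simp add: e'_def)
  then have e'': "2 * ((2 * C + 1) * e') \<le> e"
    using C(1) by (simp add: field_simps)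
  obtain d where d: "d > 0" "\<And>s l y. 0 \<le> s \<Longrightarrow> s < d \<Longrightarrow> \<bar>l - l0\<bar> < d \<Longrightarrow> y \<in> {0..1} \<Longrightarrow>
      norm (phi s l y - of_real (u y)) \<le> e'"
    "\<And>s l y. 0 \<le> s \<Longrightarrow> s < d \<Longrightarrow> \<bar>l - l0\<bar> < d \<Longrightarrow> y \<in> {0..1} \<Longrightarrow>
      norm (psi s l y - of_real (v y)) \<le> e'"
    using near_ground[OF e'(1)] by blast
  show ?thesis
  proof (intro exI[of _ d] conjI allI impI ballI)
    fix s l s' l' y :: real
    assume 1: "0 \<le> s" "s < d" "\<bar>l - l0\<bar> < d" and 2: "0 \<le> s'" "s' < d" "\<bar>l' - l0\<bar> < d" and y: "y \<in> {0..1}"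
    have uC: "norm (complex_of_real (u y)) \<le> C" and vC: "norm (complex_of_real (v y)) \<le> C"
      using C y by auto
    have "norm (phi s l y * phi s' l' y - of_real (u y) * of_real (u y)) \<le> (2 * C + 1) * e'"
      by (rule norm_mult_diff_le[OF d(2)[OF 1 y] d(2)[OF 2 y] uC uC e'(2)])
    moreover have "(2 * C + 1) * e' \<ge> 0" using C(1) e'(1) by simp
    ultimately show "norm (phi s l y * phi s' l' y - of_real ((u y)\<^sup>2)) \<le> e"
      using e'' by (simp add: power2_eq_square)
    have "norm (psi s l y * phi s' l' y - of_real (v y) * of_real (u y)) \<le> (2 * C + 1) * e'"
      by (rule norm_mult_diff_le[OF d(3)[OF 1 y] d(2)[OF 2 y] vC uC e'(2)])
    moreover have "norm (phi s l y * psi s' l' y - of_real (u y) * of_real (v y)) \<le> (2 * C + 1) * e'"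
      by (rule norm_mult_diff_le[OF d(2)[OF 1 y] d(3)[OF 2 y] uC vC e'(2)])
    moreover have "psi s l y * phi s' l' y + phi s l y * psi s' l' y - of_real (2 * (u y * v y))
      = (psi s l y * phi s' l' y - of_real (v y) * of_real (u y))
        + (phi s l y * psi s' l' y - of_real (u y) * of_real (v y))"
      by simp
    ultimately have "norm (psi s l y * phi s' l' y + phi s l y * psi s' l' y - of_real (2 * (u y * v y)))
        \<le> (2 * C + 1) * e' + (2 * C + 1) * e'"
      by (simp only: norm_triangle_mono)
    then show "norm (psi s l y * phi s' l' y + phi s l y * psi s' l' y - of_real (2 * (u y * v y))) \<le> e"
      using e'' by linarith
  qed (rule d)
qed

lemma phi_cont: "continuous_on {0..1} (phi s l)" "continuous_on {0..1} (psi s l)"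
  using shootsD(5,6)[OF shoots_phi] by auto

lemma u_cont: "continuous_on {0..1} u"
  using shootsD(5)[OF ground] .

text \<open>At the ground state the integral is that of \<open>u\<^sup>2\<close>, call it
  \<open>I\<close>; nearby products change it by at most \<open>I / 2\<close>. The integral is the
  coefficient of \<open>l - l'\<close> in \<open>wronskian_same_s\<close>.\<close>

lemma re_integral_prod_pos:
  "\<exists>d>0. \<forall>s l s' l'. 0 \<le> s \<longrightarrow> s < d \<longrightarrow> \<bar>l - l0\<bar> < d \<longrightarrow> 0 \<le> s' \<longrightarrow> s' < d \<longrightarrow> \<bar>l' - l0\<bar> < d
    \<longrightarrow> Re (integral {0..1} (\<lambda>y. phi s l y * phi s' l' y)) > 0"
proof -
  define I where "I = integral {0..1} (\<lambda>y. (u y)\<^sup>2)"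
  have intu: "(\<lambda>y. (u y)\<^sup>2) integrable_on {0..1}"
    by (intro integrable_continuous_interval continuous_intros u_cont)
  have "I > 0"
  proof -
    have "I \<ge> 0" unfolding I_def by (intro integral_nonneg intu) auto
    moreover have "I \<noteq> 0"
    proof
      assume "I = 0"
      then have "((\<lambda>y. (u y)\<^sup>2) has_integral 0) (cbox 0 1)"
        using intu by (simp add: I_def has_integral_iff)
      then have "(u (1/2))\<^sup>2 = 0"
        by (intro has_integral_0_cbox_imp_0[of 0 1 "\<lambda>y. (u y)\<^sup>2"])
           (auto intro!: continuous_intros u_cont)
      then show False using u_pos[of "1/2"] by simp
    qed
    ultimately show ?thesis by simp
  qed
  then have "I / 2 > 0" by simp
  from prod_near_ground[OF this]
  obtain d where d: "d > 0" "\<And>s l s' l' y. 0 \<le> s \<Longrightarrow> s < d \<Longrightarrow> \<bar>l - l0\<bar> < d \<Longrightarrow> 0 \<le> s' \<Longrightarrow> s' < d \<Longrightarrow>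
      \<bar>l' - l0\<bar> < d \<Longrightarrow> y \<in> {0..1} \<Longrightarrow> norm (phi s l y * phi s' l' y - of_real ((u y)\<^sup>2)) \<le> I / 2"
    by blast
  show ?thesis
  proof (intro exI[of _ d] conjI allI impI)
    fix s l s' l' :: real
    assume *: "0 \<le> s" "s < d" "\<bar>l - l0\<bar> < d" "0 \<le> s'" "s' < d" "\<bar>l' - l0\<bar> < d"
    have int: "(\<lambda>y. phi s l y * phi s' l' y) integrable_on {0..1}"
      by (intro integrable_continuous_interval continuous_intros phi_cont)
    have intr: "(\<lambda>y. complex_of_real ((u y)\<^sup>2)) integrable_on {0..1}"
      by (intro integrable_continuous_interval continuous_intros u_cont)
    have "norm (integral {0..1} (\<lambda>y. phi s l y * phi s' l' y - of_real ((u y)\<^sup>2)))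
        \<le> integral {0..1} (\<lambda>y::real. I / 2)"
      by (rule integral_norm_bound_integral[OF integrable_diff[OF int intr] _ d(2)[OF *]]) auto
    moreover have "integral {0..1} (\<lambda>y. phi s l y * phi s' l' y - of_real ((u y)\<^sup>2))
        = integral {0..1} (\<lambda>y. phi s l y * phi s' l' y) - of_real I"
      using integral_linear[OF intu bounded_linear_of_real[where ?'a = complex]]
      unfolding integral_diff[OF int intr] I_def o_def by (simp only:)
    ultimately have "norm (integral {0..1} (\<lambda>y. phi s l y * phi s' l' y) - of_real I) \<le> I / 2"
      by simp
    then have "\<bar>Re (integral {0..1} (\<lambda>y. phi s l y * phi s' l' y)) - I\<bar> \<le> I / 2"
      using abs_Re_le_cmod[of "integral {0..1} (\<lambda>y. phi s l y * phi s' l' y) - of_real I"] by simp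
    then show "Re (integral {0..1} (\<lambda>y. phi s l y * phi s' l' y)) > 0"
      using \<open>I > 0\<close> by linarith
  qed (rule d)
qed

lemma wronskian_same_s:
  "of_real (l - l') * integral {0..1} (\<lambda>y. phi s l y * phi s l' y)
    = psi s l 1 * phi s l' 1 - phi s l 1 * psi s l' 1"
proof -
  have "((\<lambda>y. of_real (l - l') * (phi s l y * phi s l' y)) has_integral
      (psi s l 1 * phi s l' 1 - phi s l 1 * psi s l' 1)) {0..1}"
    using wronskian[OF shoots_phi shoots_phi, of s l s l'] unfolding pot_diff_l .
  then show ?thesis
    using integral_mult_right by (metis integral_unique)
qed

lemma unique_l:
  "\<exists>d>0. \<forall>s l l'. 0 \<le> s \<longrightarrow> s < d \<longrightarrow> \<bar>l - l0\<bar> < d \<longrightarrow> \<bar>l' - l0\<bar> < d \<longrightarrow> D s l = 0 \<longrightarrow> D s l' = 0 \<longrightarrow> l = l'"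
proof -
  obtain d where d: "d > 0" "\<And>s l s' l'. 0 \<le> s \<Longrightarrow> s < d \<Longrightarrow> \<bar>l - l0\<bar> < d \<Longrightarrow> 0 \<le> s' \<Longrightarrow> s' < d \<Longrightarrow>
      \<bar>l' - l0\<bar> < d \<Longrightarrow> Re (integral {0..1} (\<lambda>y. phi s l y * phi s' l' y)) > 0"
    using re_integral_prod_pos by blast
  show ?thesis
  proof (intro exI[of _ d] conjI allI impI)
    fix s l l' :: real
    assume *: "0 \<le> s" "s < d" "\<bar>l - l0\<bar> < d" "\<bar>l' - l0\<bar> < d" "D s l = 0" "D s l' = 0"
    have "of_real (l - l') * integral {0..1} (\<lambda>y. phi s l y * phi s l' y) = 0"
      unfolding wronskian_same_s by (simp add: phi_1 *)
    moreover have "integral {0..1} (\<lambda>y. phi s l y * phi s l' y) \<noteq> 0"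
      using d(2)[OF *(1-3) *(1,2,4)] by auto
    ultimately show "l = l'" by (metis eq_iff_diff_eq_0 mult_eq_0_iff of_real_eq_0_iff)
  qed (rule d)
qed

text \<open>The Wronskian against the ground state reads \<open>(l - l0) * J = - D 0 l * v 1\<close>
  with \<open>J > 0\<close> and \<open>v 1 < 0\<close>, so \<open>D 0 l\<close> has the sign of
  \<open>l - l0\<close>.\<close>

lemma sign_D_0:
  "\<exists>d>0. \<forall>l. \<bar>l - l0\<bar> < d \<longrightarrow> (l0 < l \<longrightarrow> D 0 l > 0) \<and> (l < l0 \<longrightarrow> D 0 l < 0)"
proof -
  obtain d where d: "d > 0" "\<And>s l s' l'. 0 \<le> s \<Longrightarrow> s < d \<Longrightarrow> \<bar>l - l0\<bar> < d \<Longrightarrow> 0 \<le> s' \<Longrightarrow> s' < d \<Longrightarrow>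
      \<bar>l' - l0\<bar> < d \<Longrightarrow> Re (integral {0..1} (\<lambda>y. phi s l y * phi s' l' y)) > 0"
    using re_integral_prod_pos by blast
  show ?thesis
  proof (intro exI[of _ d] conjI allI impI)
    fix l :: real assume l: "\<bar>l - l0\<bar> < d"
    define J where "J = Re (integral {0..1} (\<lambda>y. phi 0 l y * phi 0 l0 y))"
    have J: "J > 0" unfolding J_def using l d(1) by (intro d(2)) auto
    have "Re (of_real (l - l0) * integral {0..1} (\<lambda>y. phi 0 l y * phi 0 l0 y)) = - (D 0 l * v 1)"
      unfolding wronskian_same_s by (simp add: phi_1 D_ground phi_ground)
    then have eq: "(l - l0) * J = D 0 l * (- v 1)" by (simp add: J_def)
    show "D 0 l > 0" if "l0 < l"
    proof -
      have "D 0 l * (- v 1) > 0" unfolding eq[symmetric] using that J by (intro mult_pos_pos) auto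
      then show ?thesis using v_1 by (simp add: zero_less_mult_iff mult_less_0_iff)
    qed
    show "D 0 l < 0" if "l < l0"
    proof -
      have "D 0 l * (- v 1) < 0" unfolding eq[symmetric] using that J by (intro mult_neg_pos) auto
      then show ?thesis using v_1 by (simp add: zero_less_mult_iff mult_less_0_iff)
    qed
  qed (rule d)
qed

end

section \<open>The critical-layer kernel and uniqueness of \<open>s\<close> for given
  \<open>l\<close>\<close>

context odd_profile_ground
begin

text \<open>As \<open>p * W\<close> stands for \<open>U''\<close>, this is
  \<open>U'' / ((U - c1) (U - c2))\<close>, the factor left when \<open>i (s - s')\<close> is split
  off the difference of two potentials.\<close>

definition ker :: "real \<Rightarrow> real \<Rightarrow> real \<Rightarrow> complex" where
  "ker s s' y = of_real (p y * W y) / (den s y * den s' y)"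

text \<open>The imaginary part of \<open>ker\<close> without its factor \<open>p\<close>; for small
  \<open>s\<close> and \<open>s'\<close> its mass sits near the zero of \<open>W\<close>.\<close>

definition bump :: "real \<Rightarrow> real \<Rightarrow> real \<Rightarrow> real" where
  "bump s s' y = (W y)\<^sup>2 * (s + s') / (((W y)\<^sup>2 + s\<^sup>2) * ((W y)\<^sup>2 + s'\<^sup>2))"

text \<open>Each denominator is rationalised by its conjugate. The real part comes out odd about the
  centre; for positive \<open>s\<close> and \<open>s'\<close> the imaginary part is a nonnegative
  multiple of \<open>p\<close>.\<close>

lemma ker_eq:
  assumes "s \<noteq> 0" "s' \<noteq> 0"
  shows "Re (ker s s' y) = p y * W y * ((W y)\<^sup>2 - s * s') / (((W y)\<^sup>2 + s\<^sup>2) * ((W y)\<^sup>2 + s'\<^sup>2))"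
    and "Im (ker s s' y) = p y * bump s s' y"
proof -
  have inv: "1 / den t y = (of_real (W y) + \<i> * of_real t) / of_real ((W y)\<^sup>2 + t\<^sup>2)" if "t \<noteq> 0" for t
  proof -
    have "(W y)\<^sup>2 + t\<^sup>2 \<noteq> 0" using that by (simp add: sum_power2_eq_zero_iff)
    moreover have "den t y * (of_real (W y) + \<i> * of_real t) = of_real ((W y)\<^sup>2 + t\<^sup>2)"
      by (simp add: den_def complex_eq_iff power2_eq_square algebra_simps)
    ultimately show ?thesis using den_nz[OF that, of y]
      by (metis (no_types, lifting) div_by_1 frac_eq_eq mult.commute mult_1 of_real_eq_0_iff)
  qed
  have "ker s s' y = of_real (p y * W y) * ((1 / den s y) * (1 / den s' y))"
    by (simp add: ker_def)
  also have "\<dots> = of_real (p y * W y / (((W y)\<^sup>2 + s\<^sup>2) * ((W y)\<^sup>2 + s'\<^sup>2)))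
      * ((of_real (W y) + \<i> * of_real s) * (of_real (W y) + \<i> * of_real s'))"
    unfolding inv[OF assms(1)] inv[OF assms(2)] by simp
  finally have *: "ker s s' y = of_real (p y * W y / (((W y)\<^sup>2 + s\<^sup>2) * ((W y)\<^sup>2 + s'\<^sup>2)))
      * ((of_real (W y) + \<i> * of_real s) * (of_real (W y) + \<i> * of_real s'))" .
  show "Re (ker s s' y) = p y * W y * ((W y)\<^sup>2 - s * s') / (((W y)\<^sup>2 + s\<^sup>2) * ((W y)\<^sup>2 + s'\<^sup>2))"
    unfolding * Re_complex_of_real times_complex.sel
    by (simp add: power2_eq_square)
  show "Im (ker s s' y) = p y * bump s s' y"
    unfolding * times_complex.sel
    by (simp add: bump_def power2_eq_square algebra_simps)
qed

lemma ker_cont: "s \<noteq> 0 \<Longrightarrow> s' \<noteq> 0 \<Longrightarrow> continuous_on {0..1} (ker s s')"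
  unfolding ker_def by (auto intro!: continuous_intros p_cont W_cont den_cont simp: den_nz)

lemma bump_cont: "s \<noteq> 0 \<Longrightarrow> s' \<noteq> 0 \<Longrightarrow> continuous_on {0..1} (bump s s')"
  unfolding bump_def by (auto intro!: continuous_intros W_cont simp: sum_power2_eq_zero_iff)

lemma bump_nonneg: "s > 0 \<Longrightarrow> s' > 0 \<Longrightarrow> bump s s' y \<ge> 0"
  unfolding bump_def by auto

text \<open>The factor \<open>W\<close> cancels against \<open>den s\<close>, and the remaining
  \<open>1 / norm (den s' y)\<close> is at most \<open>1 / (m * \<bar>y - 1/2\<bar>)\<close>. The
  multiplied-out form covers the centre and is uniform in \<open>s\<close> and
  \<open>s'\<close>.\<close>

lemma ker_near_center:
  assumes "s > 0" "s' > 0" "y \<in> {0..1}"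
  shows "\<bar>Re (ker s s' y)\<bar> * (m * \<bar>y - 1/2\<bar>) \<le> P"
proof -
  have "norm (ker s s' y) = \<bar>p y\<bar> * norm (of_real (W y) / den s y) * (1 / norm (den s' y))"
    by (simp add: ker_def norm_mult norm_divide)
  also have "\<dots> \<le> P * 1 * (1 / norm (den s' y))"
    using p_bound[OF assms(3)] norm_W_div_den[of y s] P_nonneg by (intro mult_mono) auto
  finally have k: "\<bar>Re (ker s s' y)\<bar> \<le> P * (1 / norm (den s' y))"
    using abs_Re_le_cmod[of "ker s s' y"] by linarith
  have "m * \<bar>y - 1/2\<bar> \<le> norm (den s' y)"
    using W_lower[OF assms(3)] norm_den_ge(1)[of y s'] by linarith
  then have "\<bar>Re (ker s s' y)\<bar> * (m * \<bar>y - 1/2\<bar>) \<le> P * (1 / norm (den s' y)) * norm (den s' y)"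
    using k P_nonneg m_pos by (intro mult_mono) auto
  also have "\<dots> = P" using den_nz[of s' y] assms by simp
  finally show ?thesis .
qed

lemma bump_far:
  assumes "s > 0" "s' > 0" "y \<in> {0..1}" "r > 0" "r \<le> \<bar>y - 1/2\<bar>"
  shows "bump s s' y \<le> (s + s') / (m * r)\<^sup>2"
proof -
  have "m * r \<le> \<bar>W y\<bar>"
    using W_lower[OF assms(3)] mult_left_mono[OF assms(5), of m] m_pos by linarith
  then have "(m * r)\<^sup>2 \<le> (W y)\<^sup>2"
    using m_pos assms(4) by (subst power2_abs[of "W y", symmetric]) (intro power_mono, auto)
  moreover have pos: "(m * r)\<^sup>2 > 0" using m_pos assms(4) by simp
  ultimately have 1: "(s + s') / ((W y)\<^sup>2 + s'\<^sup>2) \<le> (s + s') / (m * r)\<^sup>2"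
    using assms by (intro divide_left_mono mult_pos_pos add_nonneg_pos) (auto intro: add_increasing2)
  have "bump s s' y = (W y)\<^sup>2 / ((W y)\<^sup>2 + s\<^sup>2) * ((s + s') / ((W y)\<^sup>2 + s'\<^sup>2))"
    by (simp add: bump_def)
  also have "\<dots> \<le> 1 * ((s + s') / ((W y)\<^sup>2 + s'\<^sup>2))"
    using assms by (intro mult_right_mono) (auto simp: divide_le_eq_1 intro: add_nonneg_pos)
  finally show ?thesis using 1 by simp
qed

text \<open>At distance between \<open>s'\<close> and \<open>2 * s'\<close> from the centre, and for
  \<open>s \<le> s'\<close>, the two fractions bound
  \<open>W\<^sup>2 / (W\<^sup>2 + s\<^sup>2)\<close> and
  \<open>s'\<^sup>2 / (W\<^sup>2 + s'\<^sup>2)\<close> from below.\<close>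

definition c_bump :: real where
  "c_bump = m\<^sup>2 / (m\<^sup>2 + 1) / ((2 * B)\<^sup>2 + 1)"

lemma c_bump_pos: "c_bump > 0"
  unfolding c_bump_def
  by (intro divide_pos_pos zero_less_power m_pos add_nonneg_pos zero_le_power2 zero_less_one)

text \<open>\<open>bump\<close> contains a Poisson-type kernel of width \<open>max s s'\<close>; the part at distance between \<open>s'\<close> and
  \<open>2 s'\<close> from the centre has enough mass.\<close>

lemma bump_integral:
  assumes s: "s > 0" "s \<le> s'" and s': "s' \<le> 1/4"
  shows "integral {0..1} (bump s s') \<ge> c_bump"
proof -
  have sub: "{1/2 + s'..1/2 + 2 * s'} \<subseteq> {0..1}" using s s' by auto
  have cont: "continuous_on {0..1} (bump s s')" using s by (intro bump_cont) auto
  have le: "c_bump / s' \<le> bump s s' y" if y: "y \<in> {1/2 + s'..1/2 + 2 * s'}" for y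
  proof -
    have y01: "y \<in> {0..1}" using sub y by auto
    have x: "s' \<le> \<bar>y - 1/2\<bar>" "\<bar>y - 1/2\<bar> \<le> 2 * s'" using y s by auto
    have B0: "B \<ge> 0"
    proof (rule ccontr)
      assume "\<not> B \<ge> 0"
      then have "B * \<bar>y - 1/2\<bar> < 0" using x s by (intro mult_neg_pos) auto
      then show False using W_upper[OF y01] by linarith
    qed
    have "m * s' \<le> \<bar>W y\<bar>" using W_lower[OF y01] mult_left_mono[OF x(1), of m] m_pos by linarith
    then have lo: "(m * s')\<^sup>2 \<le> (W y)\<^sup>2"
      using m_pos s by (subst power2_abs[of "W y", symmetric]) (intro power_mono, auto)
    have "\<bar>W y\<bar> \<le> 2 * B * s'" using W_upper[OF y01] mult_left_mono[OF x(2) B0] by linarith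
    then have hi: "(W y)\<^sup>2 \<le> (2 * B * s')\<^sup>2"
      by (subst power2_abs[of "W y", symmetric]) (intro power_mono, auto)
    have ss: "s\<^sup>2 \<le> s'\<^sup>2" using s by (intro power_mono) auto
    have s'2: "s'\<^sup>2 > 0" using s by simp
    have "m\<^sup>2 * s\<^sup>2 \<le> (W y)\<^sup>2"
      using lo mult_left_mono[OF ss, of "m\<^sup>2"] by (simp add: power_mult_distrib)
    then have 1: "m\<^sup>2 / (m\<^sup>2 + 1) \<le> (W y)\<^sup>2 / ((W y)\<^sup>2 + s\<^sup>2)"
      using s m_pos by (simp add: divide_simps add_nonneg_pos add_pos_nonneg algebra_simps)
    have "s' * ((W y)\<^sup>2 + s'\<^sup>2) \<le> s' * (s'\<^sup>2 * ((2 * B)\<^sup>2 + 1))"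
      using hi s by (intro mult_left_mono) (auto simp: power_mult_distrib algebra_simps)
    also have "\<dots> \<le> (s + s') * (s'\<^sup>2 * ((2 * B)\<^sup>2 + 1))"
      using s by (intro mult_right_mono) auto
    finally have "s' * ((W y)\<^sup>2 + s'\<^sup>2) \<le> (s + s') * (s'\<^sup>2 * ((2 * B)\<^sup>2 + 1))" .
    moreover have "s'\<^sup>2 * ((2 * B)\<^sup>2 + 1) > 0" "(W y)\<^sup>2 + s'\<^sup>2 > 0"
      by (intro mult_pos_pos add_nonneg_pos s'2 zero_le_power2 zero_less_one)+
    ultimately have "s' / (s'\<^sup>2 * ((2 * B)\<^sup>2 + 1)) \<le> (s + s') / ((W y)\<^sup>2 + s'\<^sup>2)"
      by (simp only: pos_divide_le_eq times_divide_eq_left pos_le_divide_eq)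
    moreover have "s' / (s'\<^sup>2 * ((2 * B)\<^sup>2 + 1)) = 1 / ((2 * B)\<^sup>2 + 1) / s'"
      using s by (simp add: power2_eq_square)
    ultimately have 2: "1 / ((2 * B)\<^sup>2 + 1) / s' \<le> (s + s') / ((W y)\<^sup>2 + s'\<^sup>2)" by simp
    have "c_bump / s' = m\<^sup>2 / (m\<^sup>2 + 1) * (1 / ((2 * B)\<^sup>2 + 1) / s')"
      by (simp add: c_bump_def)
    also have "\<dots> \<le> (W y)\<^sup>2 / ((W y)\<^sup>2 + s\<^sup>2) * ((s + s') / ((W y)\<^sup>2 + s'\<^sup>2))"
      using 1 2 s by (intro mult_mono) auto
    also have "\<dots> = bump s s' y" by (simp add: bump_def)
    finally show ?thesis .
  qed
  \<comment> \<open>The window has length \<open>s'\<close>, which cancels the height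
    \<open>c_bump / s'\<close>; the bound \<open>s' \<le> 1/4\<close> keeps it inside the
    channel.\<close>
  have "c_bump = integral {1/2 + s'..1/2 + 2 * s'} (\<lambda>y. c_bump / s')"
    using s by simp
  also have "\<dots> \<le> integral {1/2 + s'..1/2 + 2 * s'} (bump s s')"
    using le by (intro integral_le integrable_continuous_interval continuous_on_subset[OF cont sub]) auto
  also have "\<dots> \<le> integral {0..1} (bump s s')"
    using s bump_nonneg[of s s']
    by (intro integral_subset_le sub integrable_continuous_interval cont
        continuous_on_subset[OF cont sub]) auto
  finally show ?thesis .
qed

lemma wronskian_same_l:
  assumes "s \<noteq> 0" "s' \<noteq> 0" "s \<noteq> s'" "D s l = 0" "D s' l = 0"
  shows "((\<lambda>y. ker s s' y * (phi s l y * phi s' l y)) has_integral 0) {0..1}"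
proof -
  have "((\<lambda>y. \<i> * of_real (s - s') * (ker s s' y * (phi s l y * phi s' l y))) has_integral 0) {0..1}"
    using wronskian[OF shoots_phi shoots_phi, of s l s' l] assms
    unfolding pot_diff_s[OF assms(1,2)] ker_def by (simp add: phi_1 mult.assoc)
  from has_integral_mult_right[OF this, of "1 / (\<i> * of_real (s - s'))"]
  show ?thesis using assms(3) by simp
qed

text \<open>The real part of \<open>ker\<close> is odd and of size \<open>1 / \<bar>y - 1/2\<bar>\<close>, but it meets only the small
  imaginary part of \<open>\<phi> \<phi>'\<close>; the imaginary part of \<open>ker\<close> concentrates at the centre, where
  \<open>\<phi> \<phi>'\<close> is close to \<open>(u (1/2))\<^sup>2 > 0\<close>.\<close>

lemma unique_s_ordered:
  "\<exists>d>0. \<forall>s s' l. 0 < s \<longrightarrow> s < s' \<longrightarrow> s' < d \<longrightarrow> \<bar>l - l0\<bar> < d \<longrightarrow> D s l = 0 \<longrightarrow> D s' l \<noteq> 0"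
proof -
  \<comment> \<open>\<open>f\<close> and \<open>k\<close> are half the central values of
    \<open>u\<^sup>2\<close> and \<open>- p\<close>. Near the centre
    \<open>u\<^sup>2 \<ge> 3/2 * f\<close> and an error of at most \<open>f / 2\<close> leave
    \<open>Re (F y) \<ge> f\<close>.\<close>
  define f where "f = (u (1/2))\<^sup>2 / 2"
  have f: "f > 0" using u_pos[of "1/2"] by (simp add: f_def)
  define k where "k = - p (1/2) / 2"
  have k: "k > 0" using p_mid by (simp add: k_def)
  obtain C0 where C0: "C0 > 0" "\<And>y. y \<in> {0..1} \<Longrightarrow> \<bar>u y\<bar> \<le> C0"
    using uv_bound by blast
  define C where "C = C0\<^sup>2 + 1"
  \<comment> \<open>The last entry limits the contribution \<open>P * E / m\<close> of the real part
    of the kernel to a quarter of \<open>k * f * c_bump\<close>, the gain from the critical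
    layer.\<close>
  define E where "E = min (min 1 (f / 2)) (m * (k * f * c_bump) / (4 * (P + 1)))"
  have "E \<le> min 1 (f / 2)" unfolding E_def by (rule min.cobounded1)
  moreover have "E > 0"
    using f k c_bump_pos P_nonneg m_pos by (simp add: E_def)
  ultimately have E: "E > 0" "E \<le> 1" "E \<le> f / 2"
    by (simp_all only: min.bounded_iff)
  have "E \<le> m * (k * f * c_bump) / (4 * (P + 1))" by (simp add: E_def)
  then have "E * (4 * (P + 1)) \<le> m * (k * f * c_bump)"
    using P_nonneg by (simp add: pos_le_divide_eq)
  moreover have "P * E * 4 \<le> E * (4 * (P + 1))" using E by (simp add: algebra_simps)
  ultimately have E4: "P * E / m \<le> k * f * c_bump / 4"
    using m_pos by (simp add: pos_divide_le_eq mult.commute)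
  obtain r where r: "r > 0" "\<And>y. y \<in> {0..1} \<Longrightarrow> \<bar>y - 1/2\<bar> < r \<Longrightarrow> p y \<le> - k \<and> (u y)\<^sup>2 \<ge> 3/2 * f"
  proof -
    have "(p \<longlongrightarrow> p (1/2)) (at (1/2) within {0..1})"
      using p_cont by (simp add: continuous_on_def)
    then have ev1: "\<forall>\<^sub>F y in at (1/2) within {0..1}. p y < - k"
      using p_mid by (intro order_tendstoD) (auto simp: k_def)
    have "((\<lambda>y. (u y)\<^sup>2) \<longlongrightarrow> (u (1/2))\<^sup>2) (at (1/2) within {0..1})"
      using u_cont by (intro tendsto_power) (simp add: continuous_on_def)
    then have ev2: "\<forall>\<^sub>F y in at (1/2) within {0..1}. (u y)\<^sup>2 > 3/2 * f"
      using u_pos[of "1/2"] by (intro order_tendstoD) (auto simp: f_def)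
    from eventually_conj[OF ev1 ev2] obtain r where
      r: "r > 0" "\<And>y. y \<in> {0..1} \<Longrightarrow> y \<noteq> 1/2 \<Longrightarrow> dist y (1/2) < r \<Longrightarrow> p y < - k \<and> (u y)\<^sup>2 > 3/2 * f"
      unfolding eventually_at by blast
    have "p y \<le> - k \<and> (u y)\<^sup>2 \<ge> 3/2 * f" if "y \<in> {0..1}" "\<bar>y - 1/2\<bar> < r" for y
    proof (cases "y = 1/2")
      case True
      show ?thesis unfolding True using p_mid f by (simp add: k_def f_def)
    next
      case False
      then show ?thesis using r(2)[OF that(1) False] that(2) by (simp add: dist_real_def)
    qed
    then show thesis using that r(1) by blast
  qed
  \<comment> \<open>The cost of the region outside radius \<open>r\<close>: there
    \<open>p * Re F\<close> is at most \<open>P * C\<close>, and \<open>k * f\<close> pays for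
    extending the subtracted term \<open>k * f * bump\<close> to the whole channel.\<close>
  define K where "K = (P * C + k * f) / (m * r)\<^sup>2"
  have C1: "C > 0" by (simp add: C_def add_nonneg_pos)
  have K: "K \<ge> 0" unfolding K_def using P_nonneg C1 k f by auto
  obtain d where d: "d > 0" "\<And>s l s' l' y. 0 \<le> s \<Longrightarrow> s < d \<Longrightarrow> \<bar>l - l0\<bar> < d \<Longrightarrow> 0 \<le> s' \<Longrightarrow> s' < d \<Longrightarrow> \<bar>l' - l0\<bar> < d
    \<Longrightarrow> y \<in> {0..1} \<Longrightarrow> norm (phi s l y * phi s' l' y - of_real ((u y)\<^sup>2)) \<le> E"
    "\<And>s l s' l' y. 0 \<le> s \<Longrightarrow> s < d \<Longrightarrow> \<bar>l - l0\<bar> < d \<Longrightarrow> 0 \<le> s' \<Longrightarrow> s' < d \<Longrightarrow> \<bar>l' - l0\<bar> < d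
    \<Longrightarrow> y \<in> {0..1} \<Longrightarrow> norm (psi s l y * phi s' l' y + phi s l y * psi s' l' y - of_real (2 * (u y * v y))) \<le> E"
    using prod_near_ground[OF E(1)] by blast
  \<comment> \<open>The entry 1/4 is needed for \<open>bump_integral\<close>; the last one limits
    \<open>K * (s + s')\<close> to a second quarter of the gain.\<close>
  define d' where "d' = min (min d (1/4)) (k * f * c_bump / (8 * (K + 1)))"
  have d': "d' > 0" using d(1) k f c_bump_pos K by (auto simp: d'_def)
  show ?thesis
  proof (intro exI[of _ d'] conjI allI impI notI)
    fix s s' l :: real
    assume s: "0 < s" "s < s'" and s'd: "s' < d'" and l: "\<bar>l - l0\<bar> < d'"
      and D1: "D s l = 0" and D2: "D s' l = 0"
    have rng: "0 \<le> s" "s < d" "\<bar>l - l0\<bar> < d" "0 \<le> s'" "s' < d" "\<bar>l - l0\<bar> < d"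
      using s s'd l by (auto simp: d'_def)
    have s'4: "s' \<le> 1/4" using s'd by (simp add: d'_def)
    have Ks: "K * (s + s') \<le> k * f * c_bump / 4"
    proof -
      have "s' \<le> k * f * c_bump / (8 * (K + 1))" using s'd by (simp add: d'_def)
      then have "s' * (8 * (K + 1)) \<le> k * f * c_bump" using K by (simp add: pos_le_divide_eq)
      moreover have "K * (s + s') * 4 \<le> s' * (8 * (K + 1))"
        using mult_left_mono[of s s' K] K s by (simp add: algebra_simps)
      ultimately show ?thesis by simp
    qed
    define F where "F = (\<lambda>y. phi s l y * phi s' l y)"
    define F' where "F' = (\<lambda>y. psi s l y * phi s' l y + phi s l y * psi s' l y)"
    have F_near: "norm (F y - of_real ((u y)\<^sup>2)) \<le> E" if "y \<in> {0..1}" for y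
      unfolding F_def by (rule d(2)[OF rng that])
    have F'_near: "norm (F' y - of_real (2 * (u y * v y))) \<le> E" if "y \<in> {0..1}" for y
      unfolding F'_def by (rule d(3)[OF rng that])
    have F_der: "(F has_vector_derivative F' y) (at y within {0..1})" if "y \<in> {0..1}" for y
      unfolding F_def F'_def using that
      by (auto intro!: derivative_eq_intros shootsD[OF shoots_phi])
    have F_cont: "continuous_on {0..1} F"
      unfolding F_def by (intro continuous_intros phi_cont)
    have ImF': "\<bar>Im (F' y)\<bar> \<le> E" if "y \<in> {0..1}" for y
      using F'_near[OF that] abs_Im_le_cmod[of "F' y - of_real (2 * (u y * v y))"] by simp
    have ReF: "\<bar>Re (F y) - (u y)\<^sup>2\<bar> \<le> E" if "y \<in> {0..1}" for y
      using F_near[OF that] abs_Re_le_cmod[of "F y - of_real ((u y)\<^sup>2)"] by simp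
    have ImF: "\<bar>Im (F y) - Im (F (1/2))\<bar> \<le> E * \<bar>y - 1/2\<bar>" if y: "y \<in> {0..1}" for y
    proof -
      have "norm (Im (F y) - Im (F (1/2))) \<le> E * norm (y - 1/2)"
      proof (rule field_differentiable_bound[of "{0..1}" "\<lambda>y. Im (F y)" "\<lambda>y. Im (F' y)"])
        show "((\<lambda>y. Im (F y)) has_field_derivative Im (F' z)) (at z within {0..1})" if "z \<in> {0..1}" for z
          unfolding has_real_derivative_iff_has_vector_derivative
          using bounded_linear.has_vector_derivative[OF bounded_linear_Im F_der[OF that]] .
      qed (use y ImF' in auto)
      then show ?thesis by simp
    qed
    have nz: "s \<noteq> 0" "s' \<noteq> 0" "s \<noteq> s'" using s by auto
    let ?h1 = "\<lambda>y. Re (ker s s' y)"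
    have h1_cont: "continuous_on {0..1} ?h1"
      by (intro continuous_intros ker_cont nz)
    \<comment> \<open>The odd kernel integrates to 0 against the constant
      \<open>Im (F (1/2))\<close>. After subtracting it, \<open>Im F\<close> vanishes linearly at
      the centre and compensates the singularity of the kernel.\<close>
    have h1_int: "((\<lambda>y. ?h1 y * Im (F (1/2))) has_integral 0 * Im (F (1/2))) {0..1}"
    proof (rule has_integral_mult_left[OF has_integral_odd_about_half[OF h1_cont]])
      show "?h1 (1 - y) = - ?h1 y" if "y \<in> {0..1}" for y
        unfolding ker_eq[OF nz(1,2)] using W_odd[OF that] p_even[OF that] by simp
    qed
    have "((\<lambda>y. Im (ker s s' y * F y)) has_integral Im 0) {0..1}"
      using has_integral_linear[OF wronskian_same_l[OF nz D1 D2] bounded_linear_Im]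
      by (simp add: F_def o_def)
    from has_integral_diff[OF this h1_int]
    have int0: "((\<lambda>y. ?h1 y * (Im (F y) - Im (F (1/2))) + p y * bump s s' y * Re (F y)) has_integral 0) {0..1}"
      by (simp add: ker_eq(2)[OF nz(1,2)] algebra_simps)
    have b_int: "((\<lambda>y. P * E / m + K * (s + s') - k * f * bump s s' y) has_integral
        (P * E / m + K * (s + s')) - k * f * integral {0..1} (bump s s')) {0..1}"
    proof (intro has_integral_diff has_integral_mult_right)
      show "((\<lambda>y. P * E / m + K * (s + s')) has_integral (P * E / m + K * (s + s'))) {0..1::real}"
        using has_integral_const_real[of "P * E / m + K * (s + s')" 0 1] by simp
      show "(bump s s' has_integral integral {0..1} (bump s s')) {0..1}"
        by (intro integrable_integral integrable_continuous_interval bump_cont nz)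
    qed
    have pw: "?h1 y * (Im (F y) - Im (F (1/2))) + p y * bump s s' y * Re (F y)
        \<le> P * E / m + K * (s + s') - k * f * bump s s' y" if y: "y \<in> {0..1}" for y
    proof -
      have g: "bump s s' y \<ge> 0" using s by (intro bump_nonneg) auto
      have "\<bar>?h1 y\<bar> * \<bar>Im (F y) - Im (F (1/2))\<bar> \<le> \<bar>?h1 y\<bar> * (E * \<bar>y - 1/2\<bar>)"
        using ImF[OF y] by (intro mult_left_mono) auto
      also have "\<dots> = \<bar>?h1 y\<bar> * (m * \<bar>y - 1/2\<bar>) * (E / m)" using m_pos by simp
      also have "\<dots> \<le> P * (E / m)"
        using ker_near_center[of s s' y] s y E m_pos by (intro mult_right_mono) auto
      finally have 1: "?h1 y * (Im (F y) - Im (F (1/2))) \<le> P * E / m"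
        by (simp flip: abs_mult)
      have 2: "p y * bump s s' y * Re (F y) \<le> K * (s + s') - k * f * bump s s' y"
      proof (cases "\<bar>y - 1/2\<bar> < r")
        case True
        then have "p y \<le> - k" "Re (F y) \<ge> f" using r(2)[OF y True] ReF[OF y] E(3) by auto
        then have "k * f \<le> (- p y) * Re (F y)" using k f by (intro mult_mono) auto
        then have "k * f * bump s s' y \<le> (- p y) * Re (F y) * bump s s' y"
          using g by (intro mult_right_mono) auto
        moreover have "K * (s + s') \<ge> 0" using K s by auto
        ultimately show ?thesis by (simp add: algebra_simps)
      next
        case False
        have "bump s s' y \<le> (s + s') / (m * r)\<^sup>2"
          using False s y r(1) by (intro bump_far) auto
        then have b: "(P * C + k * f) * bump s s' y \<le> (P * C + k * f) * ((s + s') / (m * r)\<^sup>2)"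
          using P_nonneg C1 k f by (intro mult_left_mono) auto
        have "(u y)\<^sup>2 \<le> C0\<^sup>2" using C0(2)[OF y] by (metis abs_le_square_iff abs_of_pos C0(1))
        then have "\<bar>Re (F y)\<bar> \<le> C" 
          using ReF[OF y] E(2) zero_le_power2[of "u y"] unfolding C_def by linarith
        then have "\<bar>p y\<bar> * \<bar>Re (F y)\<bar> \<le> P * C"
          using p_bound[OF y] P_nonneg by (intro mult_mono) auto
        then have "p y * Re (F y) \<le> P * C" by (simp flip: abs_mult)
        then have "p y * Re (F y) * bump s s' y \<le> P * C * bump s s' y"
          using g by (intro mult_right_mono)
        with b show ?thesis by (simp add: K_def algebra_simps)
      qed
      show ?thesis using 1 2 by linarith
    qed
    \<comment> \<open>The two error terms add up to at most half of \<open>k * f * c_bump\<close>,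
      while the subtracted term is at least all of it.\<close>
    have "0 \<le> (P * E / m + K * (s + s')) - k * f * integral {0..1} (bump s s')"
      by (rule has_integral_le[OF int0 b_int pw])
    moreover have "k * f * c_bump \<le> k * f * integral {0..1} (bump s s')"
      using bump_integral[of s s'] s s'4 k f by (intro mult_left_mono) auto
    moreover have "k * f * c_bump > 0" using k f c_bump_pos by simp
    ultimately show False using E4 Ks by linarith
  qed (rule d')
qed

lemma unique_s:
  "\<exists>d>0. \<forall>s s' l. 0 < s \<longrightarrow> s < d \<longrightarrow> 0 < s' \<longrightarrow> s' < d \<longrightarrow> \<bar>l - l0\<bar> < d \<longrightarrow> D s l = 0 \<longrightarrow> D s' l = 0 \<longrightarrow> s = s'"
proof -
  obtain d where d: "d > 0"
    "\<And>s s' l. 0 < s \<Longrightarrow> s < s' \<Longrightarrow> s' < d \<Longrightarrow> \<bar>l - l0\<bar> < d \<Longrightarrow> D s l = 0 \<Longrightarrow> D s' l \<noteq> 0"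
    using unique_s_ordered by blast
  then show ?thesis
    by (meson linorder_neqE_linordered_idom)
qed

end

text \<open>A continuous injection of an interval is strictly monotone, so \<open>a s\<close> moves
  away from \<open>a0\<close> as \<open>s\<close> grows. Hence \<open>a0\<close> is an end point of
  the open image interval, and being close to \<open>a0\<close> forces \<open>s\<close> to be small.
  On which side of \<open>a0\<close> the curve lies is left open.\<close>

lemma curve_inverse:
  fixes a :: "real \<Rightarrow> real"
  assumes s0: "s0 > 0" and cont: "continuous_on {0<..<s0} a" and inj: "inj_on a {0<..<s0}"
    and lim: "(a \<longlongrightarrow> a0) (at_right 0)"
  shows "\<exists>g. continuous_on (a ` {0<..<s0}) g \<and> (\<forall>s\<in>{0<..<s0}. g (a s) = s) \<and>
    is_interval (a ` {0<..<s0}) \<and> interior (a ` {0<..<s0}) \<noteq> {} \<and>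
    a0 \<in> frontier (a ` {0<..<s0}) \<and> (g \<longlongrightarrow> 0) (at a0 within a ` {0<..<s0})"
proof -
  let ?S = "{0<..<s0}"
  let ?I = "a ` ?S"
  define g where "g = inv_into ?S a"
  have g: "g (a s) = s" if "s \<in> ?S" for s
    unfolding g_def by (rule inv_into_f_f[OF inj that])
  have "connected ?I"
    by (intro connected_continuous_image cont) auto
  then have intv: "is_interval ?I" by (simp add: is_interval_connected_1)
  have openI: "open ?I"
    by (rule invariance_of_domain_gen[OF _ cont inj]) auto
  have intI: "interior ?I \<noteq> {}" using s0 openI by (auto simp: interior_open)
  have cont_g: "continuous_on ?I g"
    by (rule continuous_on_inverse_open[OF _ cont]) (use g in auto)
  have mono: "(a s < a t \<and> a t < a r) \<or> (a r < a t \<and> a t < a s)" if "0 < s" "s < t" "t < r" "r < s0" for s t r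
    using that by (intro continuous_inj_imp_mono continuous_on_subset[OF cont] inj_on_subset[OF inj]) auto
  have ev: "\<forall>\<^sub>F s in at_right 0. 0 < s \<and> s < b" if "b > 0" for b :: real
    using that by (intro eventually_at_rightI[of 0 b]) auto
  \<comment> \<open>The limit gives only a weak inequality between \<open>a0\<close> and
    \<open>a (t/2)\<close>; the detour through \<open>t/2\<close> makes the one between
    \<open>a0\<close> and \<open>a t\<close> strict.\<close>
  have side: "(a0 < a t \<and> (\<forall>s. t \<le> s \<longrightarrow> s < s0 \<longrightarrow> a t \<le> a s)) \<or>
      (a t < a0 \<and> (\<forall>s. t \<le> s \<longrightarrow> s < s0 \<longrightarrow> a s \<le> a t))" if t: "0 < t" "t < s0" for t
  proof -
    have ne: "a (t/2) \<noteq> a t" using inj_onD[OF inj, of "t/2" t] t by auto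
    show ?thesis
    proof (cases "a (t/2) < a t")
      case True
      have "\<forall>\<^sub>F s in at_right 0. a s \<le> a (t/2)"
        using ev[of "t/2"] mono[of _ "t/2" t] True t by (auto elim!: eventually_mono intro: less_imp_le)
      then have "a0 \<le> a (t/2)" by (intro tendsto_upperbound[OF lim]) auto
      moreover have "a t \<le> a s" if "t \<le> s" "s < s0" for s
        using mono[of "t/2" t s] True t that by (cases "s = t") auto
      ultimately show ?thesis using True by auto
    next
      case False
      have "\<forall>\<^sub>F s in at_right 0. a (t/2) \<le> a s"
        using ev[of "t/2"] mono[of _ "t/2" t] False t by (auto elim!: eventually_mono intro: less_imp_le)
      then have "a (t/2) \<le> a0" by (intro tendsto_lowerbound[OF lim]) auto
      moreover have "a s \<le> a t" if "t \<le> s" "s < s0" for s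
        using mono[of "t/2" t s] False t that by (cases "s = t") auto
      ultimately show ?thesis using False ne by auto
    qed
  qed
  have "a0 \<notin> ?I" using side by fastforce
  moreover have "a0 \<in> closure ?I"
  proof (rule Lim_in_closed_set[OF closed_closure _ _ lim])
    show "\<forall>\<^sub>F s in at_right 0. a s \<in> closure ?I"
      using ev[OF s0] by (rule eventually_mono) (auto intro: closure_subset[THEN subsetD])
  qed auto
  ultimately have front: "a0 \<in> frontier ?I"
    by (simp add: frontier_def interior_open[OF openI])
  have "(g \<longlongrightarrow> 0) (at a0 within ?I)"
  proof (rule tendstoI)
    fix e :: real assume e: "e > 0"
    define t where "t = min (e/2) (s0/2)"
    have t: "0 < t" "t < s0" "t < e" using e s0 by (auto simp: t_def)
    have "dist (g x) 0 < e" if x: "x \<in> ?I" "dist x a0 < \<bar>a t - a0\<bar>" for x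
    proof -
      obtain s where s: "s \<in> ?S" "x = a s" using x(1) by blast
      have "s < t"
      proof (rule ccontr)
        assume "\<not> s < t"
        then have "(a0 < a t \<and> a t \<le> a s) \<or> (a t < a0 \<and> a s \<le> a t)"
          using side[OF t(1,2)] s(1) by auto
        then have "\<bar>a t - a0\<bar> \<le> \<bar>a s - a0\<bar>" by linarith
        then show False using x(2) s(2) by (simp add: dist_real_def)
      qed
      then show ?thesis using s g[OF s(1)] t by (simp add: dist_real_def)
    qed
    moreover have "\<bar>a t - a0\<bar> > 0" using side[OF t(1,2)] by auto
    ultimately show "\<forall>\<^sub>F x in at a0 within ?I. dist (g x) 0 < e"
      unfolding eventually_at by blast
  qed
  then show ?thesis using g cont_g intv intI front by blast
qed

context odd_profile_ground
begin

text \<open>For small \<open>s\<close> the sign change of \<open>D 0\<close> at \<open>l0\<close>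
  persists for \<open>D s\<close>, so there is a zero \<open>lam s\<close>, single by
  \<open>unique_l\<close>. The sign of \<open>D s l\<close> then tells on which side of
  \<open>lam s\<close> the point \<open>l\<close> lies, whence continuity and the limit
  \<open>l0\<close>. Injectivity is \<open>unique_s\<close>.\<close>

theorem bifurcating_branch:
  "\<exists>s0>0. \<exists>lam. continuous_on {0<..<s0} lam \<and> inj_on lam {0<..<s0} \<and> (lam \<longlongrightarrow> l0) (at_right 0) \<and>
    (\<forall>s\<in>{0<..<s0}. D s (lam s) = 0)"
proof -
  obtain d1 where d1: "d1 > 0" "\<And>s l l'. 0 \<le> s \<Longrightarrow> s < d1 \<Longrightarrow> \<bar>l - l0\<bar> < d1 \<Longrightarrow> \<bar>l' - l0\<bar> < d1
    \<Longrightarrow> D s l = 0 \<Longrightarrow> D s l' = 0 \<Longrightarrow> l = l'"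
    using unique_l by blast
  obtain d2 where d2: "d2 > 0" "\<And>s s' l. 0 < s \<Longrightarrow> s < d2 \<Longrightarrow> 0 < s' \<Longrightarrow> s' < d2 \<Longrightarrow> \<bar>l - l0\<bar> < d2
    \<Longrightarrow> D s l = 0 \<Longrightarrow> D s' l = 0 \<Longrightarrow> s = s'"
    using unique_s by blast
  obtain d3 where d3: "d3 > 0" "\<And>l. \<bar>l - l0\<bar> < d3 \<Longrightarrow> l0 < l \<Longrightarrow> D 0 l > 0"
    "\<And>l. \<bar>l - l0\<bar> < d3 \<Longrightarrow> l < l0 \<Longrightarrow> D 0 l < 0"
    using sign_D_0 by blast
  \<comment> \<open>Halved so that the closed interval of radius \<open>d\<close> about
    \<open>l0\<close> lies strictly inside all three neighbourhoods.\<close>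
  define d where "d = min d1 (min d2 d3) / 2"
  have d: "d > 0" "d < d1" "d < d2" "d < d3" using d1(1) d2(1) d3(1) by (auto simp: d_def)
  have lim0: "((\<lambda>s. D s l) \<longlongrightarrow> D 0 l) (at_right 0)" for l
  proof (rule tendstoI)
    fix e :: real assume "e > 0"
    then have "e / 2 > 0" by simp
    from near_limit[OF this, of l] obtain b where b: "b > 0"
      "\<And>s y. 0 \<le> s \<Longrightarrow> s < b \<Longrightarrow> y \<in> {0..1} \<Longrightarrow>
        norm (phi s l y - phi 0 l y) + norm (psi s l y - psi 0 l y) \<le> e / 2"
      by (metis abs_zero diff_self)
    have "dist (D s l) (D 0 l) < e" if "0 < s" "s < b" for s
    proof -
      have "norm (phi s l 1 - phi 0 l 1) + norm (psi s l 1 - psi 0 l 1) \<le> e / 2"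
        using that by (intro b(2)) auto
      then show ?thesis
        using \<open>e / 2 > 0\<close> abs_Re_le_cmod[of "phi s l 1 - phi 0 l 1"]
          norm_ge_zero[of "psi s l 1 - psi 0 l 1"]
        unfolding dist_real_def D_def minus_complex.sel by linarith
    qed
    then show "\<forall>\<^sub>F s in at_right 0. dist (D s l) (D 0 l) < e"
      using b(1) by (intro eventually_at_rightI[of 0 b]) auto
  qed
  have "\<forall>\<^sub>F s in at_right 0. D s (l0 - d) < 0 \<and> D s (l0 + d) > 0 \<and> 0 < s \<and> s < d"
    using d d3(2)[of "l0 + d"] d3(3)[of "l0 - d"]
    by (intro eventually_conj order_tendstoD[OF lim0] eventually_at_rightI[of 0 d]) auto
  then obtain s0 where s0: "s0 > 0" "\<And>s. 0 < s \<Longrightarrow> s < s0 \<Longrightarrow> D s (l0 - d) < 0 \<and> D s (l0 + d) > 0 \<and> s < d"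
    unfolding eventually_at_right_field by blast
  let ?J = "{l0 - d..l0 + d}"
  have J: "\<bar>l - l0\<bar> < d1" "\<bar>l - l0\<bar> < d2" if "l \<in> ?J" for l using that d by auto
  have uniq: "l = l'" if "0 < s" "s < s0" "l \<in> ?J" "l' \<in> ?J" "D s l = 0" "D s l' = 0" for s l l'
    using d1(2)[of s l l'] that s0(2)[of s] J d by auto
  have right: "\<exists>x. l \<le> x \<and> x \<le> l0 + d \<and> D s x = 0" if "0 < s" "s < s0" "l \<in> ?J" "D s l \<le> 0" for s l
    using IVT'[of "D s" l 0 "l0 + d", OF _ _ _ D_cont_l] s0(2)[of s] that by auto
  have left: "\<exists>x. l0 - d \<le> x \<and> x \<le> l \<and> D s x = 0" if "0 < s" "s < s0" "l \<in> ?J" "0 \<le> D s l" for s l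
    using IVT'[of "D s" "l0 - d" 0 l, OF _ _ _ D_cont_l] s0(2)[of s] that by auto
  have "\<exists>x\<in>?J. D s x = 0" if "0 < s" "s < s0" for s
    using right[OF that, of "l0 - d"] s0(2)[OF that] d(1) by auto
  then obtain lam where lam: "\<And>s. 0 < s \<Longrightarrow> s < s0 \<Longrightarrow> lam s \<in> ?J \<and> D s (lam s) = 0"
    by metis
  have less: "l < lam s" if A: "0 < s" "s < s0" "l \<in> ?J" "D s l < 0" for s l
  proof -
    obtain x where "l \<le> x" "x \<le> l0 + d" "D s x = 0" using right[OF A(1-3)] A(4) by auto
    moreover from this have "x = lam s" using uniq[OF A(1,2), of x "lam s"] lam[OF A(1,2)] A(3) by auto
    ultimately show ?thesis using A(4) by (cases "l = x") auto
  qed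
  have greater: "lam s < l" if A: "0 < s" "s < s0" "l \<in> ?J" "D s l > 0" for s l
  proof -
    obtain x where "l0 - d \<le> x" "x \<le> l" "D s x = 0" using left[OF A(1-3)] A(4) by auto
    moreover from this have "x = lam s" using uniq[OF A(1,2), of x "lam s"] lam[OF A(1,2)] A(3) by auto
    ultimately show ?thesis using A(4) by (cases "l = x") auto
  qed
  have edge: "l0 - d < lam s \<and> lam s < l0 + d" if "0 < s" "s < s0" for s
    using less[OF that, of "l0 - d"] greater[OF that, of "l0 + d"] s0(2)[OF that] d(1) by auto
  have neg: "D s l < 0" if "0 < s" "s < s0" "l \<in> ?J" "l < lam s" for s l
    using greater[OF that(1-3)] uniq[OF that(1-3), of "lam s"] lam[OF that(1,2)] that(4)
    by (metis less_asym linorder_neqE_linordered_idom order_less_irrefl)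
  have pos: "D s l > 0" if "0 < s" "s < s0" "l \<in> ?J" "lam s < l" for s l
    using less[OF that(1-3)] uniq[OF that(1-3), of "lam s"] lam[OF that(1,2)] that(4)
    by (metis less_asym linorder_neqE_linordered_idom order_less_irrefl)
  text \<open>A strict sign of \<open>D s l\<close> persists for nearby \<open>s\<close> and locates \<open>lam\<close> relative to \<open>l\<close>.\<close>
  have tends: "(lam \<longlongrightarrow> b) F"
    if ev: "\<forall>\<^sub>F s in F. 0 < s \<and> s < s0" and bJ: "l0 - d < b" "b < l0 + d"
      and lt: "\<And>l. l \<in> ?J \<Longrightarrow> l < b \<Longrightarrow> \<forall>\<^sub>F s in F. D s l < 0"
      and gt: "\<And>l. l \<in> ?J \<Longrightarrow> b < l \<Longrightarrow> \<forall>\<^sub>F s in F. D s l > 0" for b and F :: "real filter"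
  proof (rule order_tendstoI)
    fix z assume z: "z < b"
    define l where "l = max z (l0 - d)"
    have l: "l \<in> ?J" "l < b" "z \<le> l" using z bJ d(1) by (auto simp: l_def)
    from ev lt[OF l(1,2)] show "\<forall>\<^sub>F s in F. z < lam s"
      by eventually_elim (use less[OF _ _ l(1)] l(3) in \<open>auto intro: le_less_trans\<close>)
  next
    fix z assume z: "b < z"
    define l where "l = min z (l0 + d)"
    have l: "l \<in> ?J" "b < l" "l \<le> z" using z bJ d(1) by (auto simp: l_def)
    from ev gt[OF l(1,2)] show "\<forall>\<^sub>F s in F. lam s < z"
      by eventually_elim (use greater[OF _ _ l(1)] l(3) in \<open>auto intro: less_le_trans\<close>)
  qed
  have "(lam \<longlongrightarrow> l0) (at_right 0)"
  proof (rule tends)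
    show "\<forall>\<^sub>F s in at_right 0. 0 < s \<and> s < s0"
      using s0(1) by (intro eventually_at_rightI[of 0 s0]) auto
    show "\<forall>\<^sub>F s in at_right 0. D s l < 0" if "l \<in> ?J" "l < l0" for l
      using d3(3)[of l] that d by (intro order_tendstoD[OF lim0]) auto
    show "\<forall>\<^sub>F s in at_right 0. D s l > 0" if "l \<in> ?J" "l0 < l" for l
      using d3(2)[of l] that d by (intro order_tendstoD[OF lim0]) auto
  qed (use d in auto)
  moreover have "continuous_on {0<..<s0} lam"
  proof (rule continuous_at_imp_continuous_on, rule ballI)
    fix s assume s: "s \<in> {0<..<s0}"
    have "(lam \<longlongrightarrow> lam s) (at s)"
    proof (rule tends)
      have "\<forall>\<^sub>F t in at s. t \<in> {0<..<s0}"
        using s by (intro eventually_at_in_open') auto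
      then show "\<forall>\<^sub>F t in at s. 0 < t \<and> t < s0" by simp
      show "\<forall>\<^sub>F t in at s. D t l < 0" if "l \<in> ?J" "l < lam s" for l
        using neg[of s l] that s by (intro order_tendstoD[OF D_tendsto_s]) auto
      show "\<forall>\<^sub>F t in at s. D t l > 0" if "l \<in> ?J" "lam s < l" for l
        using pos[of s l] that s by (intro order_tendstoD[OF D_tendsto_s]) auto
    qed (use edge[of s] s in auto)
    then show "isCont lam s" by (simp add: isCont_def)
  qed
  moreover have "inj_on lam {0<..<s0}"
  proof (rule inj_onI)
    fix s s' assume s: "s \<in> {0<..<s0}" "s' \<in> {0<..<s0}" and eq: "lam s = lam s'"
    show "s = s'"
      using d2(2)[of s s' "lam s"] lam[of s] lam[of s'] s eq s0(2)[of s] s0(2)[of s'] d J(2)[of "lam s"]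
      by auto
  qed
  moreover have "\<forall>s\<in>{0<..<s0}. D s (lam s) = 0" using lam by auto
  ultimately show ?thesis using s0(1) by blast
qed

end

section \<open>Eigenfunctions on the channel\<close>

lemma chan_derivI:
  assumes "(f has_vector_derivative f') (at y within {0..1})" "y \<in> {0..1}"
  shows "chan_deriv f y = f'"
  unfolding chan_deriv_def
  using vector_derivative_within_cbox[of 0 1 y f f'] assms by (simp add: box_real)

lemma shoots_chan_deriv:
  assumes "shoots q \<phi> \<psi>" "y \<in> {0..1}"
  shows "chan_deriv \<phi> y = \<psi> y" "chan_deriv (chan_deriv \<phi>) y = q y * \<phi> y"
proof -
  have 1: "chan_deriv \<phi> y = \<psi> y" if "y \<in> {0..1}" for y
    by (rule chan_derivI[OF shootsD(3)[OF assms(1) that] that])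
  then show "chan_deriv \<phi> y = \<psi> y" using assms(2) .
  have "(chan_deriv \<phi> has_vector_derivative q y * \<phi> y) (at y within {0..1})"
    by (rule has_vector_derivative_transform[OF assms(2) _ shootsD(4)[OF assms]]) (use 1 in auto)
  then show "chan_deriv (chan_deriv \<phi>) y = q y * \<phi> y"
    by (rule chan_derivI[OF _ assms(2)])
qed

lemma shoots_C2_chan:
  assumes "shoots q \<phi> \<psi>" "continuous_on {0..1} q"
  shows "C2_chan \<phi>"
proof -
  have d: "(chan_deriv \<phi> has_vector_derivative q y * \<phi> y) (at y within {0..1})" if "y \<in> {0..1}" for y
    by (rule has_vector_derivative_transform[OF that _ shootsD(4)[OF assms(1) that]])
       (use shoots_chan_deriv(1)[OF assms(1)] in auto)
  have "\<phi> differentiable_on {0..1}"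
    unfolding differentiable_on_def using shootsD(3)[OF assms(1)]
    by (blast intro: differentiableI_vector)
  moreover have "chan_deriv \<phi> differentiable_on {0..1}"
    unfolding differentiable_on_def using d by (blast intro: differentiableI_vector)
  moreover have "continuous_on {0..1} (\<lambda>y. q y * \<phi> y)"
    by (intro continuous_intros assms shootsD[OF assms(1)])
  then have "continuous_on {0..1} (chan_deriv (chan_deriv \<phi>))"
    by (rule continuous_on_eq) (use shoots_chan_deriv(2)[OF assms(1)] in auto)
  ultimately show ?thesis by (simp add: C2_chan_def)
qed

lemma shoots_nontrivial:
  assumes "shoots q \<phi> \<psi>"
  shows "\<exists>y\<in>{0..1}. \<phi> y \<noteq> 0"
proof (rule ccontr)
  assume "\<not> ?thesis"
  then have "\<phi> y = 0" if "y \<in> {0..1}" for y using that by blast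
  then have "(\<phi> has_vector_derivative 0) (at 0 within {0..1})"
    by (intro has_vector_derivative_transform[OF _ _ has_vector_derivative_const]) auto
  then have "chan_deriv \<phi> 0 = 0"
    by (rule chan_derivI) simp
  then show False
    using shoots_chan_deriv(1)[OF assms, of 0] shootsD(2)[OF assms] by simp
qed

text \<open>Every iterated derivative of \<open>\<phi>\<close> has the form
  \<open>P \<phi> + R \<psi>\<close>, since the equation eliminates \<open>\<psi>'\<close>.
  Coefficients are taken as restrictions of holomorphic functions because these are closed under
  differentiation.\<close>

lemma smooth_open_chan_linear_ode:
  assumes S: "open S" and Q: "Q holomorphic_on S"
    and in_S: "\<And>y. y \<in> {0<..<1} \<Longrightarrow> of_real y \<in> S"
    and \<phi>: "\<And>y. y \<in> {0<..<1} \<Longrightarrow> (\<phi> has_vector_derivative \<psi> y) (at y)"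
    and \<psi>: "\<And>y. y \<in> {0<..<1} \<Longrightarrow> (\<psi> has_vector_derivative Q (of_real y) * \<phi> y) (at y)"
  shows "smooth_open_chan \<phi>"
proof -
  let ?D = "\<lambda>g x. vector_derivative g (at x)"
  have step: "(f has_vector_derivative
      (deriv P (of_real y) + R (of_real y) * Q (of_real y)) * \<phi> y + (P (of_real y) + deriv R (of_real y)) * \<psi> y) (at y)"
    if P: "P holomorphic_on S" and R: "R holomorphic_on S" and y: "y \<in> {0<..<1}"
      and f: "\<And>y. y \<in> {0<..<1} \<Longrightarrow> f y = P (of_real y) * \<phi> y + R (of_real y) * \<psi> y" for P R f y
  proof -
    have "((\<lambda>y. P (of_real y)) has_vector_derivative deriv P (of_real y)) (at y)"
      "((\<lambda>y. R (of_real y)) has_vector_derivative deriv R (of_real y)) (at y)"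
      using holomorphic_derivI[OF P S in_S[OF y]] holomorphic_derivI[OF R S in_S[OF y]]
      by (auto intro: has_vector_derivative_real_field)
    then have "((\<lambda>y. P (of_real y) * \<phi> y + R (of_real y) * \<psi> y) has_vector_derivative
      (deriv P (of_real y) + R (of_real y) * Q (of_real y)) * \<phi> y + (P (of_real y) + deriv R (of_real y)) * \<psi> y) (at y)"
      by (auto intro!: derivative_eq_intros \<phi>[OF y] \<psi>[OF y] simp: algebra_simps)
    then show ?thesis
      by (rule has_vector_derivative_transform_within_open[of _ _ _ "{0<..<1}"]) (use y f in auto)
  qed
  have rep: "\<exists>P R. P holomorphic_on S \<and> R holomorphic_on S \<and>
      (\<forall>y\<in>{0<..<1}. (?D ^^ k) \<phi> y = P (of_real y) * \<phi> y + R (of_real y) * \<psi> y)" for k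
  proof (induction k)
    case 0
    show ?case by (intro exI[of _ "\<lambda>_. 1"] exI[of _ "\<lambda>_. 0"]) auto
  next
    case (Suc k)
    then obtain P R where PR: "P holomorphic_on S" "R holomorphic_on S"
      "\<And>y. y \<in> {0<..<1} \<Longrightarrow> (?D ^^ k) \<phi> y = P (of_real y) * \<phi> y + R (of_real y) * \<psi> y"
      by blast
    show ?case
    proof (intro exI conjI ballI)
      show "(\<lambda>z. deriv P z + R z * Q z) holomorphic_on S" "(\<lambda>z. P z + deriv R z) holomorphic_on S"
        using PR Q S by (auto intro!: holomorphic_intros)
      fix y :: real assume y: "y \<in> {0<..<1}"
      show "(?D ^^ Suc k) \<phi> y = (deriv P (of_real y) + R (of_real y) * Q (of_real y)) * \<phi> y
          + (P (of_real y) + deriv R (of_real y)) * \<psi> y"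
        using vector_derivative_at[OF step[OF PR(1,2) y PR(3)]] by simp
    qed
  qed
  show ?thesis
    unfolding smooth_open_chan_def
  proof (intro allI ballI)
    fix k and y :: real assume y: "y \<in> {0<..<1}"
    obtain P R where PR: "P holomorphic_on S" "R holomorphic_on S"
      "\<And>y. y \<in> {0<..<1} \<Longrightarrow> (?D ^^ k) \<phi> y = P (of_real y) * \<phi> y + R (of_real y) * \<psi> y"
      using rep[of k] by blast
    show "(?D ^^ k) \<phi> differentiable at y"
      using step[OF PR(1,2) y PR(3)] by (rule differentiableI_vector)
  qed
qed

section \<open>The shears\<close>

definition sinc :: "real \<Rightarrow> real" where
  "sinc x = (if x = 0 then 1 else sin x / x)"

lemma sin_eq_sinc: "sin x = x * sinc x"
  by (simp add: sinc_def)

lemma sinc_minus: "sinc (- x) = sinc x"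
  by (simp add: sinc_def)

lemma isCont_sinc: "isCont sinc x"
proof (cases "x = 0")
  case True
  have "(\<lambda>x. sin x / x) \<midarrow>0\<rightarrow> (1::real)"
    using DERIV_sin[of "0::real"] by (simp add: has_field_derivative_def field_has_derivative_at)
  then have "sinc \<midarrow>0\<rightarrow> 1"
    by (rule Lim_transform_eventually) (auto simp: sinc_def eventually_at intro!: exI[of _ 1])
  then show ?thesis using True by (simp add: isCont_def sinc_def)
next
  case False
  then have "isCont (\<lambda>x. sin x / x) x" by (intro continuous_intros)
  moreover have "\<forall>\<^sub>F y in nhds x. sinc y = sin y / y"
    using t1_space_nhds[OF False] by (rule eventually_mono) (simp add: sinc_def)
  ultimately show ?thesis by (simp add: isCont_cong)
qed

lemma abs_sinc_le_1: "\<bar>sinc x\<bar> \<le> 1"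
  using abs_sin_x_le_abs_x[of x] by (auto simp: sinc_def divide_le_eq_1)

lemma sinc_nonneg:
  assumes "\<bar>x\<bar> \<le> pi"
  shows "sinc x \<ge> 0"
proof -
  have "sinc \<bar>x\<bar> \<ge> 0"
    using sin_ge_zero[of "\<bar>x\<bar>"] assms by (auto simp: sinc_def)
  then show ?thesis by (cases "x \<ge> 0") (auto simp: sinc_minus)
qed

text \<open>The half-angle formula gives \<open>cos t \<ge> 1 - t\<^sup>2 / 2\<close>, which makes
  \<open>sin t - t + t ^ 3 / 6\<close> nondecreasing for \<open>t \<ge> 0\<close>.\<close>

lemma sinc_ge: "sinc x \<ge> 1 - x\<^sup>2 / 6"
proof -
  have cos_ge: "cos t \<ge> 1 - t\<^sup>2 / 2" for t :: real
  proof -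
    have "(sin (t/2))\<^sup>2 \<le> (t/2)\<^sup>2"
      using abs_sin_x_le_abs_x[of "t/2"] by (simp only: abs_le_square_iff)
    moreover have "cos t = 1 - 2 * (sin (t/2))\<^sup>2"
      using cos_double_sin[of "t/2"] by simp
    ultimately show ?thesis by (simp add: power_divide)
  qed
  have "sin t - t + t ^ 3 / 6 \<ge> sin 0 - 0 + 0 ^ 3 / 6" if "t \<ge> 0" for t :: real
  proof (rule DERIV_nonneg_imp_nondecreasing[OF that])
    fix s :: real
    have "((\<lambda>t. sin t - t + t ^ 3 / 6) has_real_derivative (cos s - 1 + s\<^sup>2 / 2)) (at s)"
      by (auto intro!: derivative_eq_intros)
    moreover have "cos s - 1 + s\<^sup>2 / 2 \<ge> 0" using cos_ge[of s] by simp
    ultimately show "\<exists>y. ((\<lambda>t. sin t - t + t ^ 3 / 6) has_real_derivative y) (at s) \<and> 0 \<le> y" by blast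
  qed
  then have "sin t \<ge> t * (1 - t\<^sup>2 / 6)" if "t \<ge> 0" for t :: real
    using that by (fastforce simp: algebra_simps power3_eq_cube power2_eq_square)
  from this[of "\<bar>x\<bar>"] have *: "sin \<bar>x\<bar> \<ge> \<bar>x\<bar> * (1 - x\<^sup>2 / 6)"
    by simp
  have "sinc \<bar>x\<bar> \<ge> 1 - x\<^sup>2 / 6"
    using * by (cases "x = 0") (auto simp: sinc_def pos_le_divide_eq mult.commute)
  then show ?thesis by (cases "x \<ge> 0") (auto simp: sinc_minus)
qed

section \<open>The shears as odd profiles, and a lower bound for their ground states\<close>

locale shear =
  fixes A :: real and n :: nat
  assumes A_gt: "1 / 2 * (1 / (4 * pi)) < A" and A_lt: "A < 1 / (4 * pi)" and n: "n \<ge> 1"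
begin

text \<open>The amplitude in \<open>U' = 1 + a cos (4 n pi y)\<close>. The hypotheses on
  \<open>A\<close> say \<open>1/2 < a < 1\<close>; the upper bound keeps \<open>U'\<close>
  positive.\<close>

definition a :: real where "a = 4 * pi * A"

text \<open>Recentring at 1/2 shifts the argument of the sine by \<open>2 n pi\<close>, so
  \<open>sin (4 n pi y)\<close> is \<open>4 n pi (y - 1/2) * S y\<close> and the zero at the
  critical layer becomes an explicit factor.\<close>

definition S :: "real \<Rightarrow> real" where "S y = sinc (4 * real n * pi * (y - 1/2))"

definition W :: "real \<Rightarrow> real" where "W y = (y - 1/2) * (1 + a * S y)"

text \<open>\<open>U'' / (U - 1/2)\<close> with the common factor \<open>y - 1/2\<close>
  cancelled.\<close>

definition p :: "real \<Rightarrow> real" where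
  "p y = - (16 * pi\<^sup>2 * (real n)\<^sup>2) * (a * S y / (1 + a * S y))"

lemma a_bounds: "1/2 < a" "a < 1"
  using A_gt A_lt by (auto simp: a_def field_simps)

lemma abs_aS: "\<bar>a * S y\<bar> \<le> a"
  using abs_sinc_le_1[of "4 * real n * pi * (y - 1/2)"] a_bounds
  by (simp add: S_def abs_mult mult_le_cancel_left1)

lemma one_aS: "1 - a \<le> 1 + a * S y" "1 + a * S y \<le> 2" "1 + a * S y > 0"
  using abs_aS[of y] a_bounds by linarith+

lemma S_cont: "continuous_on X S"
  unfolding S_def
  by (intro continuous_at_imp_continuous_on ballI continuous_at_compose[OF _ isCont_sinc, unfolded o_def])
     (auto intro!: continuous_intros)

lemma S_even: "S (1 - y) = S y"
proof -
  have "4 * real n * pi * (1 - y - 1/2) = - (4 * real n * pi * (y - 1/2))"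
    by (simp add: algebra_simps)
  then show ?thesis by (simp only: S_def sinc_minus)
qed

lemma sin_eq: "sin (4 * real n * pi * y) = 4 * real n * pi * (y - 1/2) * S y"
proof -
  have "4 * real n * pi * y = 4 * real n * pi * (y - 1/2) + 2 * real n * pi"
    by (simp add: algebra_simps)
  moreover have "sin (x + 2 * real n * pi) = sin x" for x
    unfolding sin_add cos_2npi sin_2npi by simp
  ultimately show ?thesis
    unfolding S_def by (simp only: flip: sin_eq_sinc)
qed

lemma shear_profile_eq: "shear_profile A n y = 1/2 + W y"
  unfolding shear_profile_def sin_eq W_def a_def using n by (simp add: field_simps)

lemma shear_deriv: "chan_deriv (shear_profile A n) y = 1 + a * cos (4 * real n * pi * y)" if "y \<in> {0..1}"
proof (rule chan_derivI[OF _ that])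
  have "(shear_profile A n has_real_derivative 1 + a * cos (4 * real n * pi * y)) (at y within {0..1})"
    unfolding shear_profile_def[abs_def] a_def using n by (auto intro!: derivative_eq_intros)
  then show "(shear_profile A n has_vector_derivative 1 + a * cos (4 * real n * pi * y)) (at y within {0..1})"
    by (simp add: has_real_derivative_iff_has_vector_derivative)
qed

lemma shear_deriv2: "chan_deriv (chan_deriv (shear_profile A n)) y = - (4 * real n * pi * a * sin (4 * real n * pi * y))"
  if "y \<in> {0..1}"
proof (rule chan_derivI[OF _ that])
  have "((\<lambda>y. 1 + a * cos (4 * real n * pi * y)) has_real_derivative - (4 * real n * pi * a * sin (4 * real n * pi * y)))
      (at y within {0..1})"
    by (auto intro!: derivative_eq_intros)
  then have "((\<lambda>y. 1 + a * cos (4 * real n * pi * y)) has_vector_derivative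
      - (4 * real n * pi * a * sin (4 * real n * pi * y))) (at y within {0..1})"
    by (simp add: has_real_derivative_iff_has_vector_derivative)
  then show "(chan_deriv (shear_profile A n) has_vector_derivative
      - (4 * real n * pi * a * sin (4 * real n * pi * y))) (at y within {0..1})"
    by (rule has_vector_derivative_transform[OF that, rotated]) (use shear_deriv in auto)
qed

lemma shear_deriv2_eq:
  assumes "y \<in> {0..1}"
  shows "chan_deriv (chan_deriv (shear_profile A n)) y = p y * W y"
  unfolding shear_deriv2[OF assms] sin_eq p_def W_def
  using one_aS(3)[of y] by (simp add: power2_eq_square)

text \<open>The constants for \<open>W\<close> come from
  \<open>1 - a \<le> 1 + a * S y \<le> 2\<close>, the one for \<open>p\<close> from
  \<open>\<bar>a * S y\<bar> \<le> a\<close> over the smallest denominator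
  \<open>1 - a\<close>.\<close>

sublocale odd_profile W p "1 - a" 2 "16 * pi\<^sup>2 * (real n)\<^sup>2 * (a / (1 - a))"
proof
  show "continuous_on {0..1} W"
    unfolding W_def by (intro continuous_intros S_cont)
  show "continuous_on {0..1} p"
    unfolding p_def using one_aS(3)
    by (intro continuous_intros S_cont) (auto simp: less_imp_neq[symmetric])
  show "W (1 - y) = - W y" "p (1 - y) = p y" for y
    unfolding W_def p_def S_even by (simp_all add: algebra_simps)
  show "1 - a > 0" using a_bounds by simp
  show "(1 - a) * \<bar>y - 1/2\<bar> \<le> \<bar>W y\<bar>" for y
    using mult_right_mono[OF one_aS(1)[of y], of "\<bar>y - 1/2\<bar>"] one_aS(3)[of y]
    by (simp add: W_def abs_mult mult.commute)
  show "\<bar>W y\<bar> \<le> 2 * \<bar>y - 1/2\<bar>" for y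
    using mult_right_mono[OF one_aS(2)[of y], of "\<bar>y - 1/2\<bar>"] one_aS(3)[of y]
    by (simp add: W_def abs_mult mult.commute)
  show "\<bar>p y\<bar> \<le> 16 * pi\<^sup>2 * (real n)\<^sup>2 * (a / (1 - a))" for y
  proof -
    have "\<bar>a * S y / (1 + a * S y)\<bar> \<le> a / (1 - a)"
      using abs_aS[of y] one_aS(1,3)[of y] a_bounds
      unfolding abs_divide by (intro frac_le) auto
    then show ?thesis
      unfolding p_def abs_mult by (intro mult_mono) auto
  qed
  show "p (1/2) < 0"
    using n a_bounds by (simp add: p_def S_def sinc_def divide_pos_pos)
qed

text \<open>The lower bound on \<open>A\<close> enters through
  \<open>1 + a * S y \<le> 1 + a \<le> 3 * a\<close>, which gives
  \<open>a S / (1 + a S) \<ge> S / 3\<close>; then \<open>sinc_ge\<close> applies. The restriction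
  on \<open>y\<close> keeps the argument of \<open>sinc\<close> within \<open>pi\<close> of 0, where
  \<open>S\<close> is nonnegative.\<close>

lemma p_le_near_center:
  assumes "\<bar>y - 1/2\<bar> \<le> 1 / (4 * real n)"
  shows "p y \<le> - (16 * pi\<^sup>2 * (real n)\<^sup>2 / 3) * (1 - 8/3 * pi\<^sup>2 * (real n)\<^sup>2 * (y - 1/2)\<^sup>2)"
proof -
  define z where "z = 4 * real n * pi * (y - 1/2)"
  have "\<bar>z\<bar> = 4 * real n * pi * \<bar>y - 1/2\<bar>" by (simp add: z_def abs_mult)
  also have "\<dots> \<le> 4 * real n * pi * (1 / (4 * real n))" using assms by (intro mult_left_mono) auto
  also have "\<dots> = pi" using n by simp
  finally have "sinc z \<ge> 0" by (rule sinc_nonneg)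
  then have S: "0 \<le> S y" "S y \<le> 1"
    using abs_sinc_le_1[of z] by (auto simp: S_def z_def)
  have "S y * (1 + a * S y) \<le> 3 * (a * S y)"
  proof -
    have "a * S y \<le> a" using S a_bounds by (simp add: mult_le_cancel_left1)
    then have "1 + a * S y \<le> 3 * a" using a_bounds by linarith
    from mult_left_mono[OF this S(1)] show ?thesis by (simp add: mult_ac)
  qed
  then have "S y / 3 \<le> a * S y / (1 + a * S y)"
    using one_aS(3)[of y] by (simp add: pos_le_divide_eq)
  moreover have "S y \<ge> 1 - z\<^sup>2 / 6" using sinc_ge[of z] by (simp add: S_def z_def)
  ultimately have "(1 - z\<^sup>2 / 6) / 3 \<le> a * S y / (1 + a * S y)" by simp
  then have "16 * pi\<^sup>2 * (real n)\<^sup>2 * ((1 - z\<^sup>2 / 6) / 3) \<le> 16 * pi\<^sup>2 * (real n)\<^sup>2 * (a * S y / (1 + a * S y))"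
    by (intro mult_left_mono) auto
  moreover have "z\<^sup>2 / 6 = 8/3 * pi\<^sup>2 * (real n)\<^sup>2 * (y - 1/2)\<^sup>2"
    by (simp add: z_def power_mult_distrib)
  ultimately show ?thesis by (simp add: p_def)
qed

text \<open>The test function \<open>b\<^sup>2 - (y - 1/2)\<^sup>2\<close> has negative energy on \<open>\<bar>y - 1/2\<bar> \<le> b = 1 / (4 n)\<close>, so by Picone's
  identity no solution is positive there.\<close>

lemma no_positive_solution:
  assumes uv: "shoots (\<lambda>y. (real n)\<^sup>2 / 100 + p y) u v"
  shows "\<exists>y\<in>{0<..1}. u y \<le> 0"
proof (rule ccontr)
  assume "\<not> ?thesis"
  then have pos: "u y > 0" if "y \<in> {0<..1}" for y using that by (auto simp: not_le)
  define N where "N = real n"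
  have N: "N \<ge> 1" using n by (simp add: N_def)
  define b where "b = 1 / (4 * N)"
  have b: "b > 0" "b \<le> 1/4" using N by (auto simp: b_def divide_simps)
  define h where "h = (\<lambda>y. b\<^sup>2 - (y - 1/2)\<^sup>2)"
  \<comment> \<open>\<open>c1 + c2 * x\<^sup>2\<close> with \<open>x = y - 1/2\<close> is the upper
    bound for the potential supplied by \<open>p_le_near_center\<close>.\<close>
  define c1 where "c1 = N\<^sup>2 / 100 - 16 * pi\<^sup>2 * N\<^sup>2 / 3"
  define c2 where "c2 = 128 / 9 * pi ^ 4 * N ^ 4"
  \<comment> \<open>Picone's function \<open>h\<^sup>2 u' / u\<close>. It vanishes at both ends of
    the interval because \<open>h\<close> does, so \<open>G'\<close> has integral 0.\<close>
  define G where "G = (\<lambda>y. (h y)\<^sup>2 * (v y / u y))"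
  define G' where "G' = (\<lambda>y. 2 * h y * (- 2 * (y - 1/2)) * (v y / u y) + (h y)\<^sup>2 * (N\<^sup>2 / 100 + p y)
      - (h y)\<^sup>2 * (v y / u y)\<^sup>2)"
  \<comment> \<open>The energy density of the test function: \<open>4 * x\<^sup>2\<close> is
    \<open>h'\<^sup>2\<close>, the rest bounds the potential times \<open>h\<^sup>2\<close>.
    \<open>H\<close> is its antiderivative.\<close>
  define R where "R = (\<lambda>x. 4 * x\<^sup>2 + (c1 + c2 * x\<^sup>2) * (b\<^sup>2 - x\<^sup>2)\<^sup>2)"
  define H where "H = (\<lambda>x. 4 * x ^ 3 / 3 + c1 * (b ^ 4 * x - 2 * b\<^sup>2 * x ^ 3 / 3 + x ^ 5 / 5)
      + c2 * (b ^ 4 * x ^ 3 / 3 - 2 * b\<^sup>2 * x ^ 5 / 5 + x ^ 7 / 7))"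
  let ?I = "{1/2 - b..1/2 + b}"
  have sub: "?I \<subseteq> {0<..<1}" using b by auto
  have "(G' has_integral (G (1/2 + b) - G (1/2 - b))) ?I"
  proof (rule fundamental_theorem_of_calculus)
    fix y assume y: "y \<in> ?I"
    have u: "u y > 0" using pos[of y] sub y by auto
    have y01: "y \<in> {0..1}" "?I \<subseteq> {0..1}" using y sub b by auto
    have du: "(u has_real_derivative v y) (at y within ?I)"
      and dv: "(v has_real_derivative (N\<^sup>2 / 100 + p y) * u y) (at y within ?I)"
      using shootsD(3,4)[OF uv y01(1), THEN has_vector_derivative_within_subset, OF y01(2)]
      by (simp_all only: has_real_derivative_iff_has_vector_derivative N_def)
    have "((N\<^sup>2 / 100 + p y) * u y * u y - v y * v y) / (u y * u y) = (N\<^sup>2 / 100 + p y) - (v y / u y)\<^sup>2"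
      using u by (simp add: diff_divide_distrib power_divide power2_eq_square)
    with DERIV_divide[OF dv du] u
    have dw: "((\<lambda>y. v y / u y) has_real_derivative (N\<^sup>2 / 100 + p y) - (v y / u y)\<^sup>2) (at y within ?I)"
      by simp
    have dh: "((\<lambda>y. (h y)\<^sup>2) has_real_derivative 2 * h y * (- 2 * (y - 1/2))) (at y within ?I)"
      unfolding h_def by (auto intro!: derivative_eq_intros)
    have "(G has_real_derivative G' y) (at y within ?I)"
      using DERIV_mult[OF dh dw] unfolding G_def G'_def by (simp add: algebra_simps)
    then show "(G has_vector_derivative G' y) (at y within ?I)"
      by (simp add: has_real_derivative_iff_has_vector_derivative)
  qed (use b in auto)
  then have int_G': "(G' has_integral 0) ?I"
    by (simp add: G_def h_def)
  have int_R: "((\<lambda>y. R (y - 1/2)) has_integral (H (1/2 + b - 1/2) - H (1/2 - b - 1/2))) ?I"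
  proof (rule fundamental_theorem_of_calculus)
    fix y assume "y \<in> ?I"
    have "((\<lambda>y. H (y - 1/2)) has_real_derivative R (y - 1/2)) (at y within ?I)"
      unfolding H_def R_def
      by (auto intro!: derivative_eq_intros simp: field_simps power2_eq_square power4_eq_xxxx eval_nat_numeral)
    then show "((\<lambda>y. H (y - 1/2)) has_vector_derivative R (y - 1/2)) (at y within ?I)"
      by (simp add: has_real_derivative_iff_has_vector_derivative)
  qed (use b in auto)
  have "0 \<le> H (1/2 + b - 1/2) - H (1/2 - b - 1/2)"
  proof (rule has_integral_le[OF int_G' int_R])
    fix y assume y: "y \<in> ?I"
    have "p y \<le> - (16 * pi\<^sup>2 * N\<^sup>2 / 3) * (1 - 8/3 * pi\<^sup>2 * N\<^sup>2 * (y - 1/2)\<^sup>2)"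
      unfolding N_def by (rule p_le_near_center) (use y in \<open>auto simp: b_def N_def abs_le_iff\<close>)
    also have "\<dots> = - (16 * pi\<^sup>2 * N\<^sup>2 / 3) + c2 * (y - 1/2)\<^sup>2"
    proof -
      have "- (16 * pi\<^sup>2 * N\<^sup>2 / 3) * (1 - 8/3 * pi\<^sup>2 * N\<^sup>2 * t) = - (16 * pi\<^sup>2 * N\<^sup>2 / 3) + c2 * t" for t
        by (simp add: c2_def algebra_simps power2_eq_square power4_eq_xxxx)
      then show ?thesis .
    qed
    finally have "N\<^sup>2 / 100 + p y \<le> c1 + c2 * (y - 1/2)\<^sup>2"
      by (simp add: c1_def)
    then have "(h y)\<^sup>2 * (N\<^sup>2 / 100 + p y) \<le> (h y)\<^sup>2 * (c1 + c2 * (y - 1/2)\<^sup>2)"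
      by (intro mult_left_mono) auto
    \<comment> \<open>This is \<open>(h' - h u' / u)\<^sup>2 \<ge> 0\<close> with
      \<open>h' = - 2 x\<close>.\<close>
    moreover have "2 * c * (- 2 * x) * w - c\<^sup>2 * w\<^sup>2 \<le> 4 * x\<^sup>2" for x c w :: real
      using zero_le_power2[of "2 * x + c * w"] by (simp add: power2_eq_square algebra_simps)
    from this[of "h y" "y - 1/2" "v y / u y"]
    have "2 * h y * (- 2 * (y - 1/2)) * (v y / u y) - (h y)\<^sup>2 * (v y / u y)\<^sup>2 \<le> 4 * (y - 1/2)\<^sup>2" .
    ultimately show "G' y \<le> R (y - 1/2)"
      unfolding G'_def R_def by (simp add: h_def mult.commute)
  qed
  \<comment> \<open>Up to the factor \<open>b ^ 3\<close> only \<open>c1 * b\<^sup>2\<close> and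
    \<open>c2 * b ^ 4\<close> remain, and these do not depend on \<open>n\<close>; the sign becomes
    a question about powers of \<open>pi\<close>.\<close>
  also have "H (1/2 + b - 1/2) - H (1/2 - b - 1/2) = b ^ 3 * (8/3 + 16/15 * (c1 * b\<^sup>2) + 16/105 * (c2 * b ^ 4))"
    unfolding H_def by (simp add: field_simps eval_nat_numeral)
  also have "c1 * b\<^sup>2 = 1/1600 - pi\<^sup>2 / 3"
    using N by (simp add: c1_def b_def field_simps power2_eq_square)
  also have "c2 * b ^ 4 = pi ^ 4 / 18"
    using N by (simp add: c2_def b_def field_simps eval_nat_numeral)
  finally have "0 \<le> b ^ 3 * (8/3 + 16/15 * (1/1600 - pi\<^sup>2 / 3) + 16/105 * (pi ^ 4 / 18))" .
  then have neg: "0 \<le> 8/3 + 16/15 * (1/1600 - pi\<^sup>2 / 3) + 16/105 * (pi ^ 4 / 18)"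
    using b by (simp add: zero_le_mult_iff)
  have "3.14 \<le> pi" "pi \<le> 3.15" using pi_approx by simp_all
  then have t: "9.85 \<le> pi\<^sup>2" "pi\<^sup>2 \<le> 10"
    using power_mono[of "3.14" pi 2] power_mono[of pi "3.15" 2] by (auto simp: power2_eq_square)
  \<comment> \<open>On \<open>[9.85, 10]\<close> the square lies below its chord, which replaces
    \<open>pi ^ 4\<close> by a linear expression in \<open>pi\<^sup>2\<close>.\<close>
  have expand: "(t - 9.85) * (10 - t) = 19.85 * t - 98.5 - t * t" for t :: real
    by (simp add: field_simps)
  have "(pi\<^sup>2 - 9.85) * (10 - pi\<^sup>2) \<ge> 0" using t by (intro mult_nonneg_nonneg) auto
  moreover have "pi ^ 4 = pi\<^sup>2 * pi\<^sup>2" by (simp flip: power_add)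
  ultimately have pi4: "pi ^ 4 \<le> 19.85 * pi\<^sup>2 - 98.5" using expand[of "pi\<^sup>2"] by linarith
  have contra: False if "0 \<le> 8/3 + 16/15 * (1/1600 - r / 3) + 16/105 * (q / 18)"
    "q \<le> 19.85 * r - 98.5" "9.85 \<le> r" for q r :: real
    using that by (simp add: field_simps)
  show False by (rule contra[OF neg pi4 t(1)])
qed

end

section \<open>From shooting solutions to Rayleigh eigenmodes of the shears\<close>

context shear
begin

text \<open>Multiplication by \<open>U - c\<close> undoes the quotient in \<open>pot\<close>,
  leaving \<open>p * W = U''\<close>. For \<open>s = 0\<close> this also holds at the critical
  layer, where both sides are 0.\<close>

lemma eigenfunction_of_shoots:
  assumes "shoots (pot s l) \<phi> \<psi>" "\<phi> 1 = 0" "l > 0"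
  shows "rayleigh_eigenfunction (shear_profile A n) (sqrt l) (1/2 + \<i> * of_real s) \<phi>"
  unfolding rayleigh_eigenfunction_def
proof (intro conjI ballI)
  show "C2_chan \<phi>" by (rule shoots_C2_chan[OF assms(1) pot_cont])
  show "\<phi> 0 = 0" by (rule shootsD(1)[OF assms(1)])
  show "\<exists>y\<in>{0..1}. \<phi> y \<noteq> 0" by (rule shoots_nontrivial[OF assms(1)])
  fix y :: real assume y: "y \<in> {0..1}"
  have den: "of_real (shear_profile A n y) - (1/2 + \<i> * of_real s) = den s y"
    by (simp add: shear_profile_eq den_def)
  have "(of_real (sqrt l))\<^sup>2 = complex_of_real l"
    using assms(3) by (simp flip: of_real_power)
  moreover have "den s y * (pot s l y - of_real l) = of_real (p y * W y)"
  proof (cases "s = 0")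
    case True
    then show ?thesis by (simp add: pot_def den_def)
  next
    case False
    then show ?thesis using den_nz[OF False, of y] by (simp add: pot_def)
  qed
  ultimately show "of_real (chan_deriv (chan_deriv (shear_profile A n)) y) * \<phi> y
      - (of_real (shear_profile A n y) - (1/2 + \<i> * of_real s)) *
        (chan_deriv (chan_deriv \<phi>) y - (of_real (sqrt l))\<^sup>2 * \<phi> y) = 0"
    unfolding shear_deriv2_eq[OF y] den shoots_chan_deriv(2)[OF assms(1) y]
    by (simp add: left_diff_distrib[symmetric] flip: mult.assoc)
qed (rule assms)

text \<open>Since \<open>Im c > 0\<close>, the entire extension of \<open>U - c\<close> has no zero
  on the real line, so the coefficient of the equation is holomorphic on the open set
  \<open>T\<close> around it. This covers any classical eigenfunction, not only those obtained by
  shooting.\<close>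

lemma eigenfunction_smooth:
  assumes eig: "rayleigh_eigenfunction (shear_profile A n) \<alpha> c \<phi>" and c: "Im c > 0"
  shows "smooth_open_chan \<phi>"
proof -
  define Uc where "Uc = (\<lambda>z::complex. z + of_real (A / real n) * sin (of_real (4 * real n * pi) * z))"
  define V where "V = (\<lambda>z::complex. - of_real (4 * real n * pi * a) * sin (of_real (4 * real n * pi) * z))"
  define T where "T = {z. Uc z - c \<noteq> 0}"
  define Q where "Q = (\<lambda>z. (of_real \<alpha>)\<^sup>2 + V z / (Uc z - c))"
  have U: "Uc (of_real y) = of_real (shear_profile A n y)" for y
    by (simp add: Uc_def shear_profile_def flip: sin_of_real)
  have V: "V (of_real y) = of_real (chan_deriv (chan_deriv (shear_profile A n)) y)" if "y \<in> {0..1}" for y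
    unfolding shear_deriv2[OF that] by (simp add: V_def flip: sin_of_real)
  have nz: "of_real (shear_profile A n y) - c \<noteq> 0" for y
    using c by (auto simp: complex_eq_iff)
  have openT: "open T"
    unfolding T_def Uc_def by (intro open_Collect_neq continuous_intros)
  have "Q holomorphic_on T"
    unfolding Q_def V_def Uc_def T_def by (intro holomorphic_intros) auto
  moreover have "of_real y \<in> T" for y using nz U by (simp add: T_def)
  moreover have "(\<phi> has_vector_derivative chan_deriv \<phi> y) (at y)"
    and "(chan_deriv \<phi> has_vector_derivative Q (of_real y) * \<phi> y) (at y)" if y: "y \<in> {0<..<1}" for y
  proof -
    have y01: "y \<in> {0..1}" using y by simp
    have at: "at y within {0..1} = at y" using y by (intro at_within_Icc_at) auto
    have d: "\<phi> differentiable (at y)" "chan_deriv \<phi> differentiable (at y)"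
      using eig y01 unfolding rayleigh_eigenfunction_def C2_chan_def differentiable_on_def
      by (auto simp flip: at)
    then show "(\<phi> has_vector_derivative chan_deriv \<phi> y) (at y)"
      unfolding chan_deriv_def at by (simp add: vector_derivative_works)
    have "of_real (chan_deriv (chan_deriv (shear_profile A n)) y) * \<phi> y
        - (of_real (shear_profile A n y) - c) * (chan_deriv (chan_deriv \<phi>) y - (of_real \<alpha>)\<^sup>2 * \<phi> y) = 0"
      using eig y01 unfolding rayleigh_eigenfunction_def by blast
    then have "chan_deriv (chan_deriv \<phi>) y = Q (of_real y) * \<phi> y"
      unfolding Q_def U V[OF y01] using nz[of y] by (simp add: field_simps)
    then show "(chan_deriv \<phi> has_vector_derivative Q (of_real y) * \<phi> y) (at y)"
      using d(2) unfolding chan_deriv_def[of "chan_deriv \<phi>"] at by (simp add: vector_derivative_works)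
  qed
  ultimately show ?thesis
    using openT by (intro smooth_open_chan_linear_ode[of T Q \<phi> "chan_deriv \<phi>"]) auto
qed

text \<open>The branch comes parametrised by \<open>s = Im c\<close>; \<open>curve_inverse\<close>
  reparametrises it by the wave number \<open>sqrt (lam s)\<close>, after shrinking to where
  \<open>lam s > 0\<close>. The constant 1/10 is the square root of the 1/100 in
  \<open>no_positive_solution\<close>.\<close>

theorem unstable_branch:
  "\<exists>\<alpha>\<^sub>n I c. \<alpha>\<^sub>n \<ge> 1/10 * real n \<and> unstable_curve_from (shear_profile A n) \<alpha>\<^sub>n (1 / 2) I c"
proof -
  have "\<exists>l u v. (real n)\<^sup>2 / 100 \<le> l \<and> shoots (\<lambda>y. l + p y) u v \<and> u 1 = 0 \<and> (\<forall>y\<in>{0<..<1}. u y > 0)"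
    by (rule ground_state_exists[OF p_cont]) (rule no_positive_solution)
  then obtain l0 u v where l0: "(real n)\<^sup>2 / 100 \<le> l0" and uv: "shoots (\<lambda>y. l0 + p y) u v"
    and u1: "u 1 = 0" and upos: "\<And>y. y \<in> {0<..<1} \<Longrightarrow> u y > 0"
    by blast
  interpret odd_profile_ground W p "1 - a" 2 "16 * pi\<^sup>2 * (real n)\<^sup>2 * (a / (1 - a))" l0 u v
    by unfold_locales (use uv u1 upos in auto)
  have l0_pos: "l0 > 0"
    using l0 n by (meson divide_pos_pos less_le_trans of_nat_0_less_iff zero_less_numeral zero_less_power
        less_le_trans zero_less_one)
  obtain s1 lam where s1: "s1 > 0" and lam: "continuous_on {0<..<s1} lam" "inj_on lam {0<..<s1}"
    "(lam \<longlongrightarrow> l0) (at_right 0)" "\<And>s. s \<in> {0<..<s1} \<Longrightarrow> D s (lam s) = 0"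
    using bifurcating_branch by blast
  have "\<forall>\<^sub>F s in at_right 0. lam s > 0"
    using lam(3) l0_pos by (rule order_tendstoD)
  then obtain s2 where s2: "s2 > 0" "\<And>s. 0 < s \<Longrightarrow> s < s2 \<Longrightarrow> lam s > 0"
    unfolding eventually_at_right_field by blast
  define s0 where "s0 = min s1 s2"
  have s0: "s0 > 0" "s0 \<le> s1" "s0 \<le> s2" using s1 s2(1) by (auto simp: s0_def)
  let ?S = "{0<..<s0}"
  define b where "b = (\<lambda>s. sqrt (lam s))"
  have "continuous_on ?S b"
    unfolding b_def using s0 by (intro continuous_intros continuous_on_subset[OF lam(1)]) auto
  moreover have "inj_on b ?S"
    using inj_onD[OF lam(2)] s0 by (auto intro!: inj_onI simp: b_def)
  moreover have "(b \<longlongrightarrow> sqrt l0) (at_right 0)"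
    unfolding b_def by (intro tendsto_real_sqrt lam(3))
  ultimately obtain g where g: "continuous_on (b ` ?S) g" "\<And>s. s \<in> ?S \<Longrightarrow> g (b s) = s"
    "is_interval (b ` ?S)" "interior (b ` ?S) \<noteq> {}" "sqrt l0 \<in> frontier (b ` ?S)"
    "(g \<longlongrightarrow> 0) (at (sqrt l0) within b ` ?S)"
    using curve_inverse[OF s0(1), of b "sqrt l0"] by blast
  have "unstable_curve_from (shear_profile A n) (sqrt l0) (1/2) (b ` ?S) (\<lambda>\<alpha>. 1/2 + \<i> * of_real (g \<alpha>))"
    unfolding unstable_curve_from_def
  proof (intro conjI ballI g(3-5))
    have "rayleigh_eigenfunction (shear_profile A n) (sqrt l0) (1/2 + \<i> * of_real 0) (phi 0 l0)"
      using eigenfunction_of_shoots[OF shoots_phi _ l0_pos, of 0] phi_1[of 0 l0] D_ground by simp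
    then show "neutral_eigenmode (shear_profile A n) (sqrt l0) (1/2)"
      unfolding neutral_eigenmode_def rayleigh_eigenmode_def using l0_pos by auto
    show "continuous_on (b ` ?S) (\<lambda>\<alpha>. 1/2 + \<i> * of_real (g \<alpha>))"
      by (intro continuous_intros g(1))
    have "((\<lambda>\<alpha>. 1/2 + \<i> * of_real (g \<alpha>)) \<longlongrightarrow> 1/2 + \<i> * of_real 0) (at (sqrt l0) within b ` ?S)"
      by (intro tendsto_intros g(6))
    then show "((\<lambda>\<alpha>. 1/2 + \<i> * of_real (g \<alpha>)) \<longlongrightarrow> 1/2) (at (sqrt l0) within b ` ?S)" by simp
    fix \<alpha> assume "\<alpha> \<in> b ` ?S"
    then obtain s where s: "s \<in> ?S" "\<alpha> = b s" by blast
    have pos: "lam s > 0" using s s0 s2(2)[of s] by auto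
    have "D s (lam s) = 0" using s s0 by (intro lam(4)) auto
    then have "rayleigh_eigenfunction (shear_profile A n) (sqrt (lam s)) (1/2 + \<i> * of_real s) (phi s (lam s))"
      using eigenfunction_of_shoots[OF shoots_phi _ pos, of s] phi_1[of s "lam s"] by simp
    then show "unstable_eigenmode (shear_profile A n) \<alpha> (1/2 + \<i> * of_real (g \<alpha>))"
      unfolding unstable_eigenmode_def rayleigh_eigenmode_def
      using s g(2)[OF s(1)] pos by (auto simp: b_def)
  qed
  moreover have "1/10 * real n \<le> sqrt l0"
    using l0 by (intro real_le_rsqrt) (simp add: power_divide power_mult_distrib)
  ultimately show ?thesis by blast
qed

end

theorem theorem3p2:
  fixes A :: real
  assumes "1 / 2 * (1 / (4 * pi)) < A" and "A < 1 / (4 * pi)"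
  shows "(\<forall>n::nat. n \<ge> 1 \<longrightarrow> linearly_unstable (shear_profile A n)) \<and>
    (\<exists>k::real. k > 0 \<and>
      (\<forall>n::nat. n \<ge> 1 \<longrightarrow>
        (\<exists>\<alpha>\<^sub>n I c.
           \<alpha>\<^sub>n \<ge> k * real n \<and>
           unstable_curve_from (shear_profile A n) \<alpha>\<^sub>n (1 / 2) I c \<and>
           (\<forall>\<alpha>\<in>I. \<forall>\<phi>. rayleigh_eigenfunction (shear_profile A n) \<alpha> (c \<alpha>) \<phi> \<longrightarrow>
              smooth_open_chan \<phi>))))"
proof -
  have branch: "\<exists>\<alpha>\<^sub>n I c. \<alpha>\<^sub>n \<ge> 1/10 * real n \<and> unstable_curve_from (shear_profile A n) \<alpha>\<^sub>n (1 / 2) I c \<and>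
      (\<forall>\<alpha>\<in>I. \<forall>\<phi>. rayleigh_eigenfunction (shear_profile A n) \<alpha> (c \<alpha>) \<phi> \<longrightarrow> smooth_open_chan \<phi>)"
    if "n \<ge> 1" for n
  proof -
    interpret shear A n by unfold_locales (use assms that in auto)
    obtain \<alpha>\<^sub>n I c where *: "\<alpha>\<^sub>n \<ge> 1/10 * real n" "unstable_curve_from (shear_profile A n) \<alpha>\<^sub>n (1 / 2) I c"
      using unstable_branch by blast
    moreover have "Im (c \<alpha>) > 0" if "\<alpha> \<in> I" for \<alpha>
      using *(2) that by (auto simp: unstable_curve_from_def unstable_eigenmode_def)
    ultimately show ?thesis using eigenfunction_smooth by blast
  qed
  moreover have "linearly_unstable (shear_profile A n)" if n: "n \<ge> 1" for n
  proof -
    obtain \<alpha>\<^sub>n I c where *: "unstable_curve_from (shear_profile A n) \<alpha>\<^sub>n (1 / 2) I c"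
      using branch[OF n] by blast
    then obtain \<alpha> where "\<alpha> \<in> I" using interior_subset by (auto simp: unstable_curve_from_def)
    then show ?thesis
      using * by (auto simp: unstable_curve_from_def linearly_unstable_def)
  qed
  ultimately show ?thesis
    by (intro conjI exI[of _ "1/10"]) auto
qed

end
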